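(* Let $F=K(x,y)/K(x)$ be the Kummer extension defined by $y^m=f(x)=\alpha\prod_{i=1}^r p_i(x)^{\lambda_i}$ described in the context. Suppose that $d_s=\gcd(m,\lambda_s)=1$ for some $0\leq s\leq r$, and let $\lambda\in\mathbb{Z}$ be the inverse of $\lambda_s$ modulo $m$. Let $$S=\left\{1\leq i\leq m-1\;\Big|\;\sum_{k=0}^r\left\lceil\frac{i\lambda\lambda_k}{m}\right\rceil d_k-1=0\right\}\cup\{m\}.$$ Define $$i_{\min}=\min S,\qquad i_{\max}=\arg\max_{1\leq i\leq m-1}\left(\sum_{k=0}^r\left\lceil\frac{i\lambda\lambda_k}{m}\right\rceil d_k-2\right),$$ $$j_{\max}=\max_{1\leq i\leq m-1}\left(\sum_{k=0}^r\left\lceil\frac{i\lambda\lambda_k}{m}\right\rceil d_k-2\right).$$ Then $m_{H(Q_s)}=i_{\min}$ and $F_{H(Q_s)}=mj_{\max}+i_{\max}$.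
   Context: Setting. Let $q$ be a prime power, $K$ an algebraic extension of $\mathbb{F}_q$, $m\geq 2$ an integer with $\gcd(m,q)=1$, and $r\geq 2$. Let $F=K(x,y)$ with $y^m=f(x)=\alpha\prod_{i=1}^r p_i(x)^{\lambda_i}$, where $\alpha\in K\setminus\{0\}$, $\lambda_i\in\mathbb{Z}\setminus\{0\}$, the $p_i(x)\in K[x]$ are pairwise distinct monic irreducible polynomials, and for every $d\mid m$ with $d\geq 2$, $f(x)$ is not a $d$-th power of an element of $K(x)$. ($K$ is not required to contain a primitive $m$-th root of unity; $K$ is the full constant field of $F$.) Put $d_i=\deg p_i$ for $1\leq i\leq r$, $d_0=1$, and $\lambda_0=-\sum_{i=1}^r\lambda_i d_i$. Let $P_i$ ($1\leq i\leq r$) be the place of $K(x)$ that is the zero of $p_i(x)$, and $P_0$ the pole of $x$. If $\gcd(m,\lambda_i)=1$, then $P_i$ is totally ramified in $F$ and $Q_i$ denotes the unique place of $F$ over $P_i$; it has degree $d_i$. For a rational (degree one) place $P$ of $F$, $H(P)=\{n\in\mathbb{N}_0 : \exists z\in F,\ (z)_\infty=nP\}$, where $(z)_\infty$ is the pole divisor, and $G(P)=\mathbb{N}_0\setminus H(P)$, which has exactly $g$ elements if the genus $g$ of $F$ is at least $1$. The multiplicity $m_{H(P)}$ is the smallest non-zero element of $H(P)$, and the Frobenius number $F_{H(P)}$ is the largest element of $G(P)$. *)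

theory Defs
  imports
    Complex_Main
    "HOL-Computational_Algebra.Computational_Algebra"
    "HOL-Number_Theory.Cong"
    "HOL-Number_Theory.Prime_Powers"
begin

definition is_subfield :: "'a::field set \<Rightarrow> bool" where
  "is_subfield L \<longleftrightarrow> 0 \<in> L \<and> 1 \<in> L \<and>
     (\<forall>a\<in>L. \<forall>b\<in>L. a + b \<in> L \<and> a - b \<in> L \<and> a * b \<in> L) \<and> (\<forall>a\<in>L. inverse a \<in> L)"

definition algebraic_over :: "'a::field set \<Rightarrow> 'a \<Rightarrow> bool" where
  "algebraic_over L z \<longleftrightarrow> (\<exists>g. g \<noteq> 0 \<and> (\<forall>i. coeff g i \<in> L) \<and> poly g z = 0)"

text \<open>Throughout, \<open>C\<close> is the field of constants, as a subset of the function field.\<close>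

definition valuation_ring :: "'f::field set \<Rightarrow> 'f set \<Rightarrow> bool" where
  "valuation_ring C R \<longleftrightarrow> 1 \<in> R \<and> (\<forall>a\<in>R. \<forall>b\<in>R. a - b \<in> R \<and> a * b \<in> R) \<and>
     C \<subset> R \<and> R \<subset> UNIV \<and> (\<forall>z. z \<in> R \<or> inverse z \<in> R)"

text \<open>A valuation ring is local; its maximal ideal is the set of its non-units.\<close>

definition place :: "'f::field set \<Rightarrow> 'f set \<Rightarrow> bool" where
  "place C P \<longleftrightarrow> (\<exists>R. valuation_ring C R \<and> P = {z \<in> R. \<not> (\<exists>w\<in>R. z * w = 1)})"

text \<open>The valuation ring is recovered from its place as the set of \<open>z\<close> with
  \<open>1 / z\<close> not in \<open>P\<close>; zero needs a separate clause because \<open>inverse 0 = 0\<close>.\<close>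

definition ring_of_place :: "'f::field set \<Rightarrow> 'f set" where
  "ring_of_place P = {z. z = 0 \<or> inverse z \<notin> P}"

definition prime_element :: "'f::field set \<Rightarrow> 'f \<Rightarrow> bool" where
  "prime_element P t \<longleftrightarrow> P = (\<lambda>a. t * a) ` ring_of_place P"

text \<open>Only meaningful for nonzero \<open>z\<close>.\<close>

definition place_val :: "'f::field set \<Rightarrow> 'f \<Rightarrow> int" where
  "place_val P z =
     (THE n. \<exists>t u. prime_element P t \<and> u \<in> ring_of_place P - P \<and> z = t powi n * u)"

text \<open>Divisors are integer-valued functions on places, extended by 0 to all other sets.\<close>

definition pole_divisor :: "'f::field set \<Rightarrow> 'f \<Rightarrow> 'f set \<Rightarrow> int" where
  "pole_divisor C z = (\<lambda>P. if place C P then max 0 (- place_val P z) else 0)"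

definition multiple_of_place :: "nat \<Rightarrow> 'f::field set \<Rightarrow> 'f set \<Rightarrow> int" where
  "multiple_of_place n P = (\<lambda>R. if R = P then int n else 0)"

definition weierstrass_semigroup :: "'f::field set \<Rightarrow> 'f set \<Rightarrow> nat set" where
  "weierstrass_semigroup C P =
     {n. \<exists>z. z \<noteq> 0 \<and> pole_divisor C z = multiple_of_place n P}"

definition semigroup_multiplicity :: "nat set \<Rightarrow> nat" where
  "semigroup_multiplicity H = (LEAST n. n \<in> H \<and> n \<noteq> 0)"

text \<open>The largest gap; for the semigroup without gaps (genus 0) we use the customary value
  \<open>-1\<close>, the largest integer outside it.\<close>

definition frobenius_number :: "nat set \<Rightarrow> int" where
  "frobenius_number H = (if - H = {} then -1 else int (Max (- H)))"

text \<open>The rational function field \<open>K(x)\<close> is \<open>'k poly fract\<close> and \<open>F\<close> is the type \<open>'f\<close>,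
  regarded as an extension of \<open>K(x)\<close> through a field homomorphism \<open>emb\<close>.\<close>

definition constants :: "('k::field poly fract \<Rightarrow> 'f::field) \<Rightarrow> 'f set" where
  "constants emb = range (\<lambda>c. emb (to_fract [:c:]))"

definition kummer_radicand ::
    "nat \<Rightarrow> 'k::field \<Rightarrow> (nat \<Rightarrow> 'k poly) \<Rightarrow> (nat \<Rightarrow> int) \<Rightarrow> 'k poly fract" where
  "kummer_radicand r \<alpha> p lam = to_fract [:\<alpha>:] * (\<Prod>i=1..r. to_fract (p i) powi lam i)"

text \<open>\<open>Fq\<close> is a copy of the field with \<open>q\<close> elements inside \<open>K\<close>. Only the values of
  \<open>p\<close> and \<open>lam\<close> at \<open>1, \<dots>, r\<close> matter.\<close>

locale kummer_extension =
  fixes q :: nat and Fq :: "'k::field set" and m r :: nat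
    and \<alpha> :: 'k and p :: "nat \<Rightarrow> 'k poly" and lam :: "nat \<Rightarrow> int"
    and emb :: "'k poly fract \<Rightarrow> 'f::field" and y :: 'f
  assumes q_primepow: "primepow q"
    and Fq_subfield: "is_subfield Fq" and Fq_card: "card Fq = q"
    and K_algebraic: "\<forall>a. algebraic_over Fq a"
    and m_ge_2: "m \<ge> 2" and m_coprime_q: "gcd m q = 1" and r_ge_2: "r \<ge> 2"
    and \<alpha>_nonzero: "\<alpha> \<noteq> 0"
    and lam_nonzero: "\<forall>i\<in>{1..r}. lam i \<noteq> 0"
    and p_monic: "\<forall>i\<in>{1..r}. lead_coeff (p i) = 1"
    and p_irreducible: "\<forall>i\<in>{1..r}. irreducible (p i)"
    and p_distinct: "inj_on p {1..r}"
    and radicand_not_power: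
      "\<forall>d. d dvd m \<and> d \<ge> 2 \<longrightarrow> \<not> (\<exists>g. kummer_radicand r \<alpha> p lam = g ^ d)"
    and emb_one: "emb 1 = 1"
    and emb_add: "\<forall>a b. emb (a + b) = emb a + emb b"
    and emb_mult: "\<forall>a b. emb (a * b) = emb a * emb b"
    and y_power: "y ^ m = emb (kummer_radicand r \<alpha> p lam)"
    and F_generated: "\<forall>L. is_subfield L \<and> range emb \<subseteq> L \<and> y \<in> L \<longrightarrow> L = UNIV"
    and full_constant_field: "\<forall>z. algebraic_over (constants emb) z \<longrightarrow> z \<in> constants emb"

text \<open>Index 0 is the pole of \<open>x\<close>: here \<open>d\<^sub>0 = 1\<close> and \<open>\<lambda>\<^sub>0\<close> is minus the degree of the radicand.\<close>

definition place_deg :: "(nat \<Rightarrow> 'k::field poly) \<Rightarrow> nat \<Rightarrow> nat" where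
  "place_deg p k = (if k = 0 then 1 else degree (p k))"

definition place_exp ::
    "nat \<Rightarrow> (nat \<Rightarrow> 'k::field poly) \<Rightarrow> (nat \<Rightarrow> int) \<Rightarrow> nat \<Rightarrow> int" where
  "place_exp r p lam k =
     (if k = 0 then - (\<Sum>i=1..r. lam i * int (degree (p i))) else lam k)"

definition finite_place :: "'k::field poly \<Rightarrow> 'k poly fract set" where
  "finite_place g = {Fract a b | a b. g dvd a \<and> \<not> g dvd b}"

definition infinite_place :: "'k::field poly fract set" where
  "infinite_place = {Fract a b | a b. b \<noteq> 0 \<and> (a = 0 \<or> degree a < degree b)}"

definition base_place :: "(nat \<Rightarrow> 'k::field poly) \<Rightarrow> nat \<Rightarrow> 'k poly fract set" where
  "base_place p k = (if k = 0 then infinite_place else finite_place (p k))"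

definition place_above ::
    "('k::field poly fract \<Rightarrow> 'f::field) \<Rightarrow> 'f set \<Rightarrow> 'k poly fract set \<Rightarrow> bool" where
  "place_above emb Q P \<longleftrightarrow> place (constants emb) Q \<and> emb ` P \<subseteq> Q"

definition ceiling_sum ::
    "nat \<Rightarrow> nat \<Rightarrow> (nat \<Rightarrow> 'k::field poly) \<Rightarrow> (nat \<Rightarrow> int) \<Rightarrow> int \<Rightarrow> nat \<Rightarrow> int" where
  "ceiling_sum m r p lam l i =
     (\<Sum>k=0..r. \<lceil>real_of_int (int i * l * place_exp r p lam k) / real m\<rceil> * int (place_deg p k))"

end

theory Submission
  imports "HOL-Algebra.Algebraic_Closure_Type" Defs
begin

text \<open>
  Put \<open>u = y\<^sup>-\<^sup>l\<close> and \<open>u\<^sup>m = h\<close>. At the place \<open>P\<^sub>s\<close> the values of the terms of \<open>\<Sum>i<m. a\<^sub>i u\<^sup>i\<close> are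
  distinct modulo \<open>m\<close>, so the powers of \<open>u\<close> form a basis of \<open>F\<close> over \<open>K(x)\<close>, \<open>Q\<^sub>s\<close> is the only place over
  \<open>P\<^sub>s\<close>, and the pole order at \<open>Q\<^sub>s\<close> is attained by a single term. If the sum is regular outside \<open>Q\<^sub>s\<close>,
  then so is each term: over an algebraic closure of \<open>F\<close>, \<open>m a\<^sub>i u\<^sup>i\<close> is a combination of the conjugates
  under \<open>u \<mapsto> \<zeta> u\<close>, and these lie in every valuation ring over a place other than \<open>P\<^sub>s\<close>. Hence \<open>H(Q\<^sub>s)\<close>
  consists of the pole orders of the elements \<open>a u\<^sup>i\<close>, and the degree formula for \<open>a \<in> K(x)\<close> shows that
  the least such order congruent to \<open>i\<close> modulo \<open>m\<close> is \<open>m (c\<^sub>i - 1) + i\<close>, where \<open>c\<^sub>i\<close> is the ceiling sum.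
\<close>

subsection \<open>Discrete valuations and their places\<close>

text \<open>The exponent \<open>- l\<close> gives \<open>h\<close> the value -1 modulo
  \<open>m\<close> at P_s, so the pole order of \<open>a u^i\<close> at Q_s is congruent to
  \<open>i\<close> itself and the residue classes modulo \<open>m\<close> are indexed by the power
  of \<open>u\<close>. Two obstacles shape the proof. The roots of unity \<zeta> need not lie in F,
  so the conjugations map into an algebraic closure, where an extension of a discrete valuation need
  not be discrete; that part works with valuation rings obtained by maximality, not with integer
  values. On the other hand \<open>place_val\<close> is defined through prime elements, so every
  valuation ring of F over K has to be shown discrete before a pole divisor can be evaluated. The
  ceilings arise because regularity of \<open>a u^i\<close> over P_k bounds the value of
  \<open>a\<close> below by a fraction with denominator \<open>m\<close>, rounded up. In the class
  \<open>i > 0\<close> the largest integer outside the semigroup is \<open>m (c_i - 2) + i\<close>,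
  a gap unless \<open>c_i = 1\<close>; the lexicographic maximum of \<open>(c_i - 2, i)\<close>
  gives the Frobenius number, and gives -1 when every \<open>c_i\<close> is 1.\<close>

locale valuation =
  fixes v :: "'a::field \<Rightarrow> int"
  assumes val_mult: "a \<noteq> 0 \<Longrightarrow> b \<noteq> 0 \<Longrightarrow> v (a * b) = v a + v b"
    and val_add: "a \<noteq> 0 \<Longrightarrow> b \<noteq> 0 \<Longrightarrow> a + b \<noteq> 0 \<Longrightarrow> min (v a) (v b) \<le> v (a + b)"
    and val_surj: "\<exists>a. a \<noteq> 0 \<and> v a = 1"

definition vring :: "('a::field \<Rightarrow> int) \<Rightarrow> 'a set" where
  "vring v = {a. a = 0 \<or> 0 \<le> v a}"

definition vmax :: "('a::field \<Rightarrow> int) \<Rightarrow> 'a set" where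
  "vmax v = {a. a = 0 \<or> 0 < v a}"

context valuation
begin

lemma val_one [simp]: "v 1 = 0"
  using val_mult[of 1 1] by simp

lemma val_inverse: "a \<noteq> 0 \<Longrightarrow> v (inverse a) = - v a"
  using val_mult[of a "inverse a"] by simp

lemma val_divide: "a \<noteq> 0 \<Longrightarrow> b \<noteq> 0 \<Longrightarrow> v (a / b) = v a - v b"
  by (simp add: divide_inverse val_mult val_inverse)

lemma val_power: "a \<noteq> 0 \<Longrightarrow> v (a ^ n) = int n * v a"
  by (induction n) (auto simp: val_mult algebra_simps)

lemma val_power_int: "a \<noteq> 0 \<Longrightarrow> v (a powi n) = n * v a"
  by (auto simp: power_int_def val_power val_inverse)

lemma val_minus: "v (- a) = v a"
proof (cases "a = 0")
  case False
  have "2 * v (- 1) = 0"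
    using val_mult[of "-1" "-1"] by simp
  then show ?thesis
    using val_mult[of "-1" a] False by simp
qed simp

lemma val_prod:
  "finite A \<Longrightarrow> (\<And>i. i \<in> A \<Longrightarrow> a i \<noteq> 0) \<Longrightarrow> v (\<Prod>i\<in>A. a i) = (\<Sum>i\<in>A. v (a i))"
  by (induction A rule: finite_induct) (auto simp: val_mult)

lemma val_sum_ge:
  assumes "finite A" "\<And>i. i \<in> A \<Longrightarrow> a i \<noteq> 0 \<Longrightarrow> c \<le> v (a i)" "(\<Sum>i\<in>A. a i) \<noteq> 0"
  shows "c \<le> v (\<Sum>i\<in>A. a i)"
  using assms
proof (induction A rule: finite_induct)
  case (insert i A)
  show ?case
  proof (cases "a i = 0 \<or> (\<Sum>i\<in>A. a i) = 0")
    case True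
    then show ?thesis using insert by auto
  next
    case False
    then show ?thesis using insert val_add[of "a i" "\<Sum>i\<in>A. a i"] by fastforce
  qed
qed simp

lemma val_sum_eq:
  assumes "finite A" "i \<in> A" "a i \<noteq> 0"
    and "\<And>j. j \<in> A \<Longrightarrow> j \<noteq> i \<Longrightarrow> a j \<noteq> 0 \<Longrightarrow> v (a i) < v (a j)"
  shows "(\<Sum>j\<in>A. a j) \<noteq> 0 \<and> v (\<Sum>j\<in>A. a j) = v (a i)"
proof -
  let ?s = "\<Sum>j\<in>A - {i}. a j"
  have eq: "(\<Sum>j\<in>A. a j) = a i + ?s"
    using assms(1,2) by (simp add: sum.remove)
  show ?thesis
  proof (cases "?s = 0")
    case True
    then show ?thesis using eq assms(3) by simp
  next
    case False
    have lt: "v (a i) + 1 \<le> v ?s"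
      using assms(4) by (intro val_sum_ge) (use assms(1) False in \<open>auto simp: zless_imp_add1_zle\<close>)
    have nz: "a i + ?s \<noteq> 0"
    proof
      assume "a i + ?s = 0"
      then have "?s = - a i" by (simp add: eq_neg_iff_add_eq_0 add.commute)
      then show False using lt val_minus[of "a i"] by simp
    qed
    \<comment> \<open>The ultrametric inequality is used backwards, on
      \<open>a i = (a i + ?s) - ?s\<close>: as \<open>?s\<close> has larger value than
      \<open>a i\<close>, the minimum must be \<open>v (a i + ?s)\<close>.\<close>
    have "min (v (a i + ?s)) (v (- ?s)) \<le> v ((a i + ?s) + - ?s)"
      using nz False assms(3) by (intro val_add) auto
    then have "v (a i + ?s) \<le> v (a i)" using lt by (simp add: val_minus)
    moreover have "min (v (a i)) (v ?s) \<le> v (a i + ?s)"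
      using nz False assms(3) by (intro val_add) auto
    ultimately show ?thesis using nz eq lt by auto
  qed
qed

lemma ring_of_place_vmax: "ring_of_place (vmax v) = vring v"
  by (auto simp: ring_of_place_def vmax_def vring_def val_inverse)

lemma vring_minus_vmax: "vring v - vmax v = {u. u \<noteq> 0 \<and> v u = 0}"
  by (auto simp: vmax_def vring_def)

text \<open>If \<open>t\<close> generates the maximal ideal, an element of value 1, which exists by
  surjectivity, is some \<open>t * b\<close> with \<open>v t \<ge> 1\<close> and
  \<open>v b \<ge> 0\<close>; this leaves only \<open>v t = 1\<close>.\<close>

lemma prime_element_vmax: "prime_element (vmax v) t \<longleftrightarrow> t \<noteq> 0 \<and> v t = 1"
proof
  assume t: "t \<noteq> 0 \<and> v t = 1"
  have "z \<in> (\<lambda>a. t * a) ` vring v" if "z \<in> vmax v" for z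
    using that t
    by (intro image_eqI[of _ _ "z / t"]) (cases "z = 0"; auto simp: vmax_def vring_def val_divide)+
  moreover have "t * a \<in> vmax v" if "a \<in> vring v" for a
    using that t by (cases "a = 0") (auto simp: vmax_def vring_def val_mult)
  ultimately show "prime_element (vmax v) t"
    unfolding prime_element_def ring_of_place_vmax by blast
next
  assume "prime_element (vmax v) t"
  then have eq: "vmax v = (\<lambda>a. t * a) ` vring v"
    by (simp add: prime_element_def ring_of_place_vmax)
  obtain a where a: "a \<noteq> 0" "v a = 1" using val_surj by auto
  then have "a \<in> vmax v" by (simp add: vmax_def)
  then obtain b where b: "b \<in> vring v" "a = t * b" using eq by auto
  have "t \<noteq> 0" "b \<noteq> 0" using a b by auto
  have "1 \<in> vring v" by (simp add: vring_def)
  then have "t * 1 \<in> vmax v" unfolding eq by (rule imageI)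
  then show "t \<noteq> 0 \<and> v t = 1"
    using a b \<open>t \<noteq> 0\<close> \<open>b \<noteq> 0\<close> val_mult[of t b] by (auto simp: vmax_def vring_def)
qed

text \<open>Prime elements are exactly the elements of value 1, so the exponent in the description
  is forced. All pole divisors are evaluated through this.\<close>

lemma place_val_vmax:
  assumes "z \<noteq> 0" shows "place_val (vmax v) z = v z"
  unfolding place_val_def prime_element_vmax ring_of_place_vmax vring_minus_vmax
proof (rule the_equality)
  obtain t where t: "t \<noteq> 0" "v t = 1" using val_surj by auto
  show "\<exists>t u. (t \<noteq> 0 \<and> v t = 1) \<and> u \<in> {u. u \<noteq> 0 \<and> v u = 0} \<and> z = t powi v z * u"
    using assms t
    by (intro exI[of _ t] exI[of _ "z / t powi v z"]) (auto simp: val_divide val_power_int)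
next
  fix n assume "\<exists>t u. (t \<noteq> 0 \<and> v t = 1) \<and> u \<in> {u. u \<noteq> 0 \<and> v u = 0} \<and> z = t powi n * u"
  then show "n = v z" by (auto simp: val_mult val_power_int)
qed

end

subsection \<open>Valuation rings\<close>

lemma valuation_ring_one: "valuation_ring C R \<Longrightarrow> 1 \<in> R"
  and valuation_ring_diff: "valuation_ring C R \<Longrightarrow> a \<in> R \<Longrightarrow> b \<in> R \<Longrightarrow> a - b \<in> R"
  and valuation_ring_mult: "valuation_ring C R \<Longrightarrow> a \<in> R \<Longrightarrow> b \<in> R \<Longrightarrow> a * b \<in> R"
  and valuation_ring_total: "valuation_ring C R \<Longrightarrow> a \<in> R \<or> inverse a \<in> R"
  and valuation_ring_constants: "valuation_ring C R \<Longrightarrow> c \<in> C \<Longrightarrow> c \<in> R"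
  and valuation_ring_proper: "valuation_ring C R \<Longrightarrow> R \<noteq> UNIV"
  by (auto simp: valuation_ring_def)

lemma valuation_ring_zero: "valuation_ring C R \<Longrightarrow> 0 \<in> R"
  using valuation_ring_diff[of C R 1 1] valuation_ring_one[of C R] by simp

lemma valuation_ring_uminus: "valuation_ring C R \<Longrightarrow> a \<in> R \<Longrightarrow> - a \<in> R"
  using valuation_ring_diff[of C R 0 a] valuation_ring_zero[of C R] by simp

lemma valuation_ring_add: "valuation_ring C R \<Longrightarrow> a \<in> R \<Longrightarrow> b \<in> R \<Longrightarrow> a + b \<in> R"
  using valuation_ring_diff[of C R a "- b"] valuation_ring_uminus[of C R b] by simp

lemma valuation_ring_power: "valuation_ring C R \<Longrightarrow> a \<in> R \<Longrightarrow> a ^ n \<in> R"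
  by (induction n) (auto simp: valuation_ring_one valuation_ring_mult)

lemma valuation_ring_sum:
  "valuation_ring C R \<Longrightarrow> (\<And>i. i \<in> A \<Longrightarrow> a i \<in> R) \<Longrightarrow> (\<Sum>i\<in>A. a i) \<in> R"
  by (induction A rule: infinite_finite_induct) (auto simp: valuation_ring_zero valuation_ring_add)

text \<open>A case of integral closedness: if only \<open>inverse a\<close> lay in \<open>R\<close>,
  the product \<open>inverse a ^ (n - 1) * a ^ n = a\<close> would bring \<open>a\<close>
  back.\<close>

lemma valuation_ring_root:
  assumes R: "valuation_ring C R" and "n > 0" "a ^ n \<in> R"
  shows "a \<in> R"
proof (cases "a = 0")
  case False
  show ?thesis
  proof (rule ccontr)
    assume "a \<notin> R"
    then have "inverse a \<in> R" using valuation_ring_total[OF R] by blast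
    then have "inverse a ^ (n - 1) * a ^ n \<in> R"
      using R assms(3) valuation_ring_power valuation_ring_mult by blast
    moreover have "inverse a ^ (n - 1) * a ^ n = a"
      using False \<open>n > 0\<close> by (cases n) (auto simp: field_simps)
    ultimately show False using \<open>a \<notin> R\<close> by simp
  qed
qed (use valuation_ring_zero[OF R] in simp)

lemma valuation_ring_nonunits:
  assumes R: "valuation_ring C R"
  shows "{z \<in> R. \<not> (\<exists>w\<in>R. z * w = 1)} = {z. z = 0 \<or> inverse z \<notin> R}"
proof -
  have "z \<in> R \<and> \<not> (\<exists>w\<in>R. z * w = 1) \<longleftrightarrow> z = 0 \<or> inverse z \<notin> R" for z
  proof (cases "z = 0")
    case True
    then show ?thesis using valuation_ring_zero[OF R] by simp
  next
    case False
    then have "(\<exists>w\<in>R. z * w = 1) \<longleftrightarrow> inverse z \<in> R"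
      using right_inverse[OF False] inverse_unique[of z] by metis
    then show ?thesis using False valuation_ring_total[OF R, of z] by blast
  qed
  then show ?thesis by blast
qed

lemma place_iff:
  "place C P \<longleftrightarrow> (\<exists>R. valuation_ring C R \<and> P = {z. z = 0 \<or> inverse z \<notin> R})"
proof -
  have "valuation_ring C R \<and> P = {z \<in> R. \<not> (\<exists>w\<in>R. z * w = 1)} \<longleftrightarrow>
    valuation_ring C R \<and> P = {z. z = 0 \<or> inverse z \<notin> R}" for R
    using valuation_ring_nonunits[of C R] by auto
  then show ?thesis unfolding place_def by presburger
qed

lemma ring_of_place_eq:
  assumes "valuation_ring C R" "P = {z. z = 0 \<or> inverse z \<notin> R}"
  shows "ring_of_place P = R"
  using assms valuation_ring_zero[OF assms(1)] by (auto simp: ring_of_place_def)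

text \<open>Of \<open>a / b\<close> and \<open>b / a\<close> one lies in \<open>R\<close>;
  multiplying \<open>inverse (a - b)\<close> by \<open>a / b - 1\<close> or by
  \<open>1 - b / a\<close> gives the inverse of \<open>b\<close> or of \<open>a\<close>.\<close>

lemma valuation_ring_nonunit_diff:
  assumes R: "valuation_ring C R" and "a = 0 \<or> inverse a \<notin> R" "b = 0 \<or> inverse b \<notin> R"
  shows "a - b = 0 \<or> inverse (a - b) \<notin> R"
proof (rule ccontr)
  assume "\<not> ?thesis"
  then have ab: "a - b \<noteq> 0" "inverse (a - b) \<in> R" by auto
  then have nz: "a \<noteq> 0 \<or> b \<noteq> 0" by auto
  show False
  proof (cases "a = 0 \<or> b = 0")
    case True
    then show False
      using ab assms valuation_ring_uminus[OF R ab(2)] by auto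
  next
    case False
    consider "a / b \<in> R" | "b / a \<in> R"
      using valuation_ring_total[OF R, of "a / b"] False by auto
    then show False
    proof cases
      case 1
      then have "inverse (a - b) * (a / b - 1) \<in> R"
        using ab valuation_ring_mult[OF R] valuation_ring_diff[OF R] valuation_ring_one[OF R] by blast
      moreover have "inverse (a - b) * (a / b - 1) = inverse b"
        using ab False by (simp add: field_simps)
      ultimately show False using assms(3) False by simp
    next
      case 2
      then have "inverse (a - b) * (1 - b / a) \<in> R"
        using ab valuation_ring_mult[OF R] valuation_ring_diff[OF R] valuation_ring_one[OF R] by blast
      moreover have "inverse (a - b) * (1 - b / a) = inverse a"
        using ab False by (simp add: field_simps)
      ultimately show False using assms(2) False by simp
    qed
  qed
qed

lemma valuation_ring_nonunit_mult:
  assumes R: "valuation_ring C R" and a: "a \<in> R" and b: "b = 0 \<or> inverse b \<notin> R"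
  shows "a * b = 0 \<or> inverse (a * b) \<notin> R"
proof (rule ccontr)
  assume "\<not> ?thesis"
  then have "a \<noteq> 0" "b \<noteq> 0" "inverse (a * b) \<in> R" by auto
  moreover have "a * inverse (a * b) = inverse b" using \<open>a \<noteq> 0\<close> by simp
  ultimately show False using b valuation_ring_mult[OF R a, of "inverse (a * b)"] by metis
qed

text \<open>Divisibility with quotient in \<open>R\<close> is a total preorder on nonzero elements.
  This replaces a minimum of values where no value group is available.\<close>

lemma valuation_ring_least:
  assumes R: "valuation_ring C R" and "finite A" "A \<noteq> {}" "\<And>x. x \<in> A \<Longrightarrow> f x \<noteq> 0"
  shows "\<exists>x\<in>A. \<forall>y\<in>A. f y / f x \<in> R"
  using assms(2-4)
proof (induction A rule: finite_ne_induct)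
  case (singleton x)
  then show ?case using valuation_ring_one[OF R] by simp
next
  case (insert x A)
  then obtain z where z: "z \<in> A" "\<forall>y\<in>A. f y / f z \<in> R" by auto
  have nz: "f x \<noteq> 0" "f z \<noteq> 0" using insert.prems z by auto
  show ?case
  proof (cases "f x / f z \<in> R")
    case True
    then show ?thesis using z by auto
  next
    case False
    then have zx: "f z / f x \<in> R" using valuation_ring_total[OF R, of "f x / f z"] by auto
    have "f y / f x \<in> R" if "y \<in> A" for y
    proof -
      have "f y / f z * (f z / f x) \<in> R" using valuation_ring_mult[OF R] z(2) that zx by blast
      then show ?thesis using nz by simp
    qed
    then show ?thesis using valuation_ring_one[OF R] nz by auto
  qed
qed

text \<open>One element \<open>z\<close> of negative value suffices to reach the whole field: every
  \<open>y\<close> becomes integral after division by a high power of \<open>z\<close>. Inclusions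
  of rings are upgraded to equalities by this.\<close>

lemma (in valuation) vring_maximal:
  assumes mult: "\<And>a b. a \<in> R \<Longrightarrow> b \<in> R \<Longrightarrow> a * b \<in> R"
    and sub: "vring v \<subseteq> R" and ne: "R \<noteq> UNIV"
  shows "R = vring v"
proof (rule ccontr)
  assume "R \<noteq> vring v"
  then obtain z where z: "z \<in> R" "z \<notin> vring v" using sub by blast
  then have z0: "z \<noteq> 0" "v z < 0" by (auto simp: vring_def)
  have pow: "z ^ n \<in> R" for n
    using z sub by (induction n) (auto simp: vring_def mult)
  have "y \<in> R" for y
  proof (cases "y = 0")
    case False
    let ?n = "nat \<bar>v y\<bar>"
    have "v (y / z ^ ?n) = v y - \<bar>v y\<bar> * v z"
      using False z0 by (simp add: val_divide val_power)
    moreover have "\<bar>v y\<bar> * v z \<le> - \<bar>v y\<bar>"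
      using mult_left_mono[of "v z" "-1" "\<bar>v y\<bar>"] z0 by simp
    ultimately have "y / z ^ ?n \<in> R" using sub by (auto simp: vring_def)
    then have "y / z ^ ?n * z ^ ?n \<in> R" using pow mult by blast
    then show ?thesis using z0 by simp
  qed (use sub in \<open>auto simp: vring_def\<close>)
  then show False using ne by blast
qed

text \<open>The image of \<open>V\<close> is a nonzero subgroup of the integers, hence generated by some \<open>g > 0\<close>.\<close>

lemma valuation_ring_discrete:
  fixes V :: "'a::field \<Rightarrow> int"
  assumes R: "valuation_ring C R"
    and mult: "\<And>a b. a \<noteq> 0 \<Longrightarrow> b \<noteq> 0 \<Longrightarrow> V (a * b) = V a + V b"
    and mem: "\<And>a. a \<noteq> 0 \<Longrightarrow> a \<in> R \<longleftrightarrow> 0 \<le> V a"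
  obtains v g where "valuation v" "vring v = R" "g > 0" "\<And>a. a \<noteq> 0 \<Longrightarrow> V a = g * v a"
proof -
  have V1: "V 1 = 0" using mult[of 1 1] by simp
  have Vinv: "V (inverse a) = - V a" if "a \<noteq> 0" for a
    using mult[of a "inverse a"] that V1 by simp
  have Vpow: "V (a ^ n) = int n * V a" if "a \<noteq> 0" for a n
    using that by (induction n) (auto simp: mult V1 algebra_simps)
  have Vpowi: "V (a powi n) = n * V a" if "a \<noteq> 0" for a n
    using that by (auto simp: power_int_def Vpow Vinv)
  define G where "G = {n::nat. n > 0 \<and> (\<exists>a. a \<noteq> 0 \<and> V a = int n)}"
  obtain b where b: "b \<notin> R" using valuation_ring_proper[OF R] by blast
  then have b0: "b \<noteq> 0" using valuation_ring_zero[OF R] by blast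
  with b mem have "V b < 0" by force
  then have "nat (- V b) \<in> G" using b0 Vinv[OF b0] by (auto simp: G_def intro!: exI[of _ "inverse b"])
  then have L: "(LEAST n. n \<in> G) \<in> G" by (rule LeastI)
  define g where "g = int (LEAST n. n \<in> G)"
  obtain t where t: "t \<noteq> 0" "V t = g" and g: "g > 0" using L by (auto simp: G_def g_def)
  have dvd: "g dvd V a" if "a \<noteq> 0" for a
  proof (rule ccontr)
    assume "\<not> g dvd V a"
    then have "V a mod g > 0" using g by (metis dvd_eq_mod_eq_0 pos_mod_sign order_le_less)
    \<comment> \<open>Division with remainder: the remainder is itself a value, contrary to the
      choice of \<open>g\<close> as the least positive one.\<close>
    moreover have "V (a * t powi (- (V a div g))) = V a mod g"
      using that t by (simp add: mult Vpowi minus_div_mult_eq_mod)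
    ultimately have "nat (V a mod g) \<in> G" using that t by (auto simp: G_def intro!: exI[of _ "a * t powi (- (V a div g))"])
    then have "(LEAST n. n \<in> G) \<le> nat (V a mod g)" by (rule Least_le)
    then show False using g pos_mod_bound[OF g, of "V a"] unfolding g_def by linarith
  qed
  define v where "v a = V a div g" for a
  have Vv: "V a = g * v a" if "a \<noteq> 0" for a using dvd[OF that] by (simp add: v_def)
  have v_mult: "v (a * c) = v a + v c" if "a \<noteq> 0" "c \<noteq> 0" for a c
    using mult[OF that] Vv[of a] Vv[of c] Vv[of "a * c"] that g
    by (simp add: distrib_left[symmetric])
  have v_mem: "a \<in> R \<longleftrightarrow> 0 \<le> v a" if "a \<noteq> 0" for a
    using mem[OF that] Vv[OF that] g by (simp add: zero_le_mult_iff)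
  \<comment> \<open>About \<open>V\<close> only the sign criterion for membership in
    \<open>R\<close> is known; the ultrametric inequality comes from \<open>a / c + 1\<close> lying
    in \<open>R\<close> with \<open>a / c\<close>.\<close>
  have v_add_aux: "v c \<le> v (a + c)" if "a \<noteq> 0" "c \<noteq> 0" "a + c \<noteq> 0" "v c \<le> v a" for a c
  proof -
    have "v (a / c) + v c = v a" using v_mult[of "a / c" c] that by simp
    then have "a / c \<in> R" using v_mem[of "a / c"] that by simp
    then have "a / c + 1 \<in> R" using R valuation_ring_add valuation_ring_one by blast
    moreover have eq: "a / c + 1 = (a + c) / c" using that by (simp add: field_simps)
    ultimately have "0 \<le> v ((a + c) / c)" using v_mem[of "(a + c) / c"] that by simp
    moreover have "v ((a + c) / c) + v c = v (a + c)" using v_mult[of "(a + c) / c" c] that by simp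
    ultimately show ?thesis by simp
  qed
  have "valuation v"
  proof
    fix a c :: 'a assume *: "a \<noteq> 0" "c \<noteq> 0"
    then show "v (a * c) = v a + v c" by (rule v_mult)
    assume "a + c \<noteq> 0"
    then show "min (v a) (v c) \<le> v (a + c)"
      using * v_add_aux[of a c] v_add_aux[of c a] by (cases "v c \<le> v a") (auto simp: add.commute)
  next
    show "\<exists>a. a \<noteq> 0 \<and> v a = 1" using t g by (auto simp: v_def)
  qed
  moreover have "vring v = R"
  proof (rule Set.set_eqI)
    show "a \<in> vring v \<longleftrightarrow> a \<in> R" for a
      using v_mem[of a] valuation_ring_zero[OF R] by (cases "a = 0") (simp_all add: vring_def)
  qed
  ultimately show thesis using that[of v g] g Vv by simp
qed

subsection \<open>Valuations of the rational function field\<close>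

text \<open>A fraction has no distinguished numerator and denominator, hence the description;
  additivity of \<open>d\<close> makes \<open>d a - d b\<close> independent of the choice.\<close>

definition fract_ext :: "('k::field poly \<Rightarrow> int) \<Rightarrow> 'k poly fract \<Rightarrow> int" where
  "fract_ext d z = (THE n. \<exists>a b. a \<noteq> 0 \<and> b \<noteq> 0 \<and> z = Fract a b \<and> n = d a - d b)"

definition additive_on_nonzero :: "('k::field poly \<Rightarrow> int) \<Rightarrow> bool" where
  "additive_on_nonzero d \<longleftrightarrow> (\<forall>a b. a \<noteq> 0 \<longrightarrow> b \<noteq> 0 \<longrightarrow> d (a * b) = d a + d b)"

lemma fract_ext_Fract:
  assumes d: "additive_on_nonzero d" and nz: "a \<noteq> 0" "b \<noteq> 0"
  shows "fract_ext d (Fract a b) = d a - d b"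
  unfolding fract_ext_def
proof (rule the_equality)
  fix n assume "\<exists>a' b'. a' \<noteq> 0 \<and> b' \<noteq> 0 \<and> Fract a b = Fract a' b' \<and> n = d a' - d b'"
  then obtain a' b' where *: "a' \<noteq> 0" "b' \<noteq> 0" "Fract a b = Fract a' b'" "n = d a' - d b'" by blast
  then have "a * b' = a' * b" using nz by (simp add: eq_fract)
  then have "d a + d b' = d a' + d b" using d * nz unfolding additive_on_nonzero_def by metis
  then show "n = d a - d b" using * by simp
next
  show "\<exists>a' b'. a' \<noteq> 0 \<and> b' \<noteq> 0 \<and> Fract a b = Fract a' b' \<and> d a - d b = d a' - d b'"
    by (rule exI[of _ a], rule exI[of _ b]) (simp add: nz)
qed

lemma Fract_nonzero_cases:
  fixes z :: "'k::field poly fract"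
  assumes "z \<noteq> 0" obtains a b where "a \<noteq> 0" "b \<noteq> 0" "z = Fract a b"
proof (cases z)
  case (Fract a b)
  then show thesis using assms that by (cases "a = 0") (auto simp: fract_collapse)
qed

lemma valuation_fract_ext:
  assumes d: "additive_on_nonzero d"
    and add: "\<And>a b. a \<noteq> 0 \<Longrightarrow> b \<noteq> 0 \<Longrightarrow> a + b \<noteq> 0 \<Longrightarrow> min (d a) (d b) \<le> d (a + b)"
    and surj: "a0 \<noteq> 0" "b0 \<noteq> 0" "d a0 - d b0 = 1"
  shows "valuation (fract_ext d)"
proof
  fix z w :: "'a poly fract" assume "z \<noteq> 0" "w \<noteq> 0"
  then obtain a b c e where ab: "a \<noteq> 0" "b \<noteq> 0" "z = Fract a b"
    and ce: "c \<noteq> 0" "e \<noteq> 0" "w = Fract c e" by (meson Fract_nonzero_cases)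
  have mult: "d (s * t) = d s + d t" if "s \<noteq> 0" "t \<noteq> 0" for s t
    using d that by (simp add: additive_on_nonzero_def)
  show "fract_ext d (z * w) = fract_ext d z + fract_ext d w"
    using ab ce by (simp add: fract_ext_Fract[OF d] mult)
  assume zw: "z + w \<noteq> 0"
  have eq: "z + w = Fract (a * e + c * b) (b * e)" using ab ce by simp
  with zw have nz: "a * e + c * b \<noteq> 0" using fract_collapse by metis
  have "min (d (a * e)) (d (c * b)) \<le> d (a * e + c * b)"
    using ab ce nz by (intro add) auto
  then show "min (fract_ext d z) (fract_ext d w) \<le> fract_ext d (z + w)"
    using eq ab ce nz by (simp add: fract_ext_Fract[OF d] mult)
next
  have "Fract a0 b0 \<noteq> 0" using surj by (simp add: Zero_fract_def eq_fract)
  then show "\<exists>a. a \<noteq> 0 \<and> fract_ext d a = 1"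
    using surj fract_ext_Fract[OF d surj(1,2)] by auto
qed

section \<open>Multiplicity of an irreducible polynomial\<close>

definition pmult :: "'k::field poly \<Rightarrow> 'k poly \<Rightarrow> nat" where
  "pmult g a = (GREATEST n. g ^ n dvd a)"

text \<open>An irreducible \<open>g\<close> is not constant, so each power raises the degree; the
  bound makes the greatest exponent in \<open>pmult\<close> exist.\<close>

lemma irreducible_power_dvd_bound:
  fixes g :: "'k::field poly"
  assumes g: "irreducible g" and "a \<noteq> 0" "g ^ n dvd a" shows "n \<le> degree a"
proof -
  have "degree g > 0" using g by (auto simp: irreducible_def is_unit_iff_degree)
  then have "n \<le> n * degree g" by simp
  also have "\<dots> = degree (g ^ n)" using g by (simp add: degree_power_eq irreducible_def)
  also have "\<dots> \<le> degree a" using assms by (intro dvd_imp_degree_le)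
  finally show ?thesis .
qed

lemma pmult_dvd:
  assumes "irreducible g" "a \<noteq> 0" shows "g ^ pmult g a dvd a"
  unfolding pmult_def
  by (rule GreatestI_nat[of _ 0 "degree a"]) (use irreducible_power_dvd_bound[OF assms] in auto)

lemma pmult_ge:
  assumes "irreducible g" "a \<noteq> 0" "g ^ n dvd a" shows "n \<le> pmult g a"
  unfolding pmult_def
  by (rule Greatest_le_nat[of _ _ "degree a"]) (use irreducible_power_dvd_bound[OF assms(1,2)] assms in auto)

lemma pmult_eqI:
  assumes g: "irreducible g" and "a = g ^ n * b" "\<not> g dvd b"
  shows "pmult g a = n"
proof -
  have g0: "g \<noteq> 0" and a0: "a \<noteq> 0" using assms by (auto simp: irreducible_def)
  have "\<not> n < pmult g a"
  proof
    assume "n < pmult g a"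
    then have "g ^ Suc n dvd a"
      using pmult_dvd[OF g a0] by (meson Suc_leI dvd_trans le_imp_power_dvd)
    then show False using assms g0 by simp
  qed
  moreover have "n \<le> pmult g a" using assms a0 by (intro pmult_ge) auto
  ultimately show ?thesis by simp
qed

lemma pmult_decompose:
  assumes "irreducible g" "a \<noteq> 0"
  obtains b where "a = g ^ pmult g a * b" "\<not> g dvd b"
proof -
  obtain b where b: "a = g ^ pmult g a * b" using pmult_dvd[OF assms] by (elim dvdE)
  have "\<not> g dvd b"
  proof
    assume "g dvd b"
    then have "g ^ Suc (pmult g a) dvd a"
      using mult_dvd_mono[of g b "g ^ pmult g a"] b by (metis dvd_refl mult.commute power_Suc)
    then show False using pmult_ge[OF assms] by fastforce
  qed
  with b show thesis by (rule that)
qed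

lemma pmult_eq_0: "irreducible g \<Longrightarrow> \<not> g dvd a \<Longrightarrow> pmult g a = 0"
  by (rule pmult_eqI[of g a 0 a]) auto

lemma pmult_one: "irreducible g \<Longrightarrow> pmult g 1 = 0"
  by (rule pmult_eq_0) (auto simp: irreducible_def)

lemma pmult_self: "irreducible g \<Longrightarrow> pmult g g = 1"
  by (rule pmult_eqI[of g g 1 1]) (auto simp: irreducible_def)

text \<open>The cofactors left after removing the powers of \<open>g\<close> are not divisible by
  \<open>g\<close>, nor is their product, because an irreducible polynomial over a field is
  prime.\<close>

lemma pmult_mult:
  fixes g :: "'k::field poly"
  assumes g: "irreducible g" and "a \<noteq> 0" "b \<noteq> 0"
  shows "pmult g (a * b) = pmult g a + pmult g b"
proof -
  obtain a' where a: "a = g ^ pmult g a * a'" "\<not> g dvd a'" using pmult_decompose g assms(2) .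
  obtain b' where b: "b = g ^ pmult g b * b'" "\<not> g dvd b'" using pmult_decompose g assms(3) .
  have "\<not> g dvd a' * b'"
    using field_poly_irreducible_imp_prime[OF g] a(2) b(2) by (simp add: prime_elem_dvd_mult_iff)
  moreover have "a * b = g ^ (pmult g a + pmult g b) * (a' * b')"
    by (subst a, subst b) (simp add: power_add)
  ultimately show ?thesis using pmult_eqI[OF g] by blast
qed

section \<open>The valuations of K(x) at infinity and at irreducible polynomials\<close>

definition inf_val :: "'k::field poly fract \<Rightarrow> int" where
  "inf_val = fract_ext (\<lambda>a. - int (degree a))"

definition fin_val :: "'k::field poly \<Rightarrow> 'k poly fract \<Rightarrow> int" where
  "fin_val g = fract_ext (\<lambda>a. int (pmult g a))"

lemma additive_degree: "additive_on_nonzero (\<lambda>a::'k::field poly. - int (degree a))"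
  by (simp add: additive_on_nonzero_def degree_mult_eq)

lemma additive_pmult:
  "irreducible (g::'k::field poly) \<Longrightarrow> additive_on_nonzero (\<lambda>a. int (pmult g a))"
  by (simp add: additive_on_nonzero_def pmult_mult)

lemma valuation_inf_val: "valuation (inf_val :: 'k::field poly fract \<Rightarrow> int)"
  unfolding inf_val_def
proof (rule valuation_fract_ext[OF additive_degree, of 1 "[:0, 1:]"])
  fix a b :: "'k poly"
  have "degree (a + b) \<le> max (degree a) (degree b)" by (rule degree_add_le_max)
  then show "min (- int (degree a)) (- int (degree b)) \<le> - int (degree (a + b))" by linarith
qed auto

lemma valuation_fin_val:
  fixes g :: "'k::field poly"
  assumes g: "irreducible g" shows "valuation (fin_val g)"
  unfolding fin_val_def
proof (rule valuation_fract_ext[OF additive_pmult[OF g], of g 1])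
  fix a b :: "'k poly" assume nz: "a \<noteq> 0" "b \<noteq> 0" "a + b \<noteq> 0"
  let ?k = "min (pmult g a) (pmult g b)"
  have "g ^ ?k dvd a + b" by (rule dvd_add; rule dvd_trans[OF le_imp_power_dvd pmult_dvd[OF g]]) (use nz in auto)
  then have "?k \<le> pmult g (a + b)"
    using nz g by (intro pmult_ge) auto
  then show "min (int (pmult g a)) (int (pmult g b)) \<le> int (pmult g (a + b))"
    by linarith
qed (use g in \<open>auto simp: irreducible_def pmult_self pmult_one\<close>)

lemma inf_val_to_fract: "a \<noteq> 0 \<Longrightarrow> inf_val (to_fract a) = - int (degree a)"
  by (simp add: inf_val_def to_fract_def fract_ext_Fract[OF additive_degree])

lemma fin_val_to_fract:
  "irreducible g \<Longrightarrow> a \<noteq> 0 \<Longrightarrow> fin_val g (to_fract a) = int (pmult g a)"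
  by (simp add: fin_val_def to_fract_def fract_ext_Fract[OF additive_pmult] pmult_one)

definition monic_irreducibles :: "'k::field poly set" where
  "monic_irreducibles = {g. irreducible g \<and> lead_coeff g = 1}"

text \<open>One normalized valuation for each place of K(x): the pole of \<open>x\<close>, and a
  monic generator for each finite place. Completeness of the list is
  \<open>valuation_ring_ratfunc\<close>.\<close>

definition base_vals :: "('k::field poly fract \<Rightarrow> int) set" where
  "base_vals = insert inf_val (fin_val ` monic_irreducibles)"

lemma valuation_base_vals: "v \<in> base_vals \<Longrightarrow> valuation v"
  by (auto simp: base_vals_def monic_irreducibles_def valuation_inf_val valuation_fin_val)

lemma base_vals_const:
  assumes "v \<in> base_vals" "c \<noteq> 0" shows "v (to_fract [:c:]) = 0"
proof -
  have "pmult g [:c:] = 0" if "irreducible g" for g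
  proof (rule pmult_eq_0[OF that])
    have "[:c:] dvd 1" using assms(2) by (simp add: is_unit_const_poly_iff dvd_field_iff)
    then show "\<not> g dvd [:c:]" using that dvd_trans by (auto simp: irreducible_def)
  qed
  then show ?thesis
    using assms by (auto simp: base_vals_def monic_irreducibles_def inf_val_to_fract fin_val_to_fract)
qed

lemma monic_irreducible_dvd_eq:
  assumes "g \<in> monic_irreducibles" "h \<in> monic_irreducibles" "g dvd h"
  shows "g = (h :: 'k::field poly)"
proof -
  obtain k where k: "h = g * k" using assms(3) by blast
  have "k dvd 1" using assms k by (auto simp: monic_irreducibles_def irreducible_def)
  then obtain c where c: "k = [:c:]" by (auto simp: is_unit_poly_iff)
  have "lead_coeff h = lead_coeff g * c" using k c by (simp add: lead_coeff_mult)
  then have "c = 1" using assms by (simp add: monic_irreducibles_def)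
  then show ?thesis using k c by simp
qed

lemma fin_val_monic_irreducible:
  assumes "g \<in> monic_irreducibles" "h \<in> monic_irreducibles"
  shows "fin_val g (to_fract h) = (if g = (h :: 'k::field poly) then 1 else 0)"
proof -
  have "h \<noteq> 0" "irreducible g"
    using assms by (auto simp: monic_irreducibles_def irreducible_def)
  then show ?thesis
    using monic_irreducible_dvd_eq[OF assms] pmult_eq_0[of g h] pmult_self[of g]
    by (auto simp: fin_val_to_fract)
qed

section \<open>Zeros, poles and degrees of rational functions\<close>

lemma monic_irreducible_factor:
  fixes b :: "'k::field poly"
  assumes "degree b > 0"
  obtains g where "g \<in> monic_irreducibles" "g dvd b"
  using assms
proof (induction "degree b" arbitrary: b thesis rule: less_induct)
  case less
  show thesis
  proof (cases "irreducible b")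
    case True
    have "b \<noteq> 0" using less.prems by auto
    then have lc: "inverse (lead_coeff b) \<noteq> 0" by simp
    have "is_unit [:inverse (lead_coeff b):]"
      using lc by (simp add: is_unit_const_poly_iff dvd_field_iff)
    then have "irreducible ([:inverse (lead_coeff b):] * b)"
      using True by (simp only: irreducible_mult_unit_left)
    then have "smult (inverse (lead_coeff b)) b \<in> monic_irreducibles"
      using lc by (simp add: monic_irreducibles_def)
    moreover have "smult (inverse (lead_coeff b)) b dvd b"
      using lc by (simp add: smult_dvd)
    ultimately show thesis using less.prems by blast
  next
    case False
    have "b \<noteq> 0" using less.prems by auto
    then have "\<not> b dvd 1" using less.prems by (simp add: is_unit_iff_degree)
    then obtain c e where ce: "b = c * e" "\<not> c dvd 1" "\<not> e dvd 1"
      using False \<open>b \<noteq> 0\<close> by (auto simp: irreducible_def)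
    then have nz: "c \<noteq> 0" "e \<noteq> 0" using \<open>b \<noteq> 0\<close> by auto
    then have "degree c > 0" "degree e > 0"
      using ce(2,3) by (auto simp: is_unit_iff_degree)
    moreover have "degree b = degree c + degree e" using ce nz by (simp add: degree_mult_eq)
    ultimately obtain g where "g \<in> monic_irreducibles" "g dvd c"
      using less.hyps[of c] by auto
    then show thesis using less.prems ce by (meson dvd_mult2)
  qed
qed

text \<open>For a denominator of least degree, an irreducible factor \<open>g\<close> of it would
  also divide the numerator, the value at \<open>g\<close> being non-negative; cancelling
  \<open>g\<close> contradicts minimality.\<close>

lemma fract_is_poly:
  fixes z :: "'k::field poly fract"
  assumes "z \<noteq> 0" and "\<And>g. g \<in> monic_irreducibles \<Longrightarrow> 0 \<le> fin_val g z"
  obtains a where "a \<noteq> 0" "z = to_fract a"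
proof -
  define P where "P n \<longleftrightarrow> (\<exists>a b. a \<noteq> 0 \<and> b \<noteq> 0 \<and> z = Fract a b \<and> degree b = n)" for n
  have "\<exists>n. P n" using Fract_nonzero_cases[OF assms(1)] unfolding P_def by metis
  then have L: "P (LEAST n. P n)" by (rule LeastI_ex)
  then obtain a b where ab: "a \<noteq> 0" "b \<noteq> 0" "z = Fract a b" "degree b = (LEAST n. P n)"
    unfolding P_def by blast
  have "degree b = 0"
  proof (rule ccontr)
    assume "degree b \<noteq> 0"
    then obtain g where g: "g \<in> monic_irreducibles" "g dvd b"
      using monic_irreducible_factor[of b] by auto
    then have irr: "irreducible g" and gnu: "g \<noteq> 0" "\<not> is_unit g"
      by (auto simp: monic_irreducibles_def irreducible_def)
    have "pmult g b > 0" using pmult_ge[OF irr ab(2), of 1] g by simp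
    moreover have "int (pmult g a) - int (pmult g b) \<ge> 0"
      using assms(2)[OF g(1)] ab by (simp add: fin_val_def fract_ext_Fract[OF additive_pmult[OF irr]])
    ultimately have "g dvd a" using pmult_eq_0[OF irr, of a] by linarith
    then obtain a' b' where *: "a = g * a'" "b = g * b'" using g by (auto elim!: dvdE)
    then have "z = Fract a' b'" "a' \<noteq> 0" "b' \<noteq> 0" using ab gnu by (auto simp: eq_fract)
    then have "P (degree b')" unfolding P_def by blast
    then have "degree b \<le> degree b'" using ab(4) Least_le by metis
    moreover have "degree b = degree g + degree b'" using * ab by (simp add: degree_mult_eq)
    moreover have "degree g > 0" using gnu by (auto simp: is_unit_iff_degree)
    ultimately show False by simp
  qed
  then obtain c where c: "b = [:c:]" "c \<noteq> 0" using ab(2) by (auto elim!: degree_eq_zeroE)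
  then have "z = to_fract (smult (inverse c) a)"
    using ab by (simp add: to_fract_def eq_fract)
  moreover have "smult (inverse c) a \<noteq> 0" using c ab by simp
  ultimately show thesis using that by blast
qed

text \<open>Multiplying \<open>a\<close> by the powers \<open>- n i\<close> of the
  \<open>p i\<close> removes all finite poles and leaves a polynomial, whose value at infinity is
  minus its degree. This is the half of the degree formula saying that a divisor bounding a nonzero
  function from below has degree at most 0.\<close>

lemma degree_sum_le_0:
  fixes p :: "nat \<Rightarrow> 'k::field poly"
  assumes I: "finite I" "inj_on p I" "p ` I \<subseteq> monic_irreducibles" and a: "a \<noteq> 0"
    and n: "\<And>i. i \<in> I \<Longrightarrow> n i \<le> fin_val (p i) a" and n0: "n0 \<le> inf_val a"
    and other: "\<And>g. g \<in> monic_irreducibles \<Longrightarrow> g \<notin> p ` I \<Longrightarrow> 0 \<le> fin_val g a"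
  shows "n0 + (\<Sum>i\<in>I. n i * int (degree (p i))) \<le> 0"
proof -
  define c where "c = a * (\<Prod>i\<in>I. to_fract (p i) powi (- n i))"
  have p0: "to_fract (p i) \<noteq> 0" "p i \<noteq> 0" if "i \<in> I" for i
    using I(3) that by (auto simp: monic_irreducibles_def irreducible_def)
  have c0: "c \<noteq> 0" unfolding c_def using a p0 I(1) by auto
  have val_c: "v c = v a + (\<Sum>i\<in>I. - n i * v (to_fract (p i)))" if "valuation v" for v
  proof -
    interpret valuation v by fact
    have "v (\<Prod>i\<in>I. to_fract (p i) powi (- n i)) = (\<Sum>i\<in>I. v (to_fract (p i) powi (- n i)))"
      using p0 by (intro val_prod I) auto
    also have "\<dots> = (\<Sum>i\<in>I. - n i * v (to_fract (p i)))"
      using p0 by (intro sum.cong) (auto simp: val_power_int)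
    finally show ?thesis unfolding c_def using a p0 I(1) by (subst val_mult) auto
  qed
  have "0 \<le> fin_val g c" if g: "g \<in> monic_irreducibles" for g
  proof -
    have "fin_val g c = fin_val g a + (\<Sum>i\<in>I. - n i * fin_val g (to_fract (p i)))"
      using g by (intro val_c valuation_fin_val) (simp add: monic_irreducibles_def)
    also have "(\<Sum>i\<in>I. - n i * fin_val g (to_fract (p i))) = (\<Sum>i\<in>I. if g = p i then - n i else 0)"
      using I(3) g by (intro sum.cong refl) (subst fin_val_monic_irreducible, auto)
    finally have eq: "fin_val g c = fin_val g a + (\<Sum>i\<in>I. if g = p i then - n i else 0)" .
    show ?thesis
    proof (cases "g \<in> p ` I")
      case True
      then obtain j where j: "j \<in> I" "g = p j" by blast
      have "(\<Sum>i\<in>I. if g = p i then - n i else 0) = (\<Sum>i\<in>I. if i = j then - n i else 0)"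
        using I(2) j by (intro sum.cong refl) (auto simp: inj_on_def)
      then show ?thesis using eq I(1) j n by simp
    next
      case False
      then have "(\<Sum>i\<in>I. if g = p i then - n i else 0) = 0" by (intro sum.neutral) auto
      then show ?thesis using eq other[OF g False] by simp
    qed
  qed
  then obtain b where b: "b \<noteq> 0" "c = to_fract b" using fract_is_poly[OF c0] by blast
  then have "inf_val c \<le> 0" by (simp add: inf_val_to_fract)
  moreover have "inf_val c = inf_val a + (\<Sum>i\<in>I. - n i * inf_val (to_fract (p i)))"
    by (intro val_c valuation_inf_val)
  moreover have "(\<Sum>i\<in>I. - n i * inf_val (to_fract (p i))) = (\<Sum>i\<in>I. n i * int (degree (p i)))"
    using p0 by (intro sum.cong refl) (simp add: inf_val_to_fract)
  ultimately show ?thesis using n0 by linarith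
qed

lemma val_prod_powi:
  fixes p :: "nat \<Rightarrow> 'k::field poly"
  assumes I: "finite I" "p ` I \<subseteq> monic_irreducibles" and v: "valuation v"
  shows "(\<Prod>i\<in>I. to_fract (p i) powi n i) \<noteq> 0"
    and "v (\<Prod>i\<in>I. to_fract (p i) powi n i) = (\<Sum>i\<in>I. n i * v (to_fract (p i)))"
proof -
  interpret valuation v by fact
  have p0: "to_fract (p i) \<noteq> 0" if "i \<in> I" for i
    using I(2) that by (auto simp: monic_irreducibles_def irreducible_def)
  then show "(\<Prod>i\<in>I. to_fract (p i) powi n i) \<noteq> 0" using I by auto
  have "v (\<Prod>i\<in>I. to_fract (p i) powi n i) = (\<Sum>i\<in>I. v (to_fract (p i) powi n i))"
    using p0 by (intro val_prod I) auto
  then show "v (\<Prod>i\<in>I. to_fract (p i) powi n i) = (\<Sum>i\<in>I. n i * v (to_fract (p i)))"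
    using p0 by (simp add: val_power_int)
qed

lemma fin_val_prod_powi:
  fixes p :: "nat \<Rightarrow> 'k::field poly"
  assumes I: "finite I" "inj_on p I" "p ` I \<subseteq> monic_irreducibles" and g: "g \<in> monic_irreducibles"
  shows "j \<in> I \<Longrightarrow> g = p j \<Longrightarrow> fin_val g (\<Prod>i\<in>I. to_fract (p i) powi n i) = n j"
    and "g \<notin> p ` I \<Longrightarrow> fin_val g (\<Prod>i\<in>I. to_fract (p i) powi n i) = 0"
proof -
  have "valuation (fin_val g)" using g by (simp add: monic_irreducibles_def valuation_fin_val)
  then have eq: "fin_val g (\<Prod>i\<in>I. to_fract (p i) powi n i) = (\<Sum>i\<in>I. n i * fin_val g (to_fract (p i)))"
    using val_prod_powi I by blast
  also have "\<dots> = (\<Sum>i\<in>I. if g = p i then n i else 0)"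
    using I(3) g by (intro sum.cong refl) (subst fin_val_monic_irreducible, auto)
  finally have eq: "fin_val g (\<Prod>i\<in>I. to_fract (p i) powi n i) = (\<Sum>i\<in>I. if g = p i then n i else 0)" .
  show "fin_val g (\<Prod>i\<in>I. to_fract (p i) powi n i) = n j" if "j \<in> I" "g = p j"
  proof -
    have "(\<Sum>i\<in>I. if g = p i then n i else 0) = (\<Sum>i\<in>I. if i = j then n i else 0)"
      using I(2) that by (intro sum.cong refl) (auto simp: inj_on_def)
    then show ?thesis using eq I(1) that by simp
  qed
  show "fin_val g (\<Prod>i\<in>I. to_fract (p i) powi n i) = 0" if "g \<notin> p ` I"
    unfolding eq using that by (intro sum.neutral) auto
qed

lemma inf_val_prod_powi:
  fixes p :: "nat \<Rightarrow> 'k::field poly"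
  assumes I: "finite I" "p ` I \<subseteq> monic_irreducibles"
  shows "inf_val (\<Prod>i\<in>I. to_fract (p i) powi n i) = - (\<Sum>i\<in>I. n i * int (degree (p i)))"
proof -
  have "p i \<noteq> 0" if "i \<in> I" for i
    using I(2) that by (auto simp: monic_irreducibles_def irreducible_def)
  then show ?thesis
    by (simp add: val_prod_powi[OF I valuation_inf_val] inf_val_to_fract sum_negf)
qed

section \<open>Classification of the valuation rings of K(x) over K\<close>

lemma to_fract_power: "to_fract (a ^ n) = to_fract a ^ n"
  by (induction n) (simp_all add: to_fract_mult)

lemma to_fract_pCons: "to_fract (pCons c a) = to_fract [:c:] + to_fract [:0, 1:] * to_fract a"
  by (simp flip: to_fract_mult to_fract_add)

lemma fin_val_vring:
  fixes z :: "'k::field poly fract"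
  assumes g: "irreducible g" and "z \<in> vring (fin_val g)" "z \<noteq> 0"
  obtains n a b where "z = to_fract g ^ n * to_fract a / to_fract b" "b \<noteq> 0" "\<not> g dvd b"
proof -
  obtain a b where ab: "a \<noteq> 0" "b \<noteq> 0" "z = Fract a b" using Fract_nonzero_cases assms(3) .
  have g0: "g \<noteq> 0" using g by (simp add: irreducible_def)
  have le: "pmult g b \<le> pmult g a"
    using assms ab by (simp add: vring_def fin_val_def fract_ext_Fract[OF additive_pmult[OF g]])
  obtain a' where a': "a = g ^ pmult g a * a'" using pmult_decompose[OF g ab(1)] by metis
  obtain b' where b': "b = g ^ pmult g b * b'" "\<not> g dvd b'" using pmult_decompose[OF g ab(2)] by metis
  have b0: "b' \<noteq> 0" using b' by auto
  have "a * b' = g ^ (pmult g a - pmult g b) * a' * b"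
    using le by (subst a', subst b') (simp add: power_add[symmetric] mult_ac flip: mult.assoc)
  then have "z = Fract (g ^ (pmult g a - pmult g b) * a') b'"
    using ab b0 by (simp add: eq_fract)
  also have "\<dots> = to_fract g ^ (pmult g a - pmult g b) * to_fract a' / to_fract b'"
    by (simp add: Fract_conv_to_fract to_fract_power)
  finally show thesis using b' b0 that by blast
qed

text \<open>All polynomials lie in \<open>R\<close>, and the maximal ideal meets them in a nonzero
  prime ideal with monic generator \<open>g\<close>. The localisation there is contained in
  \<open>R\<close>, and maximality gives equality.\<close>

lemma valuation_ring_ratfunc_finite:
  fixes R :: "'k::field poly fract set"
  assumes R: "valuation_ring (range (\<lambda>c. to_fract [:c:])) R" and X: "to_fract [:0, 1:] \<in> R"
  obtains g where "g \<in> monic_irreducibles" "R = vring (fin_val g)"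
proof -
  have c: "to_fract [:c:] \<in> R" for c by (rule valuation_ring_constants[OF R]) simp
  have p: "to_fract a \<in> R" for a
    by (induction a) (use valuation_ring_zero[OF R] in simp, subst to_fract_pCons,
        intro valuation_ring_add[OF R] valuation_ring_mult[OF R] c X)
  \<comment> \<open>\<open>N\<close> describes the nonzero polynomials in the maximal ideal. Without
    any, every nonzero polynomial would be a unit and \<open>R\<close> the whole field.\<close>
  define N where "N a \<longleftrightarrow> a \<noteq> 0 \<and> inverse (to_fract a) \<notin> R" for a :: "'k poly"
  have ex: "\<exists>a. N a"
  proof (rule ccontr)
    assume "\<not> ?thesis"
    then have *: "a \<noteq> 0 \<Longrightarrow> inverse (to_fract a) \<in> R" for a by (auto simp: N_def)
    have "z \<in> R" for z
    proof (cases z)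
      case (Fract a b)
      then show ?thesis
        using valuation_ring_mult[OF R p[of a] *[of b]] by (simp add: Fract_conv_to_fract divide_inverse)
    qed
    then show False using valuation_ring_proper[OF R] by blast
  qed
  then obtain h where h: "N h" "\<And>a. N a \<Longrightarrow> degree h \<le> degree a"
    using ex_has_least_nat[of N _ degree] by blast
  have dvd: "h dvd a" if "N a" for a
  proof (rule ccontr)
    assume nd: "\<not> h dvd a"
    then have m0: "a mod h \<noteq> 0" by (simp add: dvd_eq_mod_eq_0)
    have "to_fract (a div h) * to_fract h = 0 \<or> inverse (to_fract (a div h) * to_fract h) \<notin> R"
      using h by (intro valuation_ring_nonunit_mult[OF R p]) (auto simp: N_def)
    then have "to_fract a - to_fract (a div h) * to_fract h = 0 \<or>
        inverse (to_fract a - to_fract (a div h) * to_fract h) \<notin> R"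
      using that by (intro valuation_ring_nonunit_diff[OF R]) (auto simp: N_def)
    moreover have "to_fract a - to_fract (a div h) * to_fract h = to_fract (a mod h)"
      by (simp add: minus_div_mult_eq_mod flip: to_fract_mult to_fract_diff)
    ultimately have "N (a mod h)" using m0 by (simp add: N_def)
    then have "degree h \<le> degree (a mod h)" by (rule h)
    moreover have "degree (a mod h) < degree h"
      using m0 h(1) degree_mod_less'[of h a] by (simp add: N_def)
    ultimately show False by simp
  qed
  have "\<not> h dvd 1"
  proof
    assume "h dvd 1"
    then obtain k where "1 = h * k" by (elim dvdE)
    then have "to_fract h * to_fract k = 1" by (simp flip: to_fract_mult)
    then have "inverse (to_fract h) = to_fract k" by (rule inverse_unique)
    then show False using h(1) p by (simp add: N_def)
  qed
  moreover have "degree h > 0" if "h \<noteq> 0" using \<open>\<not> h dvd 1\<close> that by (simp add: is_unit_iff_degree)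
  ultimately obtain g where g: "g \<in> monic_irreducibles" "g dvd h"
    using monic_irreducible_factor[of h] h(1) by (auto simp: N_def)
  have irr: "irreducible g" using g by (simp add: monic_irreducibles_def)
  \<comment> \<open>In \<open>h = g * k\<close> one factor is a non-unit of \<open>R\<close>; it
    cannot be \<open>k\<close>, whose degree is smaller than that of \<open>h\<close>.\<close>
  have "N g"
  proof (rule ccontr)
    assume "\<not> N g"
    obtain k where k: "h = g * k" using g by (elim dvdE)
    have nz: "g \<noteq> 0" "k \<noteq> 0" using h(1) k by (auto simp: N_def)
    then have "inverse (to_fract g) \<in> R" using \<open>\<not> N g\<close> by (simp add: N_def)
    have "N k"
    proof (rule ccontr)
      assume "\<not> N k"
      then have "inverse (to_fract k) * inverse (to_fract g) \<in> R"
        using valuation_ring_mult[OF R] \<open>inverse (to_fract g) \<in> R\<close> nz by (simp add: N_def)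
      then show False using h(1) k by (simp add: N_def mult.commute)
    qed
    then have "degree h \<le> degree k" by (rule h)
    then have "degree g = 0" using k nz by (simp add: degree_mult_eq)
    then show False using irr nz by (simp add: irreducible_def is_unit_iff_degree)
  qed
  have "vring (fin_val g) \<subseteq> R"
  proof
    fix z assume z: "z \<in> vring (fin_val g)"
    show "z \<in> R"
    proof (cases "z = 0")
      case False
      obtain n a b where *: "z = to_fract g ^ n * to_fract a / to_fract b" "b \<noteq> 0" "\<not> g dvd b"
        using fin_val_vring[OF irr z False] .
      have "inverse (to_fract b) \<in> R" using *(2,3) dvd[of b] g(2) dvd_trans by (auto simp: N_def)
      then show ?thesis
        unfolding *(1) divide_inverse using p
        by (intro valuation_ring_mult[OF R] valuation_ring_power[OF R])
    qed (use valuation_ring_zero[OF R] in simp)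
  qed
  then have "R = vring (fin_val g)"
    using valuation.vring_maximal[OF valuation_fin_val[OF irr]] valuation_ring_mult[OF R]
      valuation_ring_proper[OF R] by blast
  then show thesis using that g by blast
qed

text \<open>Here \<open>T = 1/x\<close> lies in the maximal ideal, and a polynomial times
  \<open>T ^ n\<close> with \<open>n\<close> at least its degree is a polynomial in
  \<open>T\<close>. So \<open>a / b\<close> with \<open>degree a \<le> degree b = n\<close> is the
  quotient of the element \<open>a T^n\<close> of \<open>R\<close> by the unit
  \<open>b T^n\<close>.\<close>

lemma valuation_ring_ratfunc_infinite:
  fixes R :: "'k::field poly fract set"
  assumes R: "valuation_ring (range (\<lambda>c. to_fract [:c:])) R" and X: "to_fract [:0, 1:] \<notin> R"
  shows "R = vring inf_val"
proof -
  define T where "T = inverse (to_fract ([:0, 1:] :: 'k poly))"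
  have T: "T \<in> R" using valuation_ring_total[OF R] X unfolding T_def by blast
  have T0: "T \<noteq> 0" by (simp add: T_def)
  have TN: "T = 0 \<or> inverse T \<notin> R" using X by (simp add: T_def)
  have c: "to_fract [:c:] \<in> R" for c by (rule valuation_ring_constants[OF R]) simp
  have pT: "to_fract a * T ^ n \<in> R" if "degree a \<le> n" for a n
    using that
  proof (induction a arbitrary: n)
    case 0
    then show ?case using valuation_ring_zero[OF R] by simp
  next
    case (pCons b a)
    show ?case
    proof (cases "a = 0")
      case True
      then show ?thesis using valuation_ring_mult[OF R c valuation_ring_power[OF R T]] by simp
    next
      case False
      then obtain k where k: "n = Suc k" "degree a \<le> k" using pCons.prems by (cases n) auto
      have "to_fract (pCons b a) * T ^ n = to_fract [:b:] * T ^ n + to_fract a * T ^ k"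
        unfolding to_fract_pCons[of b a] k by (simp add: T_def field_simps)
      moreover have "to_fract [:b:] * T ^ n \<in> R" "to_fract a * T ^ k \<in> R"
        using valuation_ring_mult[OF R c valuation_ring_power[OF R T]] pCons.IH k(2) by blast+
      ultimately show ?thesis using valuation_ring_add[OF R] by simp
    qed
  qed
  \<comment> \<open>\<open>b * T ^ degree b\<close> is the nonzero leading coefficient plus a
    multiple of \<open>T\<close>; were it a non-unit, so would be that constant.\<close>
  have unit: "inverse (to_fract b * T ^ degree b) \<in> R" if b0: "b \<noteq> 0" for b
  proof (rule ccontr)
    assume nu: "\<not> ?thesis"
    define b' where "b' = b - monom (lead_coeff b) (degree b)"
    have eq: "to_fract (monom (lead_coeff b) (degree b)) * T ^ degree b = to_fract [:lead_coeff b:]"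
    proof -
      have "monom (lead_coeff b) (degree b) = [:lead_coeff b:] * [:0, 1:] ^ degree b"
        by (simp add: monom_altdef)
      then have "to_fract (monom (lead_coeff b) (degree b)) =
          to_fract [:lead_coeff b:] * to_fract [:0, 1:] ^ degree b"
        by (simp only: to_fract_mult to_fract_power)
      then show ?thesis by (simp add: T_def power_inverse)
    qed
    have lc: "to_fract [:lead_coeff b:] = to_fract b * T ^ degree b - to_fract b' * T ^ degree b"
      unfolding b'_def to_fract_diff eq[symmetric] by (simp add: algebra_simps)
    have b'N: "to_fract b' * T ^ degree b = 0 \<or> inverse (to_fract b' * T ^ degree b) \<notin> R"
    proof (cases "b' = 0")
      case False
      have "degree b' \<le> degree b"
        unfolding b'_def by (intro degree_diff_le degree_monom_le order_refl)
      moreover have "degree b' \<noteq> degree b"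
      proof
        assume "degree b' = degree b"
        then have "lead_coeff b' = coeff b' (degree b)" by simp
        also have "\<dots> = 0" by (simp add: b'_def)
        finally show False using False by simp
      qed
      ultimately obtain k where k: "degree b = Suc k" "degree b' \<le> k" by (cases "degree b") auto
      have "(to_fract b' * T ^ k) * T = 0 \<or> inverse ((to_fract b' * T ^ k) * T) \<notin> R"
        using k by (intro valuation_ring_nonunit_mult[OF R pT TN])
      then show ?thesis using k by (simp add: mult_ac)
    qed simp
    have "to_fract [:lead_coeff b:] = 0 \<or> inverse (to_fract [:lead_coeff b:]) \<notin> R"
      unfolding lc by (rule valuation_ring_nonunit_diff[OF R _ b'N]) (use nu in simp)
    moreover have "inverse (to_fract [:lead_coeff b:]) = to_fract [:inverse (lead_coeff b):]"
      using b0 by (intro inverse_unique) (simp flip: to_fract_mult one_pCons)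
    ultimately show False using c b0 by simp
  qed
  have "vring inf_val \<subseteq> R"
  proof
    fix z :: "'k poly fract" assume z: "z \<in> vring inf_val"
    show "z \<in> R"
    proof (cases "z = 0")
      case False
      obtain a b where ab: "a \<noteq> 0" "b \<noteq> 0" "z = Fract a b" using Fract_nonzero_cases False .
      then have "degree a \<le> degree b"
        using z False by (simp add: vring_def inf_val_def fract_ext_Fract[OF additive_degree])
      then have "to_fract a * T ^ degree b * inverse (to_fract b * T ^ degree b) \<in> R"
        using pT unit ab valuation_ring_mult[OF R] by blast
      moreover have "to_fract a * T ^ degree b * inverse (to_fract b * T ^ degree b) = z"
        using ab T0 by (simp add: Fract_conv_to_fract divide_inverse mult_ac)
      ultimately show ?thesis by simp
    qed (use valuation_ring_zero[OF R] in simp)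
  qed
  then show ?thesis
    using valuation.vring_maximal[OF valuation_inf_val] valuation_ring_mult[OF R]
      valuation_ring_proper[OF R] by blast
qed

lemma valuation_ring_ratfunc:
  fixes R :: "'k::field poly fract set"
  assumes R: "valuation_ring (range (\<lambda>c. to_fract [:c:])) R"
  obtains v where "v \<in> base_vals" "R = vring v"
proof (cases "to_fract [:0, 1:] \<in> R")
  case True
  then show thesis
    using valuation_ring_ratfunc_finite[OF R] that by (metis base_vals_def image_eqI insertCI)
next
  case False
  then show thesis
    using valuation_ring_ratfunc_infinite[OF R] that[of inf_val] by (simp add: base_vals_def)
qed

subsection \<open>Extension of discrete valuation rings\<close>

locale field_embedding =
  fixes emb :: "'a::field \<Rightarrow> 'b::field"
  assumes emb_1: "emb 1 = 1"
    and emb_plus: "emb (a + b) = emb a + emb b"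
    and emb_times: "emb (a * b) = emb a * emb b"
begin

lemma emb_0: "emb 0 = 0"
proof -
  have "emb 0 + emb 0 = emb 0 + 0" using emb_plus[of 0 0] by simp
  then show ?thesis by (rule add_left_imp_eq)
qed

lemma emb_uminus: "emb (- a) = - emb a"
  using emb_plus[of a "- a"] emb_0 by (simp add: eq_neg_iff_add_eq_0 add.commute)

lemma emb_diff: "emb (a - b) = emb a - emb b"
  using emb_plus[of a "- b"] emb_uminus by simp

lemma emb_eq_0 [simp]: "emb a = 0 \<longleftrightarrow> a = 0"
proof
  assume "emb a = 0"
  then show "a = 0" using emb_times[of a "inverse a"] emb_1 by (cases "a = 0") auto
qed (simp add: emb_0)

lemma emb_inverse: "emb (inverse a) = inverse (emb a)"
proof (cases "a = 0")
  case False
  then have "emb a * emb (inverse a) = 1" using emb_times[of a "inverse a"] emb_1 by simp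
  then show ?thesis by (metis inverse_unique)
qed (simp add: emb_0)

lemma emb_power: "emb (a ^ n) = emb a ^ n"
  by (induction n) (simp_all add: emb_1 emb_times)

lemma emb_power_int: "emb (a powi n) = emb a powi n"
  by (simp add: power_int_def emb_power emb_inverse)

lemma emb_sum: "emb (\<Sum>i\<in>A. f i) = (\<Sum>i\<in>A. emb (f i))"
  by (induction A rule: infinite_finite_induct) (simp_all add: emb_0 emb_plus)

end

lemma chain_union_in_member:
  assumes "subset.chain A C" "C \<noteq> {}" "finite F" "F \<subseteq> \<Union>C"
  shows "\<exists>M\<in>C. F \<subseteq> M"
  using assms(3,4)
proof (induction F rule: finite_induct)
  case empty
  then show ?case using assms(2) by blast
next
  case (insert x F)
  then obtain M N where "M \<in> C" "F \<subseteq> M" "N \<in> C" "x \<in> N" by blast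
  moreover have "M \<subseteq> N \<or> N \<subseteq> M"
    using assms(1) calculation by (auto simp: subset_chain_def)
  ultimately show ?case by blast
qed

text \<open>A subring maximal among those containing the image of \<open>vring v\<close> but not \<open>1 / \<pi>\<close> is a valuation ring.\<close>

lemma valuation_ring_extension:
  fixes v :: "'a::field \<Rightarrow> int" and emb :: "'a \<Rightarrow> 'b::field"
  assumes v: "valuation v" and emb: "field_embedding emb"
  obtains W where "valuation_ring {0} W" "\<And>a. emb a \<in> W \<longleftrightarrow> a \<in> vring v"
proof -
  interpret valuation v by fact
  interpret field_embedding emb by fact
  obtain \<pi>0 where \<pi>0: "\<pi>0 \<noteq> 0" "v \<pi>0 = 1" using val_surj by auto
  define \<pi> where "\<pi> = emb \<pi>0"
  have \<pi>nz: "\<pi> \<noteq> 0" using \<pi>0 by (simp add: \<pi>_def)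
  define Ov where "Ov = emb ` vring v"
  define sr where "sr A \<longleftrightarrow> Ov \<subseteq> A \<and> (\<forall>a\<in>A. \<forall>b\<in>A. a - b \<in> A \<and> a * b \<in> A) \<and> inverse \<pi> \<notin> A" for A
  have vr: "a - b \<in> vring v" "a * b \<in> vring v" if "a \<in> vring v" "b \<in> vring v" for a b
  proof -
    show "a * b \<in> vring v" using that by (cases "a = 0 \<or> b = 0") (auto simp: vring_def val_mult)
    show "a - b \<in> vring v"
    proof (cases "a = 0 \<or> b = 0 \<or> a - b = 0")
      case True
      then show ?thesis using that by (auto simp: vring_def val_minus)
    next
      case False
      then show ?thesis using that val_add[of a "- b"] by (auto simp: vring_def val_minus)
    qed
  qed
  have "sr Ov"
    unfolding sr_def
  proof (intro conjI ballI)
    fix a b assume "a \<in> Ov" "b \<in> Ov"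
    then obtain a' b' where "a = emb a'" "b = emb b'" "a' \<in> vring v" "b' \<in> vring v"
      by (auto simp: Ov_def)
    then show "a - b \<in> Ov" "a * b \<in> Ov"
      using vr[of a' b'] by (auto simp: Ov_def simp flip: emb_diff emb_times)
  next
    show "inverse \<pi> \<notin> Ov"
    proof
      assume "inverse \<pi> \<in> Ov"
      then obtain a where a: "inverse \<pi> = emb a" "a \<in> vring v" by (auto simp: Ov_def)
      have "emb (a * \<pi>0 - 1) = 0"
        using \<pi>nz a(1)[symmetric] by (simp add: emb_diff emb_times emb_1 \<pi>_def)
      then have "a * \<pi>0 = 1" by simp
      then have a0: "a \<noteq> 0" by auto
      then have "v a + v \<pi>0 = 0" using val_mult[of a \<pi>0] \<pi>0 \<open>a * \<pi>0 = 1\<close> by simp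
      then show False using a0 a \<pi>0 by (simp add: vring_def)
    qed
  qed simp
  have "\<exists>M\<in>Collect sr. (\<forall>Y\<in>Collect sr. M \<subseteq> Y \<longrightarrow> Y = M)"
  proof (rule subset_Zorn_nonempty)
    show "Collect sr \<noteq> {}" using \<open>sr Ov\<close> by blast
    fix C assume C: "C \<noteq> {}" "subset.chain (Collect sr) C"
    then have Csr: "A \<in> C \<Longrightarrow> sr A" for A by (auto simp: subset_chain_def)
    have "a - b \<in> \<Union>C \<and> a * b \<in> \<Union>C" if "a \<in> \<Union>C" "b \<in> \<Union>C" for a b
    proof -
      have "{a, b} \<subseteq> \<Union>C" using that by blast
      from chain_union_in_member[OF C(2,1) _ this] obtain M where "M \<in> C" "{a, b} \<subseteq> M" by auto
      then show ?thesis using Csr[of M] by (auto simp: sr_def)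
    qed
    then show "\<Union>C \<in> Collect sr" using Csr C(1) unfolding sr_def by blast
  qed
  then obtain W where W: "sr W" "\<And>Y. sr Y \<Longrightarrow> W \<subseteq> Y \<Longrightarrow> Y = W" by blast
  have W1: "1 \<in> W" and W\<pi>: "\<pi> \<in> W"
  proof -
    have "1 \<in> vring v" "\<pi>0 \<in> vring v" using \<pi>0 by (auto simp: vring_def)
    then have "emb 1 \<in> Ov" "emb \<pi>0 \<in> Ov" by (auto simp: Ov_def)
    then show "1 \<in> W" "\<pi> \<in> W" using W(1) by (auto simp: sr_def emb_1 \<pi>_def)
  qed
  have Wd: "a - b \<in> W" and Wm: "a * b \<in> W" if "a \<in> W" "b \<in> W" for a b
    using W(1) that by (auto simp: sr_def)
  have W0: "0 \<in> W" using Wd[OF W1 W1] by simp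
  have Wa: "a + b \<in> W" if "a \<in> W" "b \<in> W" for a b
    using Wd[OF that(1) Wd[OF W0 that(2)]] by simp
  have n\<pi>: "inverse \<pi> \<notin> W" using W(1) by (simp add: sr_def)
  \<comment> \<open>Localising \<open>W\<close> at the elements \<open>1 - \<pi> * c\<close> gives a
    subring \<open>Y\<close> that still avoids \<open>1 / \<pi>\<close>; by maximality nothing new
    is added.\<close>
  have unit: "inverse (1 - \<pi> * b) \<in> W" "1 - \<pi> * b \<noteq> 0" if b: "b \<in> W" for b
  proof -
    have nz: "1 - \<pi> * b \<noteq> 0" if "b \<in> W" for b
    proof
      assume "1 - \<pi> * b = 0"
      then have "inverse \<pi> = b" by (intro inverse_unique) simp
      then show False using n\<pi> that by simp
    qed
    define Y where "Y = {a / (1 - \<pi> * c) | a c. a \<in> W \<and> c \<in> W}"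
    have "sr Y" unfolding sr_def
    proof (intro conjI ballI)
      have "a \<in> Y" if "a \<in> W" for a unfolding Y_def using that W0 by (intro CollectI exI[of _ a] exI[of _ 0]) simp
      then show "Ov \<subseteq> Y" using W(1) unfolding sr_def by blast
      fix x y assume "x \<in> Y" "y \<in> Y"
      then obtain a c a' c' where *: "x = a / (1 - \<pi> * c)" "y = a' / (1 - \<pi> * c')"
        "a \<in> W" "c \<in> W" "a' \<in> W" "c' \<in> W" unfolding Y_def by blast
      have e: "(1 - \<pi> * c) * (1 - \<pi> * c') = 1 - \<pi> * (c + c' - \<pi> * c * c')" by (simp add: algebra_simps)
      have e': "c + c' - \<pi> * c * c' \<in> W" using * W\<pi> by (intro Wd Wa Wm)
      have "x * y = (a * a') / (1 - \<pi> * (c + c' - \<pi> * c * c'))" using * e by simp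
      then show "x * y \<in> Y" unfolding Y_def using e' Wm * by blast
      have "x - y = (a * (1 - \<pi> * c') - a' * (1 - \<pi> * c)) / (1 - \<pi> * (c + c' - \<pi> * c * c'))"
        using nz[of c] nz[of c'] * unfolding e[symmetric] by (simp add: diff_frac_eq)
      moreover have "a * (1 - \<pi> * c') - a' * (1 - \<pi> * c) \<in> W" using * W\<pi> W1 by (intro Wd Wm)
      ultimately show "x - y \<in> Y" unfolding Y_def using e' by blast
    next
      show "inverse \<pi> \<notin> Y"
      proof
        assume "inverse \<pi> \<in> Y"
        then obtain a c where *: "inverse \<pi> = a / (1 - \<pi> * c)" "a \<in> W" "c \<in> W" unfolding Y_def by blast
        have "1 - \<pi> * c = \<pi> * a" using *(1) nz[OF *(3)] \<pi>nz by (simp add: field_simps)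
        then have "\<pi> * (a + c) = 1" by (simp add: algebra_simps)
        then have "inverse \<pi> = a + c" by (rule inverse_unique)
        then show False using n\<pi> Wa * by simp
      qed
    qed
    moreover have "W \<subseteq> Y"
    proof
      fix a assume "a \<in> W"
      then show "a \<in> Y" unfolding Y_def using W0 by (intro CollectI exI[of _ a] exI[of _ 0]) simp
    qed
    ultimately have "Y = W" by (rule W(2))
    moreover have "inverse (1 - \<pi> * b) \<in> Y" unfolding Y_def using W1 b
      by (intro CollectI exI[of _ 1] exI[of _ b]) (simp add: divide_inverse)
    ultimately show "inverse (1 - \<pi> * b) \<in> W" "1 - \<pi> * b \<noteq> 0" using nz[OF b] by auto
  qed
  define Z where "Z z = {poly f z | f. \<forall>i. coeff f i \<in> W}" for z
  \<comment> \<open>The enlargement \<open>W[z]\<close> is no longer admissible, and the only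
    condition it can violate is the exclusion of \<open>1 / \<pi>\<close>.\<close>
  have in_Z: "inverse \<pi> \<in> Z z" if "z \<notin> W" for z
  proof (rule ccontr)
    assume n: "inverse \<pi> \<notin> Z z"
    have WZ: "W \<subseteq> Z z"
    proof
      fix a assume "a \<in> W"
      then show "a \<in> Z z" unfolding Z_def using W0
        by (intro CollectI exI[of _ "[:a:]"]) (auto simp: coeff_pCons split: nat.split)
    qed
    have "sr (Z z)" unfolding sr_def
    proof (intro conjI ballI)
      show "Ov \<subseteq> Z z" using WZ W(1) by (auto simp: sr_def)
      fix a b assume "a \<in> Z z" "b \<in> Z z"
      then obtain f g where fg: "a = poly f z" "b = poly g z" "\<forall>i. coeff f i \<in> W" "\<forall>i. coeff g i \<in> W"
        by (auto simp: Z_def)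
      have Ws: "(\<Sum>i\<in>A. h i) \<in> W" if "\<And>i. i \<in> A \<Longrightarrow> h i \<in> W" for A :: "nat set" and h
        using that by (induction A rule: infinite_finite_induct) (auto simp: W0 Wa)
      show "a - b \<in> Z z" unfolding Z_def using fg Wd
        by (intro CollectI exI[of _ "f - g"]) simp
      show "a * b \<in> Z z" unfolding Z_def using fg
        by (intro CollectI exI[of _ "f * g"]) (auto simp: coeff_mult intro!: Ws Wm)
    qed (use n in simp)
    then have "Z z = W" using W(2) WZ by blast
    moreover have "z \<in> Z z" unfolding Z_def using W0 W1
      by (intro CollectI exI[of _ "[:0, 1:]"]) (auto simp: coeff_pCons split: nat.split)
    ultimately show False using that by simp
  qed
  \<comment> \<open>\<open>1 = \<Sum>i\<le>k. \<pi> a\<^sub>i z ^ i\<close>: the relation of minimal degree for \<open>z\<close> is shortened using the one for \<open>1 / z\<close>.\<close>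
  define rel where "rel z k \<longleftrightarrow> (\<exists>f. (\<forall>i. f i \<in> W) \<and> 1 = (\<Sum>i\<le>k. \<pi> * f i * z ^ i))" for z and k :: nat
  have rel: "\<exists>k. rel z k" if z: "z \<notin> W" for z
  proof -
    obtain f where f: "inverse \<pi> = poly f z" "\<forall>i. coeff f i \<in> W" using in_Z[OF z] by (auto simp: Z_def)
    have "1 = \<pi> * poly f z" using f(1) \<pi>nz by (simp flip: f(1))
    also have "\<dots> = (\<Sum>i\<le>degree f. \<pi> * coeff f i * z ^ i)"
      by (simp add: poly_altdef sum_distrib_left mult.assoc)
    finally show ?thesis unfolding rel_def using f(2) by blast
  qed
  have reduce: "\<exists>k'<k. rel z k'" if k: "rel z k" and j: "rel (inverse z) j" and "j \<le> k" and z: "z \<noteq> 0" for z k j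
  proof -
    obtain f where f: "\<And>i. f i \<in> W" "1 = (\<Sum>i\<le>k. \<pi> * f i * z ^ i)" using k by (auto simp: rel_def)
    obtain g where g: "\<And>i. g i \<in> W" "1 = (\<Sum>i\<le>j. \<pi> * g i * inverse z ^ i)" using j by (auto simp: rel_def)
    have k0: "k > 0"
    proof (rule ccontr)
      assume "\<not> k > 0"
      then have "\<pi> * f 0 = 1" using f(2) by simp
      then have "inverse \<pi> = f 0" by (rule inverse_unique)
      then show False using n\<pi> f(1) by simp
    qed
    \<comment> \<open>The constant term of the relation for \<open>inverse z\<close> goes to the
      left as the unit \<open>1 - \<pi> * g 0\<close>. Multiplied by \<open>z ^ k\<close>, the
      result expresses \<open>z ^ k\<close> by lower powers with coefficients in
      \<open>\<pi> W\<close>, which eliminates the top term of the relation for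
      \<open>z\<close>.\<close>
    define u where "u = inverse (1 - \<pi> * g 0)"
    have u: "u \<in> W" "u * (1 - \<pi> * g 0) = 1" using unit[OF g(1)] by (auto simp: u_def)
    have "1 = \<pi> * g 0 + (\<Sum>i\<in>{1..j}. \<pi> * g i * inverse z ^ i)"
      using g(2) by (simp add: sum.atMost_shift sum.atLeast1_atMost_eq lessThan_Suc_atMost)
    then have "1 - \<pi> * g 0 = (\<Sum>i\<in>{1..j}. \<pi> * g i * inverse z ^ i)" by (simp add: algebra_simps)
    then have "1 = u * (\<Sum>i\<in>{1..j}. \<pi> * g i * inverse z ^ i)" using u by simp
    then have "z ^ k = u * (\<Sum>i\<in>{1..j}. \<pi> * g i * inverse z ^ i) * z ^ k" by simp
    also have "\<dots> = (\<Sum>i\<in>{1..j}. u * \<pi> * g i * (inverse z ^ i * z ^ k))"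
      by (simp add: sum_distrib_left sum_distrib_right mult.assoc)
    also have "\<dots> = (\<Sum>i\<in>{1..j}. u * \<pi> * g i * z ^ (k - i))"
    proof (intro sum.cong refl)
      fix i assume "i \<in> {1..j}"
      then have "z ^ k = z ^ i * z ^ (k - i)" using \<open>j \<le> k\<close> by (simp flip: power_add)
      then have "inverse z ^ i * z ^ k = z ^ (k - i)" using z by (simp add: power_inverse)
      then show "u * \<pi> * g i * (inverse z ^ i * z ^ k) = u * \<pi> * g i * z ^ (k - i)" by simp
    qed
    also have "\<dots> = (\<Sum>i<k. if k - i \<le> j then u * \<pi> * g (k - i) * z ^ i else 0)"
    proof -
      have "(\<Sum>i\<in>{1..j}. u * \<pi> * g i * z ^ (k - i)) = (\<Sum>i\<in>{k - j..<k}. u * \<pi> * g (k - i) * z ^ i)"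
        by (rule sum.reindex_bij_witness[of _ "\<lambda>i. k - i" "\<lambda>i. k - i"]) (use \<open>j \<le> k\<close> in auto)
      also have "\<dots> = (\<Sum>i<k. if k - i \<le> j then u * \<pi> * g (k - i) * z ^ i else 0)"
        by (rule sum.mono_neutral_cong_left) auto
      finally show ?thesis .
    qed
    finally have zk: "z ^ k = (\<Sum>i<k. \<pi> * (if k - i \<le> j then u * g (k - i) else 0) * z ^ i)"
      by (rule trans) (intro sum.cong refl, simp)
    define f' where "f' i = f i + \<pi> * f k * (if k - i \<le> j then u * g (k - i) else 0)" for i
    have "1 = (\<Sum>i<k. \<pi> * f i * z ^ i) + \<pi> * f k * z ^ k"
      using f(2) by (simp flip: lessThan_Suc_atMost)
    also have "\<dots> = (\<Sum>i<k. \<pi> * f' i * z ^ i)"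
      unfolding zk f'_def sum_distrib_left sum.distrib[symmetric] by (intro sum.cong refl) (simp add: algebra_simps)
    finally have "1 = (\<Sum>i\<le>k - 1. \<pi> * f' i * z ^ i)"
      using k0 by (metis Suc_pred' lessThan_Suc_atMost)
    moreover have "f' i \<in> W" for i
      unfolding f'_def using f g u W\<pi> W0 by (auto intro!: Wa Wm)
    ultimately have "rel z (k - 1)" unfolding rel_def by blast
    then show ?thesis using k0 by (intro exI[of _ "k - 1"]) simp
  qed
  have total: "z \<in> W \<or> inverse z \<in> W" for z
  proof (rule ccontr)
    assume *: "\<not> (z \<in> W \<or> inverse z \<in> W)"
    then have z: "z \<noteq> 0" using W0 by auto
    obtain k where k: "rel z k" "\<And>k'. rel z k' \<Longrightarrow> k \<le> k'"
      using rel[of z] * ex_has_least_nat[of "rel z" _ id] by auto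
    obtain j where j: "rel (inverse z) j" "\<And>k'. rel (inverse z) k' \<Longrightarrow> j \<le> k'"
      using rel[of "inverse z"] * ex_has_least_nat[of "rel (inverse z)" _ id] by auto
    show False
    proof (cases "j \<le> k")
      case True
      then show False using reduce[OF k(1) j(1) _ z] k(2) by fastforce
    next
      case False
      then show False using reduce[of "inverse z" j k] j k z by fastforce
    qed
  qed
  \<comment> \<open>With \<open>{0}\<close> as constants the strict inclusion asks only for a
    nonzero element; the true constants come in when \<open>W\<close> is pulled back to F.\<close>
  have "{0} \<subset> W" using W0 W1 by (metis empty_subsetI insert_subset psubsetI singletonD zero_neq_one)
  then have R: "valuation_ring {0} W"
    unfolding valuation_ring_def using W1
  proof (intro conjI ballI allI)
    show "W \<subset> UNIV" using n\<pi> by blast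
  qed (use total Wd Wm in auto)
  \<comment> \<open>The trace of \<open>W\<close> on the base field contains \<open>vring v\<close>
    and misses the inverse of \<open>\<pi>0\<close>; maximality leaves only equality.\<close>
  have "{a. emb a \<in> W} = vring v"
  proof (rule vring_maximal)
    show "vring v \<subseteq> {a. emb a \<in> W}" using W(1) by (auto simp: sr_def Ov_def)
    show "{a. emb a \<in> W} \<noteq> UNIV"
      using n\<pi> unfolding \<pi>_def emb_inverse[symmetric] by blast
  qed (simp add: emb_times Wm)
  then show thesis using that[OF R] by blast
qed

subsection \<open>Roots of unity\<close>

text \<open>A double root of \<open>X^m - 1\<close> would be a root of the derivative
  \<open>m X^(m-1)\<close>, hence 0, which is not a root. So the \<open>m\<close> linear factors are
  distinct.\<close>

lemma card_roots_of_unity: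
  fixes m :: nat
  assumes "of_nat m \<noteq> (0 :: 'a::alg_closed_field)"
  shows "card {z::'a. z ^ m = 1} = m" "finite {z::'a. z ^ m = 1}"
proof -
  have m: "m > 0" using assms by (cases m) auto
  define f where "f = monom (1::'a) m - 1"
  have poly_f: "poly f z = z ^ m - 1" for z by (simp add: f_def poly_monom)
  have deg: "degree f = m"
  proof -
    have "degree (monom (1::'a) m + (- 1)) = degree (monom (1::'a) m)"
      using m by (intro degree_add_eq_left) (simp add: degree_monom_eq)
    then show ?thesis by (simp add: f_def degree_monom_eq)
  qed
  then have f0: "f \<noteq> 0" using m by auto
  obtain A where A: "size A = m" "f = smult (lead_coeff f) (\<Prod>x\<in>#A. [:- x, 1:])"
    using alg_closed_imp_factorization[OF f0] deg by auto
  have roots: "poly f z = 0 \<longleftrightarrow> z \<in># A" for z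
    using f0 by (subst A(2)) (auto simp: poly_prod_mset prod_mset_zero_iff)
  have "count A x \<le> 1" for x
  proof (rule ccontr)
    assume "\<not> count A x \<le> 1"
    then have c: "count A x \<ge> 2" by simp
    then have B': "A = add_mset x (add_mset x (A - {#x, x#}))" (is "A = add_mset x (add_mset x ?B)")
      by (intro multiset_eqI) auto
    define h where "h = smult (lead_coeff f) (\<Prod>x\<in>#?B. [:- x, 1:])"
    have "f = [:- x, 1:] * ([:- x, 1:] * h)"
      unfolding h_def by (subst A(2), subst B') (simp add: mult_ac)
    moreover have "poly (pderiv (L * (L * h))) x = 0" if "poly L x = 0" for L
      using that by (simp add: pderiv_mult)
    from this[of "[:- x, 1:]"] have "poly (pderiv ([:- x, 1:] * ([:- x, 1:] * h))) x = 0"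
      by (simp only: poly_pCons) simp
    ultimately have "poly (pderiv f) x = 0" by (simp only:)
    moreover have "pderiv f = monom (of_nat m) (m - 1)" by (simp add: f_def pderiv_diff pderiv_monom)
    moreover have "x \<in># A" using c by (metis count_greater_zero_iff less_le_trans zero_less_numeral)
    then have "x ^ m = 1" using roots[of x] poly_f by simp
    then have "x \<noteq> 0" using m by (auto simp: power_0_left)
    ultimately show False using assms by (simp add: poly_monom)
  qed
  note le = this
  have "A = mset_set (set_mset A)"
  proof (intro multiset_eqI)
    fix x
    show "count A x = count (mset_set (set_mset A)) x"
      using le[of x] by (cases "x \<in># A") (auto simp: not_in_iff count_greater_zero_iff[symmetric] simp del: count_greater_zero_iff)
  qed
  then have "card (set_mset A) = m" using A(1) by (metis size_mset_set)
  moreover have "set_mset A = {z. z ^ m = 1}" using roots poly_f by auto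
  ultimately show "card {z::'a. z ^ m = 1} = m" "finite {z::'a. z ^ m = 1}"
    using finite_set_mset[of A] by simp_all
qed

text \<open>Some root of unity \<open>w\<close> has \<open>w ^ i \<noteq> 1\<close>, since
  \<open>X^i - 1\<close> has at most \<open>i < m\<close> roots; multiplication by \<open>w\<close>
  permutes the range and scales the sum by \<open>w ^ i\<close>.\<close>

lemma sum_powers_roots_of_unity:
  fixes m i :: nat
  assumes m: "of_nat m \<noteq> (0 :: 'a::alg_closed_field)" and i: "0 < i" "i < m"
  shows "(\<Sum>z | z ^ m = 1. (z::'a) ^ i) = 0"
proof -
  have "\<exists>w::'a. w ^ m = 1 \<and> w ^ i \<noteq> 1"
  proof (rule ccontr)
    assume "\<not> ?thesis"
    then have sub: "{z::'a. z ^ m = 1} \<subseteq> {z. poly (monom 1 i - 1) z = 0}"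
      by (auto simp: poly_monom)
    have deg: "degree (monom (1::'a) i + (- 1)) = i"
      using i by (subst degree_add_eq_left) (simp_all add: degree_monom_eq)
    then have nz: "monom (1::'a) i - 1 \<noteq> 0" using i by auto
    have "m \<le> card {z::'a. poly (monom 1 i - 1) z = 0}"
      using card_mono[OF poly_roots_finite[OF nz] sub] card_roots_of_unity[OF m] by simp
    also have "\<dots> \<le> i" using card_poly_roots_bound[OF nz] deg by simp
    finally show False using i by simp
  qed
  then obtain w :: 'a where w: "w ^ m = 1" "w ^ i \<noteq> 1" by blast
  have w0: "w \<noteq> 0" using w i by (auto simp: power_0_left)
  have "(\<Sum>z | z ^ m = 1. z ^ i) = (\<Sum>z | z ^ m = 1. (w * z) ^ i)"
    by (rule sum.reindex_bij_witness[of _ "\<lambda>z. w * z" "\<lambda>z. z / w"])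
      (use w w0 in \<open>auto simp: power_mult_distrib power_divide\<close>)
  also have "\<dots> = w ^ i * (\<Sum>z | z ^ m = 1. z ^ i)"
    by (simp add: power_mult_distrib sum_distrib_left)
  finally have "(1 - w ^ i) * (\<Sum>z | z ^ m = 1. z ^ i) = 0" by (simp add: algebra_simps)
  then show ?thesis using w by simp
qed

subsection \<open>Radical extensions\<close>

context field_embedding
begin

definition ev :: "'b \<Rightarrow> 'a poly \<Rightarrow> 'b" where
  "ev t g = poly (map_poly emb g) t"

lemma coeff_map_emb: "coeff (map_poly emb g) i = emb (coeff g i)"
  by (simp add: coeff_map_poly emb_0)

lemma ev_plus: "ev t (f + g) = ev t f + ev t g"
proof -
  have "map_poly emb (f + g) = map_poly emb f + map_poly emb g"
    by (intro poly_eqI) (simp add: coeff_map_emb emb_plus)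
  then show ?thesis by (simp add: ev_def)
qed

lemma ev_times: "ev t (f * g) = ev t f * ev t g"
proof -
  have "map_poly emb (f * g) = map_poly emb f * map_poly emb g"
    by (intro poly_eqI) (simp add: coeff_map_emb coeff_mult emb_sum emb_times)
  then show ?thesis by (simp add: ev_def)
qed

lemma ev_pCons: "ev t (pCons a g) = emb a + t * ev t g"
  by (simp add: ev_def map_poly_pCons emb_0)

lemma ev_0: "ev t 0 = 0"
  by (simp add: ev_def)

lemma ev_const: "ev t [:a:] = emb a"
  by (simp add: ev_pCons ev_0)

lemma ev_1: "ev t 1 = 1"
  using ev_const[of t 1] by (simp add: emb_1 one_pCons)

lemma ev_uminus: "ev t (- g) = - ev t g"
  using ev_plus[of t g "- g"] ev_0 by (simp add: eq_neg_iff_add_eq_0 add.commute)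

lemma ev_diff: "ev t (f - g) = ev t f - ev t g"
  using ev_plus[of t f "- g"] ev_uminus[of t g] by simp

lemma ev_var: "ev t [:0, 1:] = t"
  by (simp add: ev_pCons ev_0 emb_0 emb_1)

lemma ev_power: "ev t (g ^ n) = ev t g ^ n"
  by (induction n) (simp_all add: ev_1 ev_times)

lemma ev_monom: "ev t (monom a n) = emb a * t ^ n"
  by (induction n) (simp_all add: monom_0 monom_Suc ev_const ev_pCons emb_0 ev_0)

lemma ev_sum:
  assumes "degree g < n" shows "ev t g = (\<Sum>i<n. emb (coeff g i) * t ^ i)"
proof -
  let ?g = "map_poly emb g"
  have "degree ?g \<le> degree g" by (rule map_poly_degree_leq)
  have "ev t g = (\<Sum>i\<le>degree ?g. coeff ?g i * t ^ i)" unfolding ev_def by (rule poly_altdef)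
  also have "\<dots> = (\<Sum>i<n. coeff ?g i * t ^ i)"
    using \<open>degree ?g \<le> degree g\<close> assms by (intro sum.mono_neutral_left) (auto simp: coeff_eq_0)
  finally show ?thesis by (simp add: coeff_map_emb)
qed

end

text \<open>The powers of \<open>u\<close> below \<open>m\<close> are shown here to span; that
  \<open>kpoly\<close> is the minimal polynomial of \<open>u\<close> comes later from ramification,
  in \<open>ev_eq_0\<close>.\<close>

locale radical_extension = field_embedding emb
  for emb :: "'a::field \<Rightarrow> 'b::field" +
  fixes m :: nat and u :: 'b and h :: 'a
  assumes m_pos: "m > 0" and h_nz: "h \<noteq> 0" and u_power: "u ^ m = emb h"
    and generated: "is_subfield L \<Longrightarrow> range emb \<subseteq> L \<Longrightarrow> u \<in> L \<Longrightarrow> L = UNIV"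
begin

lemma u_nz: "u \<noteq> 0"
  using u_power h_nz m_pos by (auto simp: power_0_left)

definition kpoly :: "'a poly" where
  "kpoly = monom 1 m - [:h:]"

lemma degree_kpoly: "degree kpoly = m"
  unfolding kpoly_def diff_conv_add_uminus
  by (subst degree_add_eq_left) (use m_pos in \<open>auto simp: degree_monom_eq\<close>)

lemma ev_kpoly: "t ^ m = u ^ m \<Longrightarrow> ev t kpoly = 0"
  by (simp add: kpoly_def ev_diff ev_monom ev_const emb_1 u_power)

lemma kpoly_nz: "kpoly \<noteq> 0"
  using degree_kpoly m_pos by auto

lemma ev_mod_kpoly: "ev u (g mod kpoly) = ev u g" "degree (g mod kpoly) < m"
proof -
  have "g = g div kpoly * kpoly + g mod kpoly" by (simp add: div_mult_mod_eq)
  then have "ev u g = ev u (g div kpoly) * ev u kpoly + ev u (g mod kpoly)"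
    by (metis ev_plus ev_times)
  then show "ev u (g mod kpoly) = ev u g" by (simp add: ev_kpoly)
  show "degree (g mod kpoly) < m"
    using degree_mod_less[OF kpoly_nz, of g] degree_kpoly m_pos by auto
qed

text \<open>The powers of \<open>z\<close> up to \<open>z ^ m\<close> lie in a span of at most
  \<open>m\<close> elements. Linear dependence concerns the set of powers, so coinciding powers are
  treated apart; they give a difference of two monomials.\<close>

lemma range_ev_algebraic:
  assumes "z \<in> range (ev u)"
  obtains f where "f \<noteq> 0" "degree f \<le> m" "ev z f = 0"
proof (cases "inj_on (\<lambda>i. z ^ i) {..m}")
  case False
  then obtain i j where ij: "i < j" "j \<le> m" "z ^ i = z ^ j"
    by (auto simp: inj_on_def) (metis linorder_neqE_nat)
  let ?f = "monom 1 j - monom 1 i :: 'a poly"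
  have "coeff ?f j = 1" using ij by simp
  then have "?f \<noteq> 0" by (metis coeff_0 zero_neq_one)
  moreover have "degree ?f \<le> m"
    using ij by (intro degree_diff_le) (auto simp: degree_monom_eq)
  moreover have "ev z ?f = 0" using ij by (simp add: ev_diff ev_monom)
  ultimately show thesis by (rule that)
next
  case True
  interpret vs: vector_space "\<lambda>a z. emb a * z"
    by unfold_locales (auto simp: emb_plus emb_times emb_1 algebra_simps)
  let ?A = "(\<lambda>i. z ^ i) ` {..m}" and ?B = "(\<lambda>i. u ^ i) ` {..<m}"
  have span: "ev u g \<in> vs.span ?B" for g
  proof -
    have "ev u g = (\<Sum>i<m. emb (coeff (g mod kpoly) i) * u ^ i)"
      using ev_sum[OF ev_mod_kpoly(2)] ev_mod_kpoly(1) by metis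
    also have "\<dots> \<in> vs.span ?B" by (intro vs.span_sum vs.span_scale vs.span_base) auto
    finally show ?thesis .
  qed
  obtain g where g: "z = ev u g" using assms by auto
  have "?A \<subseteq> vs.span ?B" using span[of "g ^ i" for i] g by (auto simp: ev_power)
  moreover have "card ?A = Suc m" using True by (simp add: card_image)
  moreover have "card ?B \<le> m" using card_image_le[of "{..<m}" "\<lambda>i. u ^ i"] by simp
  ultimately have "vs.dependent ?A"
    using vs.independent_span_bound[of ?B ?A] by fastforce
  then obtain c where c: "\<exists>w\<in>?A. c w \<noteq> 0" "(\<Sum>w\<in>?A. emb (c w) * w) = 0"
    using vs.dependent_finite[of ?A] by auto
  define f where "f = (\<Sum>i\<le>m. monom (c (z ^ i)) i)"
  have coeff_f: "coeff f i = c (z ^ i)" if "i \<le> m" for i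
    using that by (simp add: f_def coeff_sum)
  obtain i where "i \<le> m" "c (z ^ i) \<noteq> 0" using c(1) by auto
  then have "f \<noteq> 0" using coeff_f[of i] by auto
  moreover have deg: "degree f \<le> m"
    unfolding f_def by (intro degree_sum_le) (auto intro: degree_monom_le[THEN order_trans])
  moreover have "ev z f = 0"
  proof -
    have "ev z f = (\<Sum>i\<le>m. emb (c (z ^ i)) * z ^ i)"
      using ev_sum[of f "Suc m" z] deg by (simp add: coeff_f lessThan_Suc_atMost)
    also have "\<dots> = (\<Sum>w\<in>?A. emb (c w) * w)" using True by (simp add: sum.reindex)
    finally show ?thesis using c(2) by simp
  qed
  ultimately show thesis by (rule that)
qed

text \<open>The point is closure under inverses. For \<open>z \<noteq> 0\<close> an annihilating
  polynomial of least degree has constant term \<open>a \<noteq> 0\<close>, and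
  \<open>a + z * ev z f' = 0\<close> exhibits \<open>inverse z\<close> as a polynomial in
  \<open>z\<close>, hence in \<open>u\<close>.\<close>

lemma range_ev: "range (ev u) = UNIV"
proof (rule generated)
  have inv: "inverse z \<in> range (ev u)" if z: "z \<in> range (ev u)" for z
  proof (cases "z = 0")
    case True
    then show ?thesis using ev_0 by (metis inverse_zero rangeI)
  next
    case False
    define P where "P f \<longleftrightarrow> f \<noteq> 0 \<and> ev z f = 0" for f
    obtain f0 where "P f0" using range_ev_algebraic[OF z] unfolding P_def by metis
    then obtain f where f: "P f" "\<And>g. P g \<Longrightarrow> degree f \<le> degree g"
      using ex_has_least_nat[of P f0 degree] by blast
    obtain a f' where f': "f = pCons a f'" by (cases f)
    have eq: "emb a + z * ev z f' = 0" using f(1) by (simp add: P_def f' ev_pCons)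
    have "a \<noteq> 0"
    proof
      assume a: "a = 0"
      then have "P f'" using eq False f(1) by (auto simp: P_def f' emb_0)
      then have "degree f \<le> degree f'" "f' \<noteq> 0" using f(2) by (auto simp: P_def)
      then show False by (simp add: f')
    qed
    obtain g where g: "z = ev u g" using z by auto
    have comp: "\<exists>k. ev z p = ev u k" for p
    proof (induction p)
      case 0
      show ?case using ev_0 by metis
    next
      case (pCons b p)
      then obtain k where "ev z p = ev u k" by blast
      then have "ev z (pCons b p) = ev u ([:b:] + g * k)"
        by (simp only: ev_pCons[of z] ev_plus ev_times ev_const g[symmetric])
      then show ?case by blast
    qed
    then obtain k where k: "ev z f' = ev u k" by blast
    have "z * (- inverse (emb a) * ev z f') = - inverse (emb a) * (z * ev z f')" by simp
    also have "z * ev z f' = - emb a" using eq by (simp add: eq_neg_iff_add_eq_0 add.commute)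
    also have "- inverse (emb a) * - emb a = 1" using \<open>a \<noteq> 0\<close> by simp
    finally have "inverse z = - inverse (emb a) * ev z f'" by (rule inverse_unique)
    also have "\<dots> = ev u ([:- inverse a:] * k)"
      by (simp only: ev_times ev_const k emb_uminus emb_inverse)
    finally show ?thesis by blast
  qed
  show "is_subfield (range (ev u))"
    unfolding is_subfield_def
  proof (intro conjI ballI)
    show "0 \<in> range (ev u)" "1 \<in> range (ev u)" using ev_0 ev_1 by (metis rangeI)+
    fix a b assume "a \<in> range (ev u)" "b \<in> range (ev u)"
    then obtain f g where "a = ev u f" "b = ev u g" by auto
    then show "a + b \<in> range (ev u)" "a - b \<in> range (ev u)" "a * b \<in> range (ev u)"
      by (simp_all flip: ev_plus ev_diff ev_times)
  qed (rule inv)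
  show "range emb \<subseteq> range (ev u)" using ev_const by (metis image_subsetI rangeI)
  show "u \<in> range (ev u)" using ev_var by (metis rangeI)
qed

lemma representation:
  obtains g where "degree g < m" "z = ev u g"
proof -
  have "z \<in> range (ev u)" using range_ev by simp
  then obtain g where "z = ev u g" by blast
  then show thesis using ev_mod_kpoly[of g] that[of "g mod kpoly"] by simp
qed

lemma algebraic:
  obtains f where "f \<noteq> 0" "degree f \<le> m" "ev z f = 0"
  using range_ev_algebraic[of z] range_ev by auto

end

subsection \<open>Places of radical extensions\<close>

context radical_extension
begin

text \<open>Two terms of an algebraic equation for \<open>z\<close> have equal value.\<close>

lemma power_commensurable:
  assumes R: "valuation_ring C R" and z: "z \<noteq> 0"
  obtains k b where "0 < k" "k \<le> m" "b \<noteq> 0" "z ^ k * emb b \<in> R" "inverse (z ^ k * emb b) \<in> R"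
proof -
  obtain f where f: "f \<noteq> 0" "degree f \<le> m" "ev z f = 0" using algebraic .
  define A where "A = {i. i \<le> m \<and> coeff f i \<noteq> 0}"
  define t where "t i = emb (coeff f i) * z ^ i" for i
  have A: "finite A" by (simp add: A_def)
  have "degree f \<in> A" using f by (simp add: A_def)
  moreover have tnz: "t i \<noteq> 0" if "i \<in> A" for i using that z by (simp add: t_def A_def)
  ultimately obtain i where i: "i \<in> A" "\<And>j. j \<in> A \<Longrightarrow> t j / t i \<in> R"
    using valuation_ring_least[OF R A, of t] by blast
  \<comment> \<open>If \<open>t i\<close> had strictly smaller value than every other term, dividing
    the equation by it would present -1 as a sum of non-units.\<close>
  have "\<exists>j\<in>A. j \<noteq> i \<and> inverse (t j / t i) \<in> R"
  proof (rule ccontr)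
    assume "\<not> ?thesis"
    then have n: "inverse (t j / t i) \<notin> R" if "j \<in> A - {i}" for j using that by blast
    have "0 = ev z f" using f by simp
    also have "\<dots> = (\<Sum>j<Suc m. t j)" using ev_sum[of f "Suc m" z] f(2) by (simp add: t_def)
    also have "\<dots> = (\<Sum>j\<in>A. t j)"
      by (rule sum.mono_neutral_right) (auto simp: A_def t_def emb_0)
    also have "\<dots> = t i + (\<Sum>j\<in>A - {i}. t j)" using A i by (simp add: sum.remove)
    finally have "t i = - (\<Sum>j\<in>A - {i}. t j)" by (simp add: eq_neg_iff_add_eq_0)
    then have "1 = - (\<Sum>j\<in>A - {i}. t j) / t i" using tnz[OF i(1)] by simp
    also have "\<dots> = 0 - (\<Sum>j\<in>A - {i}. t j / t i)" by (simp add: sum_divide_distrib)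
    finally have one: "1 = 0 - (\<Sum>j\<in>A - {i}. t j / t i)" .
    have neg: "- x = 0 \<or> inverse (- x) \<notin> R" if "x = 0 \<or> inverse x \<notin> R" for x
      using valuation_ring_nonunit_diff[OF R _ that, of 0] by simp
    have "(\<Sum>j\<in>B. t j / t i) = 0 \<or> inverse (\<Sum>j\<in>B. t j / t i) \<notin> R" if "B \<subseteq> A - {i}" for B
      using finite_subset[OF that] A that
    proof (induction B rule: infinite_finite_induct)
      case (insert j B)
      have "inverse (t j / t i) \<notin> R" using n[of j] insert by blast
      then have "t j / t i - - (\<Sum>j\<in>B. t j / t i) = 0 \<or> inverse (t j / t i - - (\<Sum>j\<in>B. t j / t i)) \<notin> R"
        using insert by (intro valuation_ring_nonunit_diff[OF R] neg) auto
      then show ?case using insert by simp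
    qed auto
    note sum_nonunit = this[OF order_refl]
    have "(\<Sum>j\<in>A - {i}. t j / t i) = - 1" using one by (simp add: eq_neg_iff_add_eq_0 add.commute)
    then show False
      using sum_nonunit valuation_ring_uminus[OF R valuation_ring_one[OF R]] by simp
  qed
  then obtain j where j: "j \<in> A" "j \<noteq> i" "inverse (t j / t i) \<in> R" by blast
  have js: "t j / t i \<in> R" using i j by blast
  have nz: "emb (coeff f i) \<noteq> 0" "emb (coeff f j) \<noteq> 0" using i j by (auto simp: A_def)
  show thesis
  proof (cases "i < j")
    case True
    have "z ^ j = z ^ (j - i) * z ^ i" using True by (simp flip: power_add)
    then have "t j / t i = z ^ (j - i) * emb (coeff f j / coeff f i)"
      using z nz by (simp add: t_def divide_inverse emb_times emb_inverse)
    then show thesis using that[of "j - i" "coeff f j / coeff f i"] True js j i by (auto simp: A_def)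
  next
    case False
    then have "j < i" using j by simp
    have "z ^ i = z ^ (i - j) * z ^ j" using \<open>j < i\<close> by (simp flip: power_add)
    then have "inverse (t j / t i) = z ^ (i - j) * emb (coeff f i / coeff f j)"
      using z nz by (simp add: t_def divide_inverse emb_times emb_inverse)
    moreover from this have "inverse (z ^ (i - j) * emb (coeff f i / coeff f j)) = t j / t i"
      by (metis inverse_inverse_eq)
    moreover have "i - j \<le> m" using i by (simp add: A_def le_diff_conv trans_le_add1)
    ultimately show thesis using that[of "i - j" "coeff f i / coeff f j"] \<open>j < i\<close> js j i
      by (simp add: A_def)
  qed
qed

text \<open>The exponents \<open>k \<le> m\<close> from \<open>power_commensurable\<close> all
  divide \<open>m!\<close>. So \<open>z\<close> to the power \<open>m!\<close> is a unit times a
  power of \<open>\<pi>\<close>, and the exponent \<open>V0 z\<close> is additive with a sign that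
  decides membership in \<open>R\<close>; \<open>valuation_ring_discrete\<close> normalizes it. The
  number \<open>e\<close> is the ramification index.\<close>

lemma extended_valuation:
  assumes R: "valuation_ring C R" and v: "valuation v"
    and over: "\<And>a. emb a \<in> R \<longleftrightarrow> a \<in> vring v"
  obtains V e where "valuation V" "vring V = R" "e > 0" "\<And>a. a \<noteq> 0 \<Longrightarrow> V (emb a) = e * v a"
proof -
  interpret v: valuation v by fact
  obtain \<pi> where \<pi>: "\<pi> \<noteq> 0" "v \<pi> = 1" using v.val_surj by auto
  define unit where "unit z \<longleftrightarrow> z \<noteq> 0 \<and> z \<in> R \<and> inverse z \<in> R" for z
  define M where "M = (fact m :: nat)"
  have M: "M > 0" by (simp add: M_def)
  have unit_mult: "unit (a * b)" if "unit a" "unit b" for a b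
    using that valuation_ring_mult[OF R] by (simp add: unit_def)
  have unit_inverse: "unit (inverse a)" if "unit a" for a using that by (simp add: unit_def)
  have unit_emb: "unit (emb a) \<longleftrightarrow> v a = 0" if "a \<noteq> 0" for a
    using that by (simp add: unit_def over vring_def v.val_inverse flip: emb_inverse) linarith
  have ex: "\<exists>k. unit (z ^ M * emb (\<pi> powi (- k)))" if z: "z \<noteq> 0" for z
  proof -
    obtain k b where kb: "0 < k" "k \<le> m" "b \<noteq> 0" "z ^ k * emb b \<in> R" "inverse (z ^ k * emb b) \<in> R"
      using power_commensurable[OF R z] .
    define j where "j = M div k"
    have "k dvd M" unfolding M_def using kb by (intro dvd_fact) auto
    then have M_eq: "M = k * j" by (simp add: j_def)
    have "unit ((z ^ k * emb b) ^ j)"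
      using kb z valuation_ring_power[OF R] by (simp add: unit_def flip: power_inverse)
    then have u1: "unit (z ^ M * emb (b ^ j))"
      by (simp add: M_eq power_mult power_mult_distrib emb_power)
    define n where "n = v (b ^ j)"
    have u2: "unit (emb (\<pi> powi n / b ^ j))"
      using kb \<pi> by (subst unit_emb) (auto simp: v.val_divide v.val_power_int n_def)
    have "(z ^ M * emb (b ^ j)) * emb (\<pi> powi n / b ^ j) = z ^ M * emb (\<pi> powi n)"
      using kb(3) by (simp add: divide_inverse emb_times emb_inverse emb_power)
    then have "unit (z ^ M * emb (\<pi> powi n))" using unit_mult[OF u1 u2] by (simp only:)
    then have "unit (z ^ M * emb (\<pi> powi - (- n)))" by simp
    then show ?thesis by blast
  qed
  define V0 where "V0 z = (SOME k. unit (z ^ M * emb (\<pi> powi (- k))))" for z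
  have V0: "unit (z ^ M * emb (\<pi> powi (- V0 z)))" if "z \<noteq> 0" for z
    unfolding V0_def using ex[OF that] by (rule someI_ex)
  have V0_eq: "V0 z = k" if k: "unit (z ^ M * emb (\<pi> powi (- k)))" and z: "z \<noteq> 0" for z k
  proof -
    have "(z ^ M * emb (\<pi> powi (- k))) * inverse (z ^ M * emb (\<pi> powi (- V0 z))) = emb (\<pi> powi (V0 z - k))"
      unfolding emb_power_int using z \<pi> by (simp add: power_int_diff power_int_minus field_simps)
    then have "unit (emb (\<pi> powi (V0 z - k)))" using unit_mult[OF k unit_inverse[OF V0[OF z]]] by simp
    then show ?thesis using \<pi> by (subst (asm) unit_emb) (auto simp: v.val_power_int)
  qed
  have V0_mult: "V0 (a * b) = V0 a + V0 b" if "a \<noteq> 0" "b \<noteq> 0" for a b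
  proof (rule V0_eq)
    have "(a ^ M * emb (\<pi> powi (- V0 a))) * (b ^ M * emb (\<pi> powi (- V0 b))) =
        (a * b) ^ M * emb (\<pi> powi (- (V0 a + V0 b)))"
      unfolding emb_power_int using \<pi> by (simp add: power_mult_distrib power_int_diff power_int_minus power_int_add field_simps)
    then show "unit ((a * b) ^ M * emb (\<pi> powi (- (V0 a + V0 b))))"
      using unit_mult[OF V0[OF that(1)] V0[OF that(2)]] by simp
  qed (use that in simp)
  have V0_mem: "a \<in> R \<longleftrightarrow> 0 \<le> V0 a" if a: "a \<noteq> 0" for a
  proof -
    let ?w = "a ^ M * emb (\<pi> powi (- V0 a))"
    have eq: "a ^ M = ?w * emb (\<pi> powi V0 a)" "emb (\<pi> powi V0 a) = a ^ M * inverse ?w"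
      unfolding emb_power_int using \<pi> a by (auto simp: power_int_minus)
    have w: "?w \<in> R" "inverse ?w \<in> R" using V0[OF a] by (auto simp: unit_def)
    have "0 \<le> V0 a \<longleftrightarrow> emb (\<pi> powi V0 a) \<in> R"
      using \<pi> by (simp add: over vring_def v.val_power_int)
    also have "\<dots> \<longleftrightarrow> a ^ M \<in> R"
      using eq w valuation_ring_mult[OF R] by metis
    also have "\<dots> \<longleftrightarrow> a \<in> R"
      using valuation_ring_root[OF R M] valuation_ring_power[OF R] by blast
    finally show ?thesis by blast
  qed
  obtain V g where V: "valuation V" "vring V = R" "g > 0" "\<And>a. a \<noteq> 0 \<Longrightarrow> V0 a = g * V a"
    using valuation_ring_discrete[OF R V0_mult V0_mem] by blast
  have V0_emb: "V0 (emb a) = int M * v a" if "a \<noteq> 0" for a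
  proof (rule V0_eq)
    have "v (a ^ M * \<pi> powi (- (int M * v a))) = 0"
      using that \<pi> by (simp add: v.val_mult v.val_power v.val_power_int)
    then have "unit (emb (a ^ M * \<pi> powi (- (int M * v a))))"
      using that \<pi> by (subst unit_emb) auto
    then show "unit (emb a ^ M * emb (\<pi> powi (- (int M * v a))))" by (simp add: emb_times emb_power)
  qed (use that in simp)
  define e where "e = V (emb \<pi>)"
  have gM: "g * e = int M" using V(4)[of "emb \<pi>"] V0_emb[of \<pi>] \<pi> by (simp add: e_def)
  then have "e > 0" using M V(3) by (metis zero_less_mult_pos of_nat_0_less_iff)
  moreover have "V (emb a) = e * v a" if "a \<noteq> 0" for a
  proof -
    have "g * V (emb a) = g * (e * v a)"
      using V(4)[of "emb a"] V0_emb[OF that] that gM by (simp flip: mult.assoc)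
    then show ?thesis using V(3) by simp
  qed
  ultimately show thesis using that V(1,2) by blast
qed

end

locale radical_function_field = radical_extension emb m u h
  for emb :: "'k::field poly fract \<Rightarrow> 'f::field" and m u h
begin

lemma emb_const: "emb (to_fract [:c:]) \<in> constants emb"
  by (simp add: constants_def)

text \<open>The ring of \<open>Q\<close> does not contain K(x), since \<open>u\<close> is integral
  over K(x) and all of F would follow; and it meets K(x) in more than the constants, since it
  contains \<open>x\<close> or \<open>1/x\<close>. The trace is thus a valuation ring of K(x), which
  the classification identifies.\<close>

lemma place_valuation:
  assumes "place (constants emb) Q"
  obtains V v e where "valuation V" "Q = vmax V" "v \<in> base_vals" "e > 0"
    "\<And>a. a \<noteq> 0 \<Longrightarrow> V (emb a) = e * v a"
proof -
  obtain R where R: "valuation_ring (constants emb) R" and Q: "Q = {z. z = 0 \<or> inverse z \<notin> R}"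
    using assms place_iff by blast
  define R0 where "R0 = {a. emb a \<in> R}"
  have "R0 \<noteq> UNIV"
  proof
    assume "R0 = UNIV"
    then have sub: "emb a \<in> R" for a by (auto simp: R0_def)
    then have "u \<in> R" using valuation_ring_root[OF R m_pos] u_power by metis
    then have "ev u g \<in> R" for g
      by (induction g) (simp_all add: ev_0 ev_pCons valuation_ring_zero[OF R] valuation_ring_add[OF R]
          valuation_ring_mult[OF R] sub)
    then have "range (ev u) \<subseteq> R" by auto
    then have "R = UNIV" by (simp add: range_ev top_unique)
    then show False using valuation_ring_proper[OF R] by blast
  qed
  moreover have "range (\<lambda>c. to_fract [:c:]) \<noteq> R0"
  proof
    assume eq: "range (\<lambda>c. to_fract [:c:]) = R0"
    have "to_fract [:0, 1:] \<notin> range (\<lambda>c. to_fract [:c:] :: 'k poly fract)" by auto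
    moreover have "inverse (to_fract [:0, 1:]) \<notin> range (\<lambda>c. to_fract [:c:] :: 'k poly fract)"
    proof
      assume "inverse (to_fract [:0, 1:]) \<in> range (\<lambda>c. to_fract [:c:] :: 'k poly fract)"
      then obtain c :: 'k where "inverse (to_fract [:0, 1:]) = to_fract [:c:]" by auto
      then have "to_fract [:c:] * to_fract [:0, 1:] = (1 :: 'k poly fract)"
        by (metis left_inverse to_fract_eq_0_iff pCons_eq_0_iff zero_neq_one)
      then have "to_fract ([:c:] * [:0, 1:]) = to_fract (1 :: 'k poly)" by (simp only: to_fract_mult to_fract_1)
      then have "[:c:] * [:0, 1:] = (1 :: 'k poly)" by (simp only: to_fract_eq_iff)
      then show False by (simp add: one_pCons)
    qed
    ultimately show False
      using eq valuation_ring_total[OF R, of "emb (to_fract [:0, 1:])"] by (auto simp: R0_def emb_inverse)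
  qed
  moreover have "range (\<lambda>c. to_fract [:c:]) \<subseteq> R0"
    using valuation_ring_constants[OF R] emb_const by (auto simp: R0_def)
  ultimately have R0: "valuation_ring (range (\<lambda>c. to_fract [:c:])) R0"
    unfolding valuation_ring_def
  proof (intro conjI ballI allI)
    show "1 \<in> R0" using valuation_ring_one[OF R] by (simp add: R0_def emb_1)
    show "a \<in> R0 \<or> inverse a \<in> R0" for a
      using valuation_ring_total[OF R, of "emb a"] by (simp add: R0_def emb_inverse)
    show "a - b \<in> R0" "a * b \<in> R0" if "a \<in> R0" "b \<in> R0" for a b
      using that valuation_ring_diff[OF R] valuation_ring_mult[OF R]
      by (simp_all add: R0_def emb_diff emb_times)
  qed auto
  obtain v where v: "v \<in> base_vals" "R0 = vring v" using valuation_ring_ratfunc[OF R0] .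
  obtain V e where V: "valuation V" "vring V = R" "e > 0" "\<And>a. a \<noteq> 0 \<Longrightarrow> V (emb a) = e * v a"
    using extended_valuation[OF R valuation_base_vals[OF v(1)]] v(2) by (auto simp: R0_def)
  moreover have "Q = vmax V"
    unfolding Q V(2)[symmetric] using valuation.val_inverse[OF V(1)] by (auto simp: vmax_def vring_def)
  ultimately show thesis using that v(1) by blast
qed

end

subsection \<open>Totally ramified places\<close>

text \<open>The function is \<open>x\<close> for the place at infinity and \<open>1/g\<close> for
  the zero of \<open>g\<close>. It separates \<open>v0\<close> from the other places, and later
  raises pole orders above \<open>v0\<close> in steps of \<open>m\<close>.\<close>

lemma base_val_pole:
  assumes "v0 \<in> base_vals"
  obtains w where "w \<noteq> 0" "v0 w = -1" "\<And>v. v \<in> base_vals \<Longrightarrow> v \<noteq> v0 \<Longrightarrow> 0 \<le> v w"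
proof -
  consider "v0 = inf_val" | g where "g \<in> monic_irreducibles" "v0 = fin_val g"
    using assms by (auto simp: base_vals_def)
  then show thesis
  proof cases
    case 1
    show thesis
    proof (rule that[of "to_fract [:0, 1:]"])
      fix v :: "'a poly fract \<Rightarrow> int" assume "v \<in> base_vals" "v \<noteq> v0"
      then show "0 \<le> v (to_fract [:0, 1:])"
        using 1 by (auto simp: base_vals_def monic_irreducibles_def fin_val_to_fract)
    qed (use 1 in \<open>auto simp: inf_val_to_fract\<close>)
  next
    case 2
    then have g: "g \<noteq> 0" by (auto simp: monic_irreducibles_def irreducible_def)
    have inv: "v (inverse (to_fract g)) = - v (to_fract g)" if "v \<in> base_vals" for v
      using valuation.val_inverse[OF valuation_base_vals[OF that], of "to_fract g"] g by simp
    show thesis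
    proof (rule that[of "inverse (to_fract g)"])
      show "v0 (inverse (to_fract g)) = -1"
        using inv[OF assms] 2 by (simp add: fin_val_monic_irreducible)
      fix v :: "'a poly fract \<Rightarrow> int" assume v: "v \<in> base_vals" "v \<noteq> v0"
      then show "0 \<le> v (inverse (to_fract g))"
        unfolding inv[OF v(1)] using 2 g by (auto simp: base_vals_def inf_val_to_fract fin_val_monic_irreducible)
    qed (use g in auto)
  qed
qed

lemma base_val_eqI:
  assumes v: "v \<in> base_vals" and v0: "v0 \<in> base_vals" and sub: "vmax v0 \<subseteq> vmax v"
  shows "v = v0"
proof (rule ccontr)
  assume "v \<noteq> v0"
  obtain w where w: "w \<noteq> 0" "v0 w = -1" "0 \<le> v w"
    using base_val_pole[OF v0] \<open>v \<noteq> v0\<close> v by metis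
  then have "inverse w \<in> vmax v0"
    by (simp add: vmax_def valuation.val_inverse[OF valuation_base_vals[OF v0]])
  then have "inverse w \<in> vmax v" using sub by blast
  then show False
    using w by (simp add: vmax_def valuation.val_inverse[OF valuation_base_vals[OF v]])
qed

locale totally_ramified_extension = radical_function_field emb m u h
  for emb :: "'k::field poly fract \<Rightarrow> 'f::field" and m u h +
  fixes v0 :: "'k poly fract \<Rightarrow> int" and Q0 :: "'f set"
  assumes v0: "v0 \<in> base_vals" and Q0: "place (constants emb) Q0"
    and Q0_over: "emb ` vmax v0 \<subseteq> Q0"
    and ramified: "coprime (v0 h) (int m)"
    and m_unit: "of_nat m \<noteq> (0::'k)"
begin

sublocale v0: valuation v0
  by (rule valuation_base_vals[OF v0])

text \<open>From \<open>m V(u) = e v0(h)\<close> and coprimality, \<open>e = m c\<close>. The terms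
  have values \<open>c (m v0(g_i) + i v0(h))\<close>, distinct because the \<open>i v0(h)\<close>
  are distinct modulo \<open>m\<close>, so the value of the sum is their minimum; the last two
  conclusions express this minimum with \<open>c = 1\<close>.\<close>

lemma ramified_valuation:
  assumes V: "valuation V" and e: "e > 0" and Ve: "\<And>a. a \<noteq> 0 \<Longrightarrow> V (emb a) = e * v0 a"
    and g: "degree g < m" "g \<noteq> 0"
  shows "ev u g \<noteq> 0"
    and "\<exists>i<m. coeff g i \<noteq> 0 \<and> V (ev u g) = int m * v0 (coeff g i) + int i * v0 h"
    and "\<And>j. coeff g j \<noteq> 0 \<Longrightarrow> V (ev u g) \<le> int m * v0 (coeff g j) + int j * v0 h"
proof -
  interpret V: valuation V by fact
  have "int m * V u = e * v0 h"
    using V.val_power[OF u_nz, of m] Ve[OF h_nz] u_power by simp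
  then have "int m dvd e * v0 h" by (metis dvd_triv_left)
  then have "int m dvd e" using ramified by (simp add: coprime_commute coprime_dvd_mult_left_iff)
  then obtain c where c: "e = int m * c" by (elim dvdE)
  have c0: "c > 0" using e c m_pos by (simp add: zero_less_mult_iff)
  have Vu: "V u = c * v0 h" using \<open>int m * V u = e * v0 h\<close> c m_pos by simp
  have main: "ev u g \<noteq> 0 \<and> (\<exists>i<m. coeff g i \<noteq> 0 \<and> V (ev u g) = c * (int m * v0 (coeff g i) + int i * v0 h) \<and>
      (\<forall>j. coeff g j \<noteq> 0 \<longrightarrow> V (ev u g) \<le> c * (int m * v0 (coeff g j) + int j * v0 h)))"
    if g: "degree g < m" "g \<noteq> 0" for g
  proof -
    define t where "t i = emb (coeff g i) * u ^ i" for i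
    define f where "f i = int m * v0 (coeff g i) + int i * v0 h" for i
    have Vt: "V (t i) = c * f i" if "coeff g i \<noteq> 0" for i
      using that u_nz by (simp add: t_def V.val_mult V.val_power Ve Vu c f_def algebra_simps)
    define A where "A = {i. coeff g i \<noteq> 0}"
    have Am: "A \<subseteq> {..<m}" using g(1) by (auto simp: A_def) (meson le_degree le_less_trans)
    then have A: "finite A" by (rule finite_subset) simp
    have "degree g \<in> A" using g by (simp add: A_def)
    then obtain i where i: "i \<in> A" "\<And>j. j \<in> A \<Longrightarrow> f i \<le> f j"
      using ex_min_if_finite[of "f ` A"] A by (metis empty_iff finite_imageI image_iff imageI leI)
    have inj: "f i \<noteq> f j" if "i \<in> A" "j \<in> A" "i \<noteq> j" for i j
    proof
      assume "f i = f j"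
      then have "int m * (v0 (coeff g i) - v0 (coeff g j)) = (int j - int i) * v0 h"
        by (simp add: f_def algebra_simps)
      then have "int m dvd (int j - int i) * v0 h" by (metis dvd_triv_left)
      then have "int m dvd int j - int i" using ramified by (simp add: coprime_commute coprime_dvd_mult_left_iff)
      moreover have "i < m" "j < m" using that Am by auto
      then have "\<bar>int j - int i\<bar> < int m" by linarith
      ultimately have "int j - int i = 0" using dvd_imp_le_int[of "int j - int i" "int m"] by fastforce
      then show False using \<open>i \<noteq> j\<close> by simp
    qed
    have sum: "ev u g = (\<Sum>j<m. t j)" using ev_sum[OF g(1)] by (simp add: t_def)
    have "(\<Sum>j<m. t j) \<noteq> 0 \<and> V (\<Sum>j<m. t j) = V (t i)"
    proof (rule V.val_sum_eq)
      show "i \<in> {..<m}" "t i \<noteq> 0" using i Am u_nz by (auto simp: t_def A_def)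
      fix j assume "j \<in> {..<m}" "j \<noteq> i" "t j \<noteq> 0"
      then have j: "j \<in> A" by (auto simp: t_def A_def emb_0)
      then have "f i < f j" using i inj[of i j] \<open>j \<noteq> i\<close> by force
      then show "V (t i) < V (t j)" using Vt i(1) j c0 by (simp add: A_def)
    qed simp
    then show ?thesis
      using sum Vt[of i] i Am c0 by (auto simp: A_def f_def intro!: exI[of _ i] mult_left_mono)
  qed
  \<comment> \<open>All values of \<open>V\<close> are now multiples of \<open>c\<close>, so an
    element of value 1 forces \<open>c = 1\<close>: the ramification index is exactly
    \<open>m\<close>.\<close>
  obtain z where z: "z \<noteq> 0" "V z = 1" using V.val_surj by auto
  obtain k where k: "degree k < m" "z = ev u k" using representation .
  have "k \<noteq> 0" using z k by (auto simp: ev_0)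
  then obtain i where "1 = c * (int m * v0 (coeff k i) + int i * v0 h)" using main[OF k(1)] z k by metis
  then have "c dvd 1" by (metis dvd_triv_left)
  then have "c = 1" using c0 by simp
  then show "ev u g \<noteq> 0"
    and "\<exists>i<m. coeff g i \<noteq> 0 \<and> V (ev u g) = int m * v0 (coeff g i) + int i * v0 h"
    and "\<And>j. coeff g j \<noteq> 0 \<Longrightarrow> V (ev u g) \<le> int m * v0 (coeff g j) + int j * v0 h"
    using main[OF g] by auto
qed

lemma Q0_valuation:
  obtains V e where "valuation V" "Q0 = vmax V" "e > 0" "\<And>a. a \<noteq> 0 \<Longrightarrow> V (emb a) = e * v0 a"
proof -
  obtain V v e where V: "valuation V" "Q0 = vmax V" "v \<in> base_vals" "e > 0"
    "\<And>a. a \<noteq> 0 \<Longrightarrow> V (emb a) = e * v a"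
    using place_valuation[OF Q0] by blast
  have "vmax v0 \<subseteq> vmax v"
  proof
    fix a assume "a \<in> vmax v0"
    then have "emb a \<in> vmax V" using Q0_over V(2) by blast
    then show "a \<in> vmax v" using V(4,5) by (cases "a = 0") (auto simp: vmax_def zero_less_mult_iff)
  qed
  then have "v = v0" using base_val_eqI V(3) v0 by blast
  then show thesis using that V by blast
qed

text \<open>The minimum formula of \<open>ramified_valuation\<close> involves only \<open>v0\<close>
  and \<open>h\<close>, so two valuations above \<open>v0\<close> agree on every nonzero
  element.\<close>

lemma unique_place:
  assumes "valuation V" "e > 0" "\<And>a. a \<noteq> 0 \<Longrightarrow> V (emb a) = e * v0 a"
  shows "vmax V = Q0"
proof -
  obtain V0 e0 where V0: "valuation V0" "Q0 = vmax V0" "e0 > 0" "\<And>a. a \<noteq> 0 \<Longrightarrow> V0 (emb a) = e0 * v0 a"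
    using Q0_valuation by blast
  have "V z = V0 z" if "z \<noteq> 0" for z
  proof -
    obtain g where g: "degree g < m" "z = ev u g" using representation .
    then have "g \<noteq> 0" using that by (auto simp: ev_0)
    note 1 = ramified_valuation[OF assms g(1) this] and 2 = ramified_valuation[OF V0(1,3,4) g(1) this]
    show ?thesis unfolding g(2) using 1(2,3) 2(2,3) by (metis order_antisym)
  qed
  then have "z \<in> vmax V \<longleftrightarrow> z \<in> vmax V0" for z by (cases "z = 0") (simp_all add: vmax_def)
  then show ?thesis using V0(2) by blast
qed

text \<open>A nonzero remainder modulo \<open>kpoly\<close> has a unique term of least value and
  cannot vanish at \<open>u\<close>. This is what makes the conjugations well defined.\<close>

lemma ev_eq_0:
  assumes "ev u g = 0" shows "kpoly dvd g"
proof -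
  obtain V e where V: "valuation V" "e > 0" "\<And>a. a \<noteq> 0 \<Longrightarrow> V (emb a) = e * v0 a"
    using Q0_valuation by metis
  have "g mod kpoly = 0"
    using ramified_valuation(1)[OF V ev_mod_kpoly(2), of g] ev_mod_kpoly(1)[of g] assms by auto
  then show ?thesis by (simp add: dvd_eq_mod_eq_0)
qed

lemma emb_of_nat: "emb (of_nat n) = of_nat n"
  by (induction n) (simp_all add: emb_0 emb_1 emb_plus)

lemma of_nat_constant: "(of_nat n :: 'k poly fract) = to_fract [:of_nat n:]"
  by (simp add: of_nat_fract to_fract_def of_nat_poly)

interpretation ac: field_embedding "\<lambda>a. to_ac (emb a)"
  by unfold_locales (simp_all add: emb_1 emb_plus emb_times)

lemma of_nat_m_ac: "of_nat m \<noteq> (0 :: 'f alg_closure)"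
proof -
  have "to_fract [:of_nat m:] \<noteq> (0 :: 'k poly fract)" using m_unit by simp
  then have "emb (of_nat m) \<noteq> 0" by (simp add: of_nat_constant)
  then have "(of_nat m :: 'f) \<noteq> 0" by (simp add: emb_of_nat)
  then show ?thesis by (metis to_ac_of_nat to_ac_eq_0_iff)
qed

text \<open>Two representations of an element differ by a multiple of \<open>kpoly\<close>, which
  \<open>\<zeta> * to_ac u\<close> annihilates just as \<open>u\<close> does; so
  \<open>\<sigma>\<close> does not depend on the chosen representation.\<close>

lemma conjugation:
  fixes \<zeta> :: "'f alg_closure"
  assumes \<zeta>: "\<zeta> ^ m = 1"
  obtains \<sigma> :: "'f \<Rightarrow> 'f alg_closure"
  where "field_embedding \<sigma>" "\<And>g. \<sigma> (ev u g) = ac.ev (\<zeta> * to_ac u) g"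
proof -
  let ?t = "\<zeta> * to_ac u"
  define \<sigma> where "\<sigma> z = ac.ev ?t (SOME g. ev u g = z)" for z
  have "ac.ev ?t kpoly = 0"
    using \<zeta> by (simp add: kpoly_def ac.ev_diff ac.ev_monom ac.ev_const emb_1 power_mult_distrib
        flip: u_power)
  have \<sigma>: "\<sigma> (ev u g) = ac.ev ?t g" for g
  proof -
    let ?g = "SOME g'. ev u g' = ev u g"
    have "ev u ?g = ev u g" by (rule someI[of _ g]) simp
    then have "ev u (?g - g) = 0" by (simp add: ev_diff)
    then obtain k where "?g - g = kpoly * k" using ev_eq_0 by (metis dvdE)
    then have "ac.ev ?t ?g - ac.ev ?t g = 0"
      using \<open>ac.ev ?t kpoly = 0\<close> by (simp add: ac.ev_times flip: ac.ev_diff)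
    then show ?thesis by (simp add: \<sigma>_def)
  qed
  have "field_embedding \<sigma>"
  proof
    show "\<sigma> 1 = 1" using \<sigma>[of 1] by (simp add: ev_1 ac.ev_1)
    fix a b :: 'f
    obtain f g where "a = ev u f" "b = ev u g" using representation by metis
    then show "\<sigma> (a + b) = \<sigma> a + \<sigma> b" "\<sigma> (a * b) = \<sigma> a * \<sigma> b"
      by (simp_all add: \<sigma> ac.ev_plus ac.ev_times flip: ev_plus ev_times)
  qed
  then show thesis using that \<sigma> by blast
qed

text \<open>Pulling back a valuation ring of the algebraic closure along the conjugations bounds all
  conjugates of \<open>z\<close>, and the component of \<open>z\<close> in degree \<open>i\<close> is an average of conjugates weighted by
  roots of unity.\<close>

lemma component_regular:
  assumes g: "degree g < m"
    and reg: "\<And>Q. place (constants emb) Q \<Longrightarrow> Q \<noteq> Q0 \<Longrightarrow> ev u g \<in> ring_of_place Q"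
    and v: "v \<in> base_vals" "v \<noteq> v0" and i: "i < m" "coeff g i \<noteq> 0"
  shows "0 \<le> int m * v (coeff g i) + int i * v h"
proof -
  interpret v: valuation v by (rule valuation_base_vals[OF v(1)])
  obtain W where W: "valuation_ring {0} W" "\<And>a. to_ac (emb a) \<in> W \<longleftrightarrow> a \<in> vring v"
    using valuation_ring_extension[OF v.valuation_axioms ac.field_embedding_axioms] by blast
  have const: "to_fract [:c:] \<in> vring v" for c
    using base_vals_const[OF v(1), of c] by (cases "c = 0") (simp_all add: vring_def)
  have conj_W: "ac.ev (\<zeta> * to_ac u) g \<in> W" if \<zeta>: "\<zeta> ^ m = 1" for \<zeta> :: "'f alg_closure"
  proof -
    obtain \<sigma> :: "'f \<Rightarrow> 'f alg_closure"
      where \<sigma>: "field_embedding \<sigma>" "\<And>g. \<sigma> (ev u g) = ac.ev (\<zeta> * to_ac u) g"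
      using conjugation[OF \<zeta>] by blast
    interpret s: field_embedding \<sigma> by fact
    have \<sigma>_emb: "\<sigma> (emb a) = to_ac (emb a)" for a
      using \<sigma>(2)[of "[:a:]"] by (simp add: ev_const ac.ev_const)
    \<comment> \<open>Since \<open>\<sigma>\<close> acts on K(x) as the inclusion, the pullback of
      \<open>W\<close> lies over \<open>v\<close>; its place is not \<open>Q0\<close>, so
      \<open>ev u g\<close> is regular there.\<close>
    define R where "R = {z. \<sigma> z \<in> W}"
    have embR: "emb a \<in> R \<longleftrightarrow> a \<in> vring v" for a by (simp add: R_def \<sigma>_emb W(2))
    obtain \<pi> where \<pi>: "\<pi> \<noteq> 0" "v \<pi> = 1" using v.val_surj by auto
    have R: "valuation_ring (constants emb) R"
      unfolding valuation_ring_def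
    proof (intro conjI ballI allI)
      show "1 \<in> R" using valuation_ring_one[OF W(1)] by (simp add: R_def s.emb_1)
      show "a - b \<in> R" "a * b \<in> R" if "a \<in> R" "b \<in> R" for a b
        using that valuation_ring_diff[OF W(1)] valuation_ring_mult[OF W(1)]
        by (simp_all add: R_def s.emb_diff s.emb_times)
      show "z \<in> R \<or> inverse z \<in> R" for z
        using valuation_ring_total[OF W(1)] by (simp add: R_def s.emb_inverse)
      have "emb (inverse \<pi>) \<notin> R" using \<pi> by (simp add: embR vring_def v.val_inverse)
      then show "R \<subset> UNIV" by blast
      have "emb \<pi> \<notin> constants emb"
      proof
        assume "emb \<pi> \<in> constants emb"
        then obtain c where "emb (\<pi> - to_fract [:c:]) = 0" by (auto simp: constants_def emb_diff)
        then have "\<pi> = to_fract [:c:]" by simp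
        then show False using \<pi> base_vals_const[OF v(1), of c] by (cases "c = 0") auto
      qed
      moreover have "emb \<pi> \<in> R" using \<pi> by (simp add: embR vring_def)
      moreover have "constants emb \<subseteq> R" using const by (auto simp: constants_def embR)
      ultimately show "constants emb \<subset> R" by blast
    qed
    define Q where "Q = {z. z = 0 \<or> inverse z \<notin> R}"
    have Q: "place (constants emb) Q" "ring_of_place Q = R"
      using R place_iff ring_of_place_eq[OF R] by (auto simp: Q_def)
    \<comment> \<open>A function with its only pole at \<open>v0\<close> is regular at
      \<open>v\<close>, hence in \<open>R\<close>, while its inverse lies in
      \<open>Q0\<close>.\<close>
    have "Q \<noteq> Q0"
    proof
      assume "Q = Q0"
      obtain w where w: "w \<noteq> 0" "v0 w = -1" "0 \<le> v w" using base_val_pole[OF v0] v by metis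
      then have "inverse w \<in> vmax v0" by (simp add: vmax_def v0.val_inverse)
      then have "emb (inverse w) \<in> Q" using Q0_over \<open>Q = Q0\<close> by blast
      then have "emb w \<notin> R" using w(1) by (simp add: Q_def emb_inverse)
      then show False using w by (simp add: embR vring_def)
    qed
    then have "ev u g \<in> R" using reg[OF Q(1)] Q(2) by simp
    then show ?thesis by (simp add: R_def \<sigma>(2))
  qed
  have root_W: "\<zeta> \<in> W" if "\<zeta> ^ m = 1" for \<zeta>
    using valuation_ring_root[OF W(1) m_pos] that valuation_ring_one[OF W(1)] by metis
  let ?U = "{\<zeta> :: 'f alg_closure. \<zeta> ^ m = 1}"
  \<comment> \<open>The weight \<open>\<zeta> ^ (m - i)\<close> is the inverse of
    \<open>\<zeta> ^ i\<close> with a natural exponent; \<open>m - i + j\<close> is divisible by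
    \<open>m\<close> only for \<open>j = i\<close>, so only the term in degree \<open>i\<close>
    survives.\<close>
  have pow_sum: "(\<Sum>\<zeta>\<in>?U. \<zeta> ^ (m - i) * \<zeta> ^ j) = (if j = i then of_nat m else 0)" if "j < m" for j
  proof -
    have "(\<Sum>\<zeta>\<in>?U. \<zeta> ^ (m - i) * \<zeta> ^ j) = (\<Sum>\<zeta>\<in>?U. \<zeta> ^ ((m - i + j) mod m))"
    proof (intro sum.cong refl)
      fix \<zeta> assume \<zeta>: "\<zeta> \<in> ?U"
      have "\<zeta> ^ (m - i) * \<zeta> ^ j = \<zeta> ^ (m * ((m - i + j) div m) + (m - i + j) mod m)"
        by (simp add: power_add)
      also have "\<dots> = \<zeta> ^ ((m - i + j) mod m)"
        using \<zeta> by (simp only: power_add power_mult) simp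
      finally show "\<zeta> ^ (m - i) * \<zeta> ^ j = \<zeta> ^ ((m - i + j) mod m)" .
    qed
    also have "\<dots> = (if j = i then of_nat m else 0)"
    proof (cases "j = i")
      case True
      then show ?thesis using i card_roots_of_unity(1)[OF of_nat_m_ac] by simp
    next
      case False
      have "(m - i + j) mod m \<noteq> 0"
      proof
        assume "(m - i + j) mod m = 0"
        then obtain k where k: "m - i + j = m * k" by (auto simp: mod_eq_0_iff_dvd)
        have "0 < m * k" "m * k < m * 2" using k i that by linarith+
        then have "k = 1" by simp
        then show False using k False i by simp
      qed
      then show ?thesis using False sum_powers_roots_of_unity[OF of_nat_m_ac] m_pos by simp
    qed
    finally show ?thesis .
  qed
  have "(\<Sum>\<zeta>\<in>?U. \<zeta> ^ (m - i) * ac.ev (\<zeta> * to_ac u) g) =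
      (\<Sum>\<zeta>\<in>?U. \<Sum>j<m. to_ac (emb (coeff g j)) * to_ac u ^ j * (\<zeta> ^ (m - i) * \<zeta> ^ j))"
    by (simp add: ac.ev_sum[OF g] sum_distrib_left power_mult_distrib mult_ac)
  also have "\<dots> = (\<Sum>j<m. to_ac (emb (coeff g j)) * to_ac u ^ j * (\<Sum>\<zeta>\<in>?U. \<zeta> ^ (m - i) * \<zeta> ^ j))"
    by (subst sum.swap) (simp add: sum_distrib_left)
  also have "\<dots> = (\<Sum>j<m. if j = i then to_ac (emb (coeff g j)) * to_ac u ^ j * of_nat m else 0)"
    by (intro sum.cong refl) (simp add: pow_sum)
  also have "\<dots> = to_ac (emb (coeff g i)) * to_ac u ^ i * of_nat m" using i by simp
  finally have avg: "(\<Sum>\<zeta>\<in>?U. \<zeta> ^ (m - i) * ac.ev (\<zeta> * to_ac u) g) =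
    to_ac (emb (coeff g i)) * to_ac u ^ i * of_nat m" .
  have "(\<Sum>\<zeta>\<in>?U. \<zeta> ^ (m - i) * ac.ev (\<zeta> * to_ac u) g) \<in> W"
    using conj_W root_W by (intro valuation_ring_sum[OF W(1)] valuation_ring_mult[OF W(1)] valuation_ring_power[OF W(1)]) auto
  \<comment> \<open>Division by \<open>m\<close> stays inside \<open>W\<close>: as \<open>m\<close>
    is nonzero in K, its inverse is a constant.\<close>
  moreover have "inverse (of_nat m) \<in> W"
  proof -
    have "(to_fract [:inverse (of_nat m):] :: 'k poly fract) = inverse (of_nat m)"
      unfolding of_nat_constant using m_unit
      by (intro inverse_unique[symmetric]) (simp flip: to_fract_mult one_pCons)
    then have "to_ac (emb (inverse (of_nat m))) \<in> W" using W(2) const by metis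
    then show ?thesis by (simp add: emb_inverse emb_of_nat)
  qed
  ultimately have "to_ac (emb (coeff g i)) * to_ac u ^ i * of_nat m * inverse (of_nat m) \<in> W"
    unfolding avg by (rule valuation_ring_mult[OF W(1)])
  then have "to_ac (emb (coeff g i)) * to_ac u ^ i \<in> W" using of_nat_m_ac by (simp add: mult.assoc)
  \<comment> \<open>The term itself need not lie in K(x), where \<open>W\<close> is known; its
    \<open>m\<close>-th power does.\<close>
  then have "(to_ac (emb (coeff g i)) * to_ac u ^ i) ^ m \<in> W" by (rule valuation_ring_power[OF W(1)])
  also have "(to_ac (emb (coeff g i)) * to_ac u ^ i) ^ m = to_ac (emb (coeff g i ^ m * h ^ i))"
    by (simp add: emb_times emb_power power_mult_distrib flip: u_power power_mult)
       (simp add: mult.commute)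
  finally have "coeff g i ^ m * h ^ i \<in> vring v" by (simp add: W(2))
  then show ?thesis using i(2) h_nz by (simp add: vring_def v.val_mult v.val_power)
qed

end

subsection \<open>The Weierstrass semigroup\<close>

context totally_ramified_extension
begin

text \<open>For \<open>V\<close> over \<open>v\<close> one has
  \<open>m V(a u^i) = e (m v(a) + i v(h))\<close>, so regularity of a term is tested by integers
  computed in K(x). At \<open>Q0\<close>, where \<open>e = m\<close>, the same expression is the
  value itself.\<close>

lemma weierstrass_semigroup_iff:
  assumes n: "n > 0"
  shows "n \<in> weierstrass_semigroup (constants emb) Q0 \<longleftrightarrow>
    (\<exists>a i. a \<noteq> 0 \<and> i < m \<and> (\<forall>v\<in>base_vals. v \<noteq> v0 \<longrightarrow> 0 \<le> int m * v a + int i * v h) \<and>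
      int n = - (int m * v0 a + int i * v0 h))" (is "?l \<longleftrightarrow> ?r")
proof
  assume ?l
  then obtain z where z: "z \<noteq> 0" "pole_divisor (constants emb) z = multiple_of_place n Q0"
    by (auto simp: weierstrass_semigroup_def)
  obtain V e where V: "valuation V" "Q0 = vmax V" "e > 0" "\<And>a. a \<noteq> 0 \<Longrightarrow> V (emb a) = e * v0 a"
    using Q0_valuation by blast
  have "max 0 (- V z) = int n"
    using fun_cong[OF z(2), of Q0] Q0 V(2) valuation.place_val_vmax[OF V(1) z(1)]
    by (simp add: pole_divisor_def multiple_of_place_def)
  \<comment> \<open>The truncation by \<open>max 0\<close> loses nothing because
    \<open>n > 0\<close>.\<close>
  then have Vz: "V z = - int n" using n by linarith
  have reg: "z \<in> ring_of_place Q" if Q: "place (constants emb) Q" "Q \<noteq> Q0" for Q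
  proof -
    obtain V' where V': "valuation V'" "Q = vmax V'" using place_valuation[OF Q(1)] by metis
    have "max 0 (- V' z) = 0"
      using fun_cong[OF z(2), of Q] Q V'(2) valuation.place_val_vmax[OF V'(1) z(1)]
      by (simp add: pole_divisor_def multiple_of_place_def)
    then have "0 \<le> V' z" by linarith
    then show ?thesis using V' valuation.ring_of_place_vmax[OF V'(1)] by (simp add: vring_def)
  qed
  obtain g where g: "degree g < m" "z = ev u g" using representation .
  have g0: "g \<noteq> 0" using z(1) g(2) by (auto simp: ev_0)
  obtain i where i: "i < m" "coeff g i \<noteq> 0" "V z = int m * v0 (coeff g i) + int i * v0 h"
    using ramified_valuation(2)[OF V(1,3,4) g(1) g0] g(2) by blast
  have "0 \<le> int m * v (coeff g i) + int i * v h" if "v \<in> base_vals" "v \<noteq> v0" for v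
    using component_regular[OF g(1) _ that i(1,2)] reg g(2) by blast
  then show ?r using i Vz by (intro exI[of _ "coeff g i"] exI[of _ i]) auto
next
  assume ?r
  then obtain a i where a: "a \<noteq> 0" "i < m"
    "\<And>v. v \<in> base_vals \<Longrightarrow> v \<noteq> v0 \<Longrightarrow> 0 \<le> int m * v a + int i * v h"
    "int n = - (int m * v0 a + int i * v0 h)" by blast
  define z where "z = emb a * u ^ i"
  have z0: "z \<noteq> 0" using a u_nz by (simp add: z_def)
  have "pole_divisor (constants emb) z Q = multiple_of_place n Q0 Q" for Q
  proof (cases "place (constants emb) Q")
    case False
    then show ?thesis using Q0 by (auto simp: pole_divisor_def multiple_of_place_def)
  next
    case True
    obtain V v e where V: "valuation V" "Q = vmax V" "v \<in> base_vals" "e > 0"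
      "\<And>a. a \<noteq> 0 \<Longrightarrow> V (emb a) = e * v a"
      using place_valuation[OF True] by blast
    interpret V: valuation V by fact
    have pv: "place_val Q z = V z" using V.place_val_vmax[OF z0] V(2) by simp
    have "int m * V u = e * v h" using V.val_power[OF u_nz, of m] V(5)[OF h_nz] u_power by simp
    moreover have "V z = e * v a + int i * V u"
      using a u_nz by (simp add: z_def V.val_mult V.val_power V(5))
    ultimately have mV: "int m * V z = e * (int m * v a + int i * v h)"
      by (simp add: algebra_simps)
    show ?thesis
    proof (cases "v = v0")
      case True
      have Q: "Q = Q0" using unique_place[OF V(1,4)] V(5) True V(2) by blast
      let ?g = "monom a i"
      have g: "degree ?g < m" "?g \<noteq> 0" using a by (auto simp: degree_monom_eq)
      have "\<exists>j<m. coeff ?g j \<noteq> 0 \<and> V (ev u ?g) = int m * v0 (coeff ?g j) + int j * v0 h"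
        by (rule ramified_valuation(2)[OF V(1,4) _ g]) (use V(5) True in simp)
      then have "V z = - int n"
        using a(4) by (auto simp: z_def ev_monom split: if_splits)
      then show ?thesis using Q Q0 pv by (simp add: pole_divisor_def multiple_of_place_def)
    next
      case False
      have "Q \<noteq> Q0"
      proof
        assume "Q = Q0"
        have "vmax v0 \<subseteq> vmax v"
        proof
          fix b assume "b \<in> vmax v0"
          then have "emb b \<in> vmax V" using Q0_over V(2) \<open>Q = Q0\<close> by blast
          then show "b \<in> vmax v" using V(4,5) by (cases "b = 0") (auto simp: vmax_def zero_less_mult_iff)
        qed
        then show False using base_val_eqI[OF V(3) v0] False by blast
      qed
      have "0 \<le> int m * V z" unfolding mV using a(3)[OF V(3) False] V(4) by simp
      then have "0 \<le> V z" using m_pos by (simp add: zero_le_mult_iff)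
      then show ?thesis using \<open>Q \<noteq> Q0\<close> pv by (simp add: pole_divisor_def multiple_of_place_def)
    qed
  qed
  then show ?l using z0 unfolding weierstrass_semigroup_def by blast
qed

lemma zero_in_weierstrass_semigroup: "0 \<in> weierstrass_semigroup (constants emb) Q0"
proof -
  have "pole_divisor (constants emb) 1 Q = 0" for Q
  proof (cases "place (constants emb) Q")
    case True
    obtain V where V: "valuation V" "Q = vmax V" using place_valuation[OF True] by metis
    then show ?thesis
      using valuation.place_val_vmax[OF V(1), of 1] valuation.val_one[OF V(1)]
      by (simp add: pole_divisor_def)
  qed (simp add: pole_divisor_def)
  then have "pole_divisor (constants emb) 1 = multiple_of_place 0 Q0"
    by (auto simp: multiple_of_place_def)
  then show ?thesis unfolding weierstrass_semigroup_def by (intro CollectI exI[of _ 1]) simp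
qed

end

section \<open>Functions with prescribed values at P_0, ..., P_r\<close>

definition indexed_val :: "(nat \<Rightarrow> 'k::field poly) \<Rightarrow> nat \<Rightarrow> 'k poly fract \<Rightarrow> int" where
  "indexed_val p k = (if k = 0 then inf_val else fin_val (p k))"

lemma sum_0_r: "(\<Sum>k=0..r. f k * int (place_deg p k)) = f 0 + (\<Sum>k=1..r. f k * int (degree (p k)))"
  by (simp add: sum.atLeast_Suc_atMost place_deg_def)

lemma degree_sum_indexed:
  fixes p :: "nat \<Rightarrow> 'k::field poly"
  assumes p: "inj_on p {1..r}" "p ` {1..r} \<subseteq> monic_irreducibles" and a: "a \<noteq> 0"
    and n: "\<And>k. k \<le> r \<Longrightarrow> n k \<le> indexed_val p k a"
    and other: "\<And>v. v \<in> base_vals \<Longrightarrow> v \<notin> indexed_val p ` {0..r} \<Longrightarrow> 0 \<le> v a"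
  shows "(\<Sum>k=0..r. n k * int (place_deg p k)) \<le> 0"
  unfolding sum_0_r
proof (rule degree_sum_le_0[OF _ p a])
  show "n i \<le> fin_val (p i) a" if "i \<in> {1..r}" for i using n[of i] that by (simp add: indexed_val_def)
  show "n 0 \<le> inf_val a" using n[of 0] by (simp add: indexed_val_def)
  fix g assume g: "g \<in> monic_irreducibles" "g \<notin> p ` {1..r}"
  show "0 \<le> fin_val g a"
  proof (cases "fin_val g \<in> indexed_val p ` {0..r}")
    case False
    then show ?thesis using other g by (simp add: base_vals_def)
  next
    case True
    then obtain k where k: "k \<le> r" "fin_val g = indexed_val p k" by auto
    \<comment> \<open>This case is contradictory: at \<open>g\<close> itself this valuation is 1,
      whereas the one at infinity is at most 0 and the one of a different \<open>p k\<close> is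
      0.\<close>
    have 1: "fin_val g (to_fract g) = 1" using g by (simp add: fin_val_monic_irreducible)
    have "g \<noteq> 0" using g by (auto simp: monic_irreducibles_def irreducible_def)
    then have "inf_val (to_fract g) \<le> 0" by (simp add: inf_val_to_fract)
    then have "fin_val g \<noteq> inf_val" using 1 by auto
    then have "k \<noteq> 0" using k by (auto simp: indexed_val_def)
    then have "p k \<in> monic_irreducibles" "g \<noteq> p k" using k p(2) g by auto
    then have "fin_val (p k) (to_fract g) = 0" using g by (simp add: fin_val_monic_irreducible)
    then show ?thesis using 1 k \<open>k \<noteq> 0\<close> by (simp add: indexed_val_def)
  qed
qed simp

lemma indexed_val_base:
  "p ` {1..r} \<subseteq> monic_irreducibles \<Longrightarrow> k \<le> r \<Longrightarrow> indexed_val p k \<in> base_vals"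
  by (cases "k = 0") (auto simp: indexed_val_def base_vals_def image_subset_iff)

text \<open>Converse to \<open>degree_sum_indexed\<close>: the product has the prescribed values at
  the finite places, and total degree 0 forces the value at infinity to be
  \<open>n 0\<close>.\<close>

lemma indexed_val_prod:
  fixes p :: "nat \<Rightarrow> 'k::field poly"
  assumes p: "inj_on p {1..r}" "p ` {1..r} \<subseteq> monic_irreducibles"
    and n: "(\<Sum>k=0..r. n k * int (place_deg p k)) = 0"
  shows "k \<le> r \<Longrightarrow> indexed_val p k (\<Prod>i=1..r. to_fract (p i) powi n i) = n k"
    and "v \<in> base_vals \<Longrightarrow> v \<notin> indexed_val p ` {0..r} \<Longrightarrow> v (\<Prod>i=1..r. to_fract (p i) powi n i) = 0"
proof -
  show "indexed_val p k (\<Prod>i=1..r. to_fract (p i) powi n i) = n k" if "k \<le> r"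
  proof (cases "k = 0")
    case True
    have "inf_val (\<Prod>i=1..r. to_fract (p i) powi n i) = - (\<Sum>i=1..r. n i * int (degree (p i)))"
      by (rule inf_val_prod_powi[OF _ p(2)]) simp
    then show ?thesis using n True unfolding sum_0_r by (simp add: indexed_val_def)
  next
    case False
    then have k: "k \<in> {1..r}" using that by simp
    then have "p k \<in> monic_irreducibles" using p(2) by blast
    then show ?thesis using k fin_val_prod_powi(1)[OF _ p, of "p k" k n] p False
      by (auto simp: indexed_val_def)
  qed
  show "v (\<Prod>i=1..r. to_fract (p i) powi n i) = 0" if v: "v \<in> base_vals" "v \<notin> indexed_val p ` {0..r}"
  proof -
    have "v \<noteq> inf_val" using v(2) by (force simp: indexed_val_def)
    then obtain g where g: "g \<in> monic_irreducibles" "v = fin_val g" using v(1) by (auto simp: base_vals_def)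
    have "g \<notin> p ` {1..r}"
    proof
      assume "g \<in> p ` {1..r}"
      then obtain i where "i \<in> {1..r}" "g = p i" by blast
      then have "v = indexed_val p i" "i \<in> {0..r}" using g by (auto simp: indexed_val_def)
      then show False using v(2) by blast
    qed
    then show ?thesis using fin_val_prod_powi(2)[OF _ p g(1)] g(2) by simp
  qed
qed

lemma indexed_val_inj:
  fixes p :: "nat \<Rightarrow> 'k::field poly"
  assumes p: "inj_on p {1..r}" "p ` {1..r} \<subseteq> monic_irreducibles"
    and "j \<le> r" "k \<le> r" "j \<noteq> k"
  shows "indexed_val p j \<noteq> indexed_val p k"
proof -
  \<comment> \<open>Each of the two places gets the degree of the other, with opposite signs, so the
    total degree is 0; the resulting function has a zero at \<open>j\<close> and a pole at
    \<open>k\<close>.\<close>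
  define n where "n i = (if i = j then int (place_deg p k) else if i = k then - int (place_deg p j) else 0)" for i
  have "(\<Sum>i=0..r. n i * int (place_deg p i)) = (\<Sum>i\<in>{j, k}. n i * int (place_deg p i))"
    using assms by (intro sum.mono_neutral_right) (auto simp: n_def)
  also have "\<dots> = 0" using assms by (simp add: n_def)
  finally have *: "(\<Sum>i=0..r. n i * int (place_deg p i)) = 0" .
  have d: "place_deg p i > 0" if "i \<le> r" for i
  proof (cases "i = 0")
    case False
    then have "i \<in> {1..r}" using that by simp
    then have "irreducible (p i)" using p(2) by (auto simp only: monic_irreducibles_def image_subset_iff)
    then show ?thesis using False by (auto simp: place_deg_def irreducible_def is_unit_iff_degree)
  qed (simp add: place_deg_def)
  have "n j > 0" "n k < 0" using assms d by (auto simp: n_def)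
  then show ?thesis
    using indexed_val_prod(1)[OF p * assms(3)] indexed_val_prod(1)[OF p * assms(4)] by auto
qed

text \<open>As \<open>e\<close> is -1 modulo \<open>m\<close>, the remainder of \<open>i e\<close>
  is \<open>m - i\<close> for \<open>0 < i < m\<close> and 0 for \<open>i = 0\<close>. Hence the
  different bounds for multiples of \<open>m\<close> and for the other classes.\<close>

lemma neg_mult_div_of_cong:
  fixes i m :: nat and e :: int
  assumes "int m dvd e + 1" "i < m"
  shows "int m * - (int i * e div int m) = - (int i * e) + (if i = 0 then 0 else int m - int i)"
proof (cases "i = 0")
  case False
  obtain t where t: "e + 1 = int m * t" using assms(1) by (elim dvdE)
  have eq: "int i * e = (int m - int i) + int m * (int i * t - 1)"
  proof -
    have "int i * e = int i * (e + 1) - int i" by (simp add: algebra_simps)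
    also have "\<dots> = int i * (int m * t) - int i" by (simp only: t)
    also have "\<dots> = (int m - int i) + int m * (int i * t - 1)" by (simp add: algebra_simps)
    finally show ?thesis .
  qed
  have div: "int i * e div int m = int i * t - 1" unfolding eq using False assms(2) by simp
  show ?thesis unfolding div unfolding eq using False by (simp add: algebra_simps)
qed simp

section \<open>Membership through ceiling sums\<close>

context totally_ramified_extension
begin

text \<open>Away from P_s, regularity of \<open>a u^i\<close> says that the value of
  \<open>a\<close> is at least the ceiling \<open>N i k\<close>; the degree formula then bounds the
  sum of the ceilings by what the pole at P_s allows. Conversely, since P_s has degree 1, the whole
  balance can be placed there.\<close>

lemma weierstrass_semigroup_ceilings:
  fixes p :: "nat \<Rightarrow> 'k poly" and r s n :: nat
  assumes p: "inj_on p {1..r}" "p ` {1..r} \<subseteq> monic_irreducibles"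
    and s: "s \<le> r" "place_deg p s = 1" "v0 = indexed_val p s"
    and h: "\<And>v. v \<in> base_vals \<Longrightarrow> v \<notin> indexed_val p ` {0..r} \<Longrightarrow> v h = 0"
    and e: "int m dvd v0 h + 1" and n: "n > 0"
  shows "n \<in> weierstrass_semigroup (constants emb) Q0 \<longleftrightarrow>
    (\<Sum>k=0..r. - (int (n mod m) * indexed_val p k h div int m) * int (place_deg p k))
      \<le> int (n div m) + (if n mod m = 0 then 0 else 1)"
    (is "_ \<longleftrightarrow> ?c (n mod m) \<le> _")
proof -
  define E where "E k = indexed_val p k h" for k
  define N where "N i k = - (int i * E k div int m)" for i :: nat and k
  define \<delta> where "\<delta> i = (if i = 0 then 0 else 1 :: int)" for i :: nat
  have c_eq: "?c i = (\<Sum>k=0..r. N i k * int (place_deg p k))" for i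
    by (simp add: N_def E_def)
  have split: "(\<Sum>k=0..r. f k * int (place_deg p k)) = f s + (\<Sum>k\<in>{0..r} - {s}. f k * int (place_deg p k))" for f
    using s by (subst sum.remove[of _ s]) auto
  have Es: "E s = v0 h" using s by (simp add: E_def)
  have Ns: "int m * N i s = - (int i * v0 h) + int m * \<delta> i - int i" if "i < m" for i
    using neg_mult_div_of_cong[OF e that] by (auto simp: N_def Es \<delta>_def)
  have bv: "indexed_val p k \<in> base_vals" if "k \<le> r" for k by (rule indexed_val_base[OF p(2) that])
  have mq: "int n = int m * int (n div m) + int (n mod m)"
    by (metis mult_div_mod_eq of_nat_add of_nat_mult)
  show ?thesis
  proof
    assume "n \<in> weierstrass_semigroup (constants emb) Q0"
    then obtain a i where a: "a \<noteq> 0" "i < m"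
      "\<And>v. v \<in> base_vals \<Longrightarrow> v \<noteq> v0 \<Longrightarrow> 0 \<le> int m * v a + int i * v h"
      "int n = - (int m * v0 a + int i * v0 h)"
      using weierstrass_semigroup_iff[OF n] by blast
    \<comment> \<open>\<open>v0 h\<close> is -1 modulo \<open>m\<close>, so the pole order of
      \<open>a u^i\<close> is congruent to \<open>i\<close>.\<close>
    have "int n - int i = int m * (- v0 a) - int i * (v0 h + 1)" using a(4) by (simp add: algebra_simps)
    also have "int m dvd \<dots>" using e by (intro dvd_diff) simp_all
    finally have "int n mod int m = int i mod int m" by (simp add: mod_eq_dvd_iff)
    then have i: "n mod m = i" using a(2) by (simp flip: zmod_int)
    define f where "f k = (if k = s then v0 a else N i k)" for k
    have "(\<Sum>k=0..r. f k * int (place_deg p k)) \<le> 0"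
    proof (rule degree_sum_indexed[OF p a(1)])
      fix k assume k: "k \<le> r"
      show "f k \<le> indexed_val p k a"
      proof (cases "k = s")
        case False
        then have "indexed_val p k \<noteq> v0" using indexed_val_inj[OF p k s(1)] s(3) by simp
        then have "0 \<le> int m * indexed_val p k a + int i * E k" using a(3) bv[OF k] by (simp add: E_def)
        then have "int m * (- indexed_val p k a) \<le> int i * E k" by simp
        then have "int m * (- indexed_val p k a) div int m \<le> int i * E k div int m"
          using m_pos by (intro zdiv_mono1) simp_all
        moreover have "int m * (- indexed_val p k a) div int m = - indexed_val p k a"
          by (rule nonzero_mult_div_cancel_left) (use m_pos in simp)
        ultimately show ?thesis using False by (simp add: f_def N_def)
      qed (simp add: f_def s)
    next
      fix v assume v: "v \<in> base_vals" "v \<notin> indexed_val p ` {0..r}"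
      then have "v \<noteq> v0" using s by auto
      then have "0 \<le> int m * v a" using a(3)[OF v(1)] h[OF v] by simp
      then show "0 \<le> v a" using m_pos by (simp add: zero_le_mult_iff)
    qed
    then have "v0 a + (\<Sum>k\<in>{0..r} - {s}. N i k * int (place_deg p k)) \<le> 0"
      unfolding split by (simp add: f_def)
    then have "?c i - N i s \<le> - v0 a" unfolding c_eq split[of "N i"] by simp
    then have "int m * (?c i - N i s) \<le> int m * (- v0 a)" using m_pos by (intro mult_left_mono) auto
    also have "int m * (- v0 a) = int n + int i * v0 h" using a(4) by simp
    finally have "int m * ?c i \<le> int n - int i + int m * \<delta> i" using Ns[OF a(2)] by (simp add: right_diff_distrib)
    then have "int m * ?c i \<le> int m * (int (n div m) + \<delta> i)" using mq i by (simp add: distrib_left)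
    then show "?c (n mod m) \<le> int (n div m) + (if n mod m = 0 then 0 else 1)"
      using m_pos i by (simp add: \<delta>_def)
  next
    define i where "i = n mod m"
    assume "?c (n mod m) \<le> int (n div m) + (if n mod m = 0 then 0 else 1)"
    then have c: "?c i \<le> int (n div m) + \<delta> i" by (simp add: i_def \<delta>_def)
    have im: "i < m" using m_pos by (simp add: i_def)
    \<comment> \<open>\<open>j\<close> is the slack in the inequality; the factor
      \<open>w ^ j\<close> supplies the missing pole order \<open>m * j\<close>.\<close>
    define j where "j = nat (int (n div m) + \<delta> i - ?c i)"
    have j: "int j = int (n div m) + \<delta> i - ?c i" using c by (simp add: j_def)
    \<comment> \<open>The least admissible values are taken outside \<open>s\<close>; subtracting
      the full sum at \<open>s\<close> makes the degree 0, as
      \<open>place_deg p s = 1\<close>.\<close>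
    define f where "f k = (if k = s then N i s - ?c i else N i k)" for k
    have f: "(\<Sum>k=0..r. f k * int (place_deg p k)) = 0"
    proof -
      have "(\<Sum>k=0..r. f k * int (place_deg p k)) =
          N i s - ?c i + (\<Sum>k\<in>{0..r} - {s}. N i k * int (place_deg p k))"
        by (subst split) (simp add: f_def)
      also have "\<dots> = 0" using trans[OF c_eq[of i] split[of "N i"]] by linarith
      finally show ?thesis .
    qed
    define a where "a = (\<Prod>k=1..r. to_fract (p k) powi f k)"
    have a0: "a \<noteq> 0" unfolding a_def by (rule val_prod_powi(1)[OF _ p(2) v0.valuation_axioms]) simp
    obtain w where w: "w \<noteq> 0" "v0 w = -1" "\<And>v. v \<in> base_vals \<Longrightarrow> v \<noteq> v0 \<Longrightarrow> 0 \<le> v w"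
      using base_val_pole[OF v0] by blast
    have val: "v (a * w ^ j) = v a + int j * v w" if "v \<in> base_vals" for v
      using a0 w(1) valuation.val_mult[OF valuation_base_vals[OF that]]
        valuation.val_power[OF valuation_base_vals[OF that]] by simp
    have "0 \<le> int m * v (a * w ^ j) + int i * v h" if v: "v \<in> base_vals" "v \<noteq> v0" for v
    proof -
      have "0 \<le> int m * (int j * v w)" using w(3)[OF v] by simp
      moreover have "0 \<le> int m * v a + int i * v h"
      proof (cases "v \<in> indexed_val p ` {0..r}")
        case True
        then obtain k where k: "k \<le> r" "v = indexed_val p k" by auto
        then have "v a = N i k" using v s indexed_val_prod(1)[OF p f k(1)] by (auto simp: a_def f_def)
        moreover have "int m * (int i * E k div int m) \<le> int i * E k"
          using mult_div_mod_eq[of "int m" "int i * E k"] pos_mod_sign[of "int m" "int i * E k"] m_pos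
          by linarith
        ultimately show ?thesis using k by (simp add: N_def E_def)
      next
        case False
        then show ?thesis using indexed_val_prod(2)[OF p f v(1) False] h[OF v(1) False] by (simp add: a_def)
      qed
      ultimately show ?thesis unfolding val[OF v(1)] by (simp add: distrib_left)
    qed
    moreover have "int n = - (int m * v0 (a * w ^ j) + int i * v0 h)"
    proof -
      have "v0 a = N i s - ?c i" using indexed_val_prod(1)[OF p f s(1)] s(3) by (simp add: a_def f_def)
      then have "v0 (a * w ^ j) = N i s - int (n div m) - \<delta> i" using val[OF v0] w(2) j by simp
      then have "int m * v0 (a * w ^ j) = int m * N i s - int m * int (n div m) - int m * \<delta> i"
        by (simp add: right_diff_distrib)
      then show ?thesis using Ns[OF im] mq by (simp add: i_def)
    qed
    ultimately show "n \<in> weierstrass_semigroup (constants emb) Q0"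
      using weierstrass_semigroup_iff[OF n] a0 w(1) im by (metis mult_eq_0_iff power_not_zero)
  qed
qed

end

text \<open>For \<open>0 < k < m\<close> the members in class \<open>k\<close> are those with
  \<open>n div m \<ge> c k - 1\<close>, so the largest integer of the class outside \<open>H\<close>
  is \<open>m (c k - 2) + k\<close>. Integers are ordered by quotient, then by remainder; hence
  \<open>i\<close> is the largest index attaining \<open>j\<close>.\<close>

lemma multiplicity_and_frobenius:
  fixes H :: "nat set" and c :: "nat \<Rightarrow> int" and m :: nat
  assumes m: "m \<ge> 2" and H0: "0 \<in> H"
    and H: "\<And>n. n > 0 \<Longrightarrow> n \<in> H \<longleftrightarrow> c (n mod m) \<le> int (n div m) + (if n mod m = 0 then 0 else 1)"
    and c0: "c 0 = 0" and c1: "\<And>i. 0 < i \<Longrightarrow> i < m \<Longrightarrow> 1 \<le> c i"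
  shows "semigroup_multiplicity H = Min ({i \<in> {1..m - 1}. c i - 1 = 0} \<union> {m})"
    and "\<lbrakk>j = Max ((\<lambda>i. c i - 2) ` {1..m - 1}); i = Max {i \<in> {1..m - 1}. c i - 2 = j}\<rbrakk>
      \<Longrightarrow> frobenius_number H = int m * j + int i"
proof -
  let ?S = "{i \<in> {1..m - 1}. c i - 1 = 0} \<union> {m}"
  show "semigroup_multiplicity H = Min ?S"
    unfolding semigroup_multiplicity_def
  proof (rule Least_equality)
    have "Min ?S \<in> ?S" by (rule Min_in) auto
    \<comment> \<open>Below \<open>m\<close> the quotient is 0, so membership of a positive number
      means \<open>c = 1\<close>; \<open>m\<close> itself qualifies by
      \<open>c 0 = 0\<close>.\<close>
    then show "Min ?S \<in> H \<and> Min ?S \<noteq> 0"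
      using H[of "Min ?S"] m c0 by auto
    fix n assume n: "n \<in> H \<and> n \<noteq> 0"
    show "Min ?S \<le> n"
    proof (cases "n < m")
      case True
      then have "c n = 1" using H[of n] n c1[of n] by auto
      then show ?thesis using True n by (intro Min_le) auto
    next
      case False
      have "Min ?S \<le> m" by (rule Min_le) auto
      also have "m \<le> n" using False by simp
      finally show ?thesis .
    qed
  qed
  assume j: "j = Max ((\<lambda>i. c i - 2) ` {1..m - 1})" and i: "i = Max {i \<in> {1..m - 1}. c i - 2 = j}"
  have j_ge: "c k - 2 \<le> j" if "0 < k" "k < m" for k
    unfolding j using that by (intro Max_ge) auto
  have "j \<in> (\<lambda>i. c i - 2) ` {1..m - 1}" unfolding j using m by (intro Max_in) auto
  then have "i \<in> {i \<in> {1..m - 1}. c i - 2 = j}" unfolding i by (intro Max_in) auto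
  then have i_in: "0 < i" "i < m" "c i - 2 = j" by auto
  have i_ge: "k \<le> i" if "0 < k" "k < m" "c k - 2 = j" for k
    unfolding i using that by (intro Max_ge) auto
  have gap_le: "int n \<le> int m * j + int i" if "n \<notin> H" for n
  proof -
    let ?k = "n mod m" and ?q = "n div m"
    have n: "n > 0" using that H0 by (cases n) auto
    have "c ?k > int ?q + (if ?k = 0 then 0 else 1)" using H[OF n] that by linarith
    then have k: "?k > 0" "int ?q \<le> c ?k - 2" using c0 by (cases "?k = 0"; simp)+
    have km: "?k < m" using m by simp
    have "int n = int m * int ?q + int ?k" by (metis mult_div_mod_eq of_nat_add of_nat_mult)
    also have "\<dots> \<le> int m * j + int i"
    proof (cases "int ?q = j")
      case True
      then have "c ?k - 2 = j" using k j_ge[OF k(1) km] by simp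
      then show ?thesis using i_ge[OF k(1) km] True by simp
    next
      case False
      then have "int ?q + 1 \<le> j" using k j_ge[OF k(1) km] by simp
      then have "int m * (int ?q + 1) \<le> int m * j" by (intro mult_left_mono) auto
      then show ?thesis using km by (simp add: distrib_left)
    qed
    finally show ?thesis .
  qed
  show "frobenius_number H = int m * j + int i"
  proof (cases "j < 0")
    \<comment> \<open>The gapless case: every \<open>c k\<close> is 1, so \<open>j = -1\<close> and
      \<open>i = m - 1\<close>, and the formula returns -1, the conventional value.\<close>
    case True
    have "c i \<ge> 1" using c1 i_in by simp
    then have j1: "j = - 1" using True i_in(3) by simp
    have "c (m - 1) = 1" using j_ge[of "m - 1"] c1[of "m - 1"] j1 m by simp
    then have "m - 1 \<le> i" using i_ge[of "m - 1"] j1 m by simp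
    then have "i = m - 1" using i_in by simp
    then have eq: "int m * j + int i = - 1" using j1 m by simp
    then have "- H = {}" using gap_le by fastforce
    then show ?thesis using eq by (simp add: frobenius_number_def)
  next
    case False
    define N where "N = m * nat j + i"
    have N: "int N = int m * j + int i" using False by (simp add: N_def)
    have "N mod m = i" "N div m = nat j" using i_in by (auto simp: N_def)
    then have "N \<notin> H" using H[of N] i_in False by (auto simp: N_def)
    moreover have "n \<le> N" if "n \<notin> H" for n using gap_le[OF that] N by linarith
    ultimately have "Max (- H) = N"
      by (intro Max_eqI) (auto intro: finite_subset[of _ "{..N}"])
    then show ?thesis using \<open>N \<notin> H\<close> N by (auto simp: frobenius_number_def)
  qed
qed

section \<open>From the Kummer data to the ramified radical extension\<close>

lemma is_subfield_powi:
  assumes L: "is_subfield L" and a: "a \<in> L" shows "a powi n \<in> L"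
proof -
  have pow: "b ^ k \<in> L" if "b \<in> L" for b k
    using that L by (induction k) (auto simp: is_subfield_def)
  have "inverse a \<in> L" using L a by (simp add: is_subfield_def)
  then show ?thesis using pow[of a] pow[of "inverse a"] a by (simp add: power_int_def)
qed

text \<open>Translation by 1 permutes \<open>L\<close> and changes the sum of its elements by
  \<open>card L\<close>.\<close>

lemma of_nat_card_subfield:
  fixes L :: "'a::field set"
  assumes L: "is_subfield L" shows "of_nat (card L) = (0 :: 'a)"
proof -
  have "(\<Sum>a\<in>L. a) = (\<Sum>a\<in>L. a + 1)"
    by (rule sum.reindex_bij_witness[of _ "\<lambda>a. a + 1" "\<lambda>a. a - 1"]) (use L in \<open>auto simp: is_subfield_def\<close>)
  also have "\<dots> = (\<Sum>a\<in>L. a) + of_nat (card L)" by (simp add: sum.distrib)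
  finally show ?thesis by simp
qed

context kummer_extension
begin

text \<open>\<open>q\<close> is zero in K by \<open>of_nat_card_subfield\<close>; were
  \<open>m\<close> zero too, a Bezout identity for the coprime pair would make 1 vanish. Averaging
  over roots of unity rests on this.\<close>

lemma m_nonzero: "of_nat m \<noteq> (0 :: 'k)"
proof
  assume m0: "of_nat m = (0 :: 'k)"
  have q0: "of_nat q = (0 :: 'k)" using of_nat_card_subfield[OF Fq_subfield] Fq_card by simp
  have "coprime (int m) (int q)" using m_coprime_q by (simp add: coprime_iff_gcd_eq_1)
  then obtain a b where "a * int m + b * int q = 1" by (metis bezout_int coprime_imp_gcd_eq_1)
  then have "of_int (a * int m + b * int q) = (1 :: 'k)" by simp
  then show False using m0 q0 by simp
qed

lemma p_monic_irreducibles: "p ` {1..r} \<subseteq> monic_irreducibles"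
  using p_monic p_irreducible by (auto simp: monic_irreducibles_def)

lemma emb_embedding: "field_embedding emb"
  by unfold_locales (simp_all add: emb_one emb_add emb_mult)

lemma place_exp_sum: "(\<Sum>k=0..r. place_exp r p lam k * int (place_deg p k)) = 0"
proof -
  have "(\<Sum>k=1..r. place_exp r p lam k * int (degree (p k))) = (\<Sum>k=1..r. lam k * int (degree (p k)))"
    by (intro sum.cong) (auto simp: place_exp_def)
  then show ?thesis unfolding sum_0_r by (simp add: place_exp_def)
qed

abbreviation radicand where "radicand \<equiv> kummer_radicand r \<alpha> p lam"

lemma radicand_eq: "radicand = to_fract [:\<alpha>:] * (\<Prod>k=1..r. to_fract (p k) powi place_exp r p lam k)"
  unfolding kummer_radicand_def by (intro arg_cong2[of _ _ _ _ "(*)"] prod.cong refl) (auto simp: place_exp_def)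

lemma radicand_prod_nz: "(\<Prod>k=1..r. to_fract (p k) powi place_exp r p lam k) \<noteq> 0"
  by (rule val_prod_powi(1)[OF _ p_monic_irreducibles valuation_inf_val]) simp

lemma radicand_nz: "radicand \<noteq> 0"
  unfolding radicand_eq using \<alpha>_nonzero radicand_prod_nz by simp

lemma val_radicand:
  assumes "v \<in> base_vals"
  shows "v radicand = v (\<Prod>k=1..r. to_fract (p k) powi place_exp r p lam k)"
  unfolding radicand_eq
  using valuation.val_mult[OF valuation_base_vals[OF assms] _ radicand_prod_nz, of "to_fract [:\<alpha>:]"]
    base_vals_const[OF assms \<alpha>_nonzero] \<alpha>_nonzero by simp

lemma indexed_val_radicand: "k \<le> r \<Longrightarrow> indexed_val p k radicand = place_exp r p lam k"
  using val_radicand[OF indexed_val_base[OF p_monic_irreducibles]]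
    indexed_val_prod(1)[OF p_distinct p_monic_irreducibles place_exp_sum] by simp

lemma other_val_radicand:
  "v \<in> base_vals \<Longrightarrow> v \<notin> indexed_val p ` {0..r} \<Longrightarrow> v radicand = 0"
  using val_radicand[of v] indexed_val_prod(2)[OF p_distinct p_monic_irreducibles place_exp_sum, of v] by simp

text \<open>Connects the sets of fractions in the statement with valuations: with
  \<open>place_above\<close> it puts the image of \<open>vmax (indexed_val p s)\<close> inside the
  place of F.\<close>

lemma vmax_base_place:
  assumes "s \<le> r" shows "vmax (indexed_val p s) \<subseteq> base_place p s"
proof
  fix z assume z: "z \<in> vmax (indexed_val p s)"
  show "z \<in> base_place p s"
  proof (cases "z = 0")
    case True
    show ?thesis
    proof (cases "s = 0")
      case False
      then have "\<not> p s dvd 1" using p_irreducible assms by (auto simp: irreducible_def)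
      then show ?thesis using True False
        unfolding base_place_def finite_place_def Zero_fract_def
        by (simp del: fract_collapse) (rule exI[of _ 0], rule exI[of _ 1], simp)
    next
      case s: True
      then show ?thesis using True
        unfolding base_place_def infinite_place_def Zero_fract_def
        by (simp del: fract_collapse) (rule exI[of _ 0], rule exI[of _ 1], simp)
    qed
  next
    case False
    show ?thesis
    proof (cases "s = 0")
      case True
      obtain a b where ab: "a \<noteq> 0" "b \<noteq> 0" "z = Fract a b" using Fract_nonzero_cases \<open>z \<noteq> 0\<close> .
      then have "degree a < degree b" using z True False
        by (simp add: vmax_def indexed_val_def inf_val_def fract_ext_Fract[OF additive_degree])
      then show ?thesis using ab True unfolding base_place_def infinite_place_def by auto
    next
      case s: False
      then have irr: "irreducible (p s)" using p_irreducible assms by auto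
      have pos: "0 < fin_val (p s) z" using z False s by (simp add: vmax_def indexed_val_def)
      then have "z \<in> vring (fin_val (p s))" by (simp add: vring_def)
      then obtain n a b where ab: "z = to_fract (p s) ^ n * to_fract a / to_fract b" "b \<noteq> 0" "\<not> p s dvd b"
        using fin_val_vring[OF irr _ False] by blast
      have z_eq: "z = Fract (p s ^ n * a) b"
        using ab(1) by (simp add: Fract_conv_to_fract to_fract_mult to_fract_power)
      have nz: "p s ^ n * a \<noteq> 0" 
      proof
        assume "p s ^ n * a = 0"
        then have "z = Fract 0 b" using z_eq by (simp only:)
        then show False using False by (simp add: fract_collapse)
      qed
      have "0 < pmult (p s) (p s ^ n * a)"
        using pos unfolding z_eq by (simp add: fin_val_def fract_ext_Fract[OF additive_pmult[OF irr] nz ab(2)])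
      then have "p s dvd p s ^ n * a" using pmult_eq_0[OF irr, of "p s ^ n * a"] by auto
      then show ?thesis using s ab(3) z_eq by (auto simp: base_place_def finite_place_def)
    qed
  qed
qed

text \<open>With \<open>u = y\<^sup>-\<^sup>l\<close> the exponent at the totally ramified place becomes \<open>-1\<close> modulo \<open>m\<close>.\<close>

lemma totally_ramified:
  assumes s: "s \<le> r" and Q: "place_above emb Q (base_place p s)"
    and l: "[l * place_exp r p lam s = 1] (mod int m)"
  shows "totally_ramified_extension emb m (y powi (- l)) (radicand powi (- l)) (indexed_val p s) Q"
    and "int m dvd indexed_val p s (radicand powi (- l)) + 1"
proof -
  interpret field_embedding emb by (rule emb_embedding)
  have bv: "indexed_val p s \<in> base_vals" by (rule indexed_val_base[OF p_monic_irreducibles s])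
  have y0: "y \<noteq> 0" using y_power radicand_nz m_ge_2 by (auto simp: power_0_left)
  obtain t where t: "l * place_exp r p lam s - 1 = int m * t"
    using l by (auto simp: cong_iff_dvd_diff elim!: dvdE)
  have v: "indexed_val p s (radicand powi (- l)) = - (l * place_exp r p lam s)"
    using valuation.val_power_int[OF valuation_base_vals[OF bv] radicand_nz] indexed_val_radicand[OF s] by simp
  have eq: "indexed_val p s (radicand powi (- l)) + 1 = - (int m * t)" using v t by simp
  then show "int m dvd indexed_val p s (radicand powi (- l)) + 1" by simp
  show "totally_ramified_extension emb m (y powi (- l)) (radicand powi (- l)) (indexed_val p s) Q"
  proof
    show "m > 0" using m_ge_2 by simp
    show "radicand powi (- l) \<noteq> 0" using radicand_nz by simp
    have "(y powi (- l)) ^ m = (y ^ m) powi (- l)"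
      by (simp add: mult.commute flip: power_int_of_nat power_int_mult)
    then show "(y powi (- l)) ^ m = emb (radicand powi (- l))" by (simp add: y_power emb_power_int)
    show "indexed_val p s \<in> base_vals" by (rule bv)
    show "place (constants emb) Q" using Q by (simp add: place_above_def)
    show "emb ` vmax (indexed_val p s) \<subseteq> Q"
      using Q vmax_base_place[OF s] by (auto simp: place_above_def)
    have "coprime (- 1 - int m * t) (int m)"
    proof (rule coprimeI)
      fix d assume "d dvd - 1 - int m * t" "d dvd int m"
      then have "d dvd (- 1 - int m * t) + int m * t" by (intro dvd_add) auto
      then show "is_unit d" by simp
    qed
    moreover have "indexed_val p s (radicand powi (- l)) = - 1 - int m * t" using eq by linarith
    ultimately show "coprime (indexed_val p s (radicand powi (- l))) (int m)" by (simp only:)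
    show "of_nat m \<noteq> (0 :: 'k)" by (rule m_nonzero)
  next
    fix L assume L: "is_subfield L" "range emb \<subseteq> L" "y powi (- l) \<in> L"
    \<comment> \<open>Since \<open>l * place_exp r p lam s - int m * t = 1\<close>, \<open>y\<close>
      is a power of \<open>u\<close> times an element of K(x); so \<open>u\<close> generates F as
      well.\<close>
    have "(y powi (- l)) powi (- place_exp r p lam s) * emb (radicand powi (- t)) =
        y powi (l * place_exp r p lam s) * (y ^ m) powi (- t)"
      by (simp add: y_power emb_power_int flip: power_int_mult)
    also have "\<dots> = y powi (l * place_exp r p lam s - int m * t)"
      using y0 by (simp add: power_int_diff power_int_minus divide_inverse power_int_mult)
    also have "l * place_exp r p lam s - int m * t = 1" using t by simp
    finally have y: "(y powi (- l)) powi (- place_exp r p lam s) * emb (radicand powi (- t)) = y" by simp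
    have "(y powi (- l)) powi (- place_exp r p lam s) \<in> L" by (rule is_subfield_powi[OF L(1,3)])
    moreover have "emb (radicand powi (- t)) \<in> L" using L(2) by blast
    ultimately have "y \<in> L" using L(1) y unfolding is_subfield_def by metis
    then show "L = UNIV" using F_generated L by blast
  qed
qed

end

text \<open>The argmax is read as the largest index attaining the maximum, the one that gives the
  largest gap; \<open>j_max\<close> is an integer because it is -1 when there are no gaps. The
  condition \<open>place_deg p s = 1\<close> expresses that Q_s is rational.\<close>

theorem corollary3p9:
  fixes q m r s :: nat and Fq :: "'k::field set"
    and \<alpha> :: 'k and p :: "nat \<Rightarrow> 'k poly" and lam :: "nat \<Rightarrow> int"
    and emb :: "'k poly fract \<Rightarrow> 'f::field" and y :: 'f and Q\<^sub>s :: "'f set"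
    and l :: int and S :: "nat set" and i_min i_max :: nat and j_max :: int
  assumes "kummer_extension q Fq m r \<alpha> p lam emb y"
    and "s \<le> r"
    and "place_deg p s = 1"
    and "gcd (int m) (place_exp r p lam s) = 1"
    and "place_above emb Q\<^sub>s (base_place p s)"
    and "[l * place_exp r p lam s = 1] (mod int m)"
    and "S = {i \<in> {1..m - 1}. ceiling_sum m r p lam l i - 1 = 0} \<union> {m}"
    and "i_min = Min S"
    and "j_max = Max ((\<lambda>i. ceiling_sum m r p lam l i - 2) ` {1..m - 1})"
    and "i_max = Max {i \<in> {1..m - 1}. ceiling_sum m r p lam l i - 2 = j_max}"
  shows "semigroup_multiplicity (weierstrass_semigroup (constants emb) Q\<^sub>s) = i_min
    \<and> frobenius_number (weierstrass_semigroup (constants emb) Q\<^sub>s) = int m * j_max + int i_max"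
proof -
  interpret kummer_extension q Fq m r \<alpha> p lam emb y by fact
  let ?h = "radicand powi (- l)"
  interpret F: totally_ramified_extension emb m "y powi (- l)" ?h "indexed_val p s" Q\<^sub>s
    by (rule totally_ramified(1)[OF assms(2,5,6)])
  have dvd: "int m dvd indexed_val p s ?h + 1" by (rule totally_ramified(2)[OF assms(2,5,6)])
  have m: "m > 0" using m_ge_2 by simp
  have val_h: "v ?h = - l * v radicand" if "v \<in> base_vals" for v
    using valuation.val_power_int[OF valuation_base_vals[OF that] radicand_nz] by simp
  have val_h_k: "indexed_val p k ?h = - l * place_exp r p lam k" if "k \<le> r" for k
    using val_h[OF indexed_val_base[OF p_monic_irreducibles that]] indexed_val_radicand[OF that] by simp
  have c_eq: "ceiling_sum m r p lam l i =
      (\<Sum>k=0..r. - (int i * indexed_val p k ?h div int m) * int (place_deg p k))" for i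
    unfolding ceiling_sum_def
  proof (intro sum.cong refl)
    fix k assume "k \<in> {0..r}"
    then have eq: "int i * indexed_val p k ?h = - (int i * l * place_exp r p lam k)" by (simp add: val_h_k)
    have "\<lceil>real_of_int (int i * l * place_exp r p lam k) / real m\<rceil> =
        - (- (int i * l * place_exp r p lam k) div int m)"
      using ceiling_divide_eq_div[of "int i * l * place_exp r p lam k" "int m", where 'a=real] by simp
    then show "\<lceil>real_of_int (int i * l * place_exp r p lam k) / real m\<rceil> * int (place_deg p k) =
        - (int i * indexed_val p k ?h div int m) * int (place_deg p k)" by (simp only: eq)
  qed
  \<comment> \<open>The sum of the unrounded terms is 0. Rounding up never decreases a term, and
    strictly increases the one at \<open>s\<close>, where \<open>l\<close> times the exponent is 1
    modulo \<open>m\<close> and \<open>0 < i < m\<close>.\<close>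
  have c1: "1 \<le> ceiling_sum m r p lam l i" if i: "0 < i" "i < m" for i
  proof -
    let ?N = "\<lambda>k. - (int i * indexed_val p k ?h div int m)"
    have le: "- (int i * indexed_val p k ?h) \<le> int m * ?N k" for k
    proof -
      let ?x = "int i * indexed_val p k ?h"
      have "int m * (?x div int m) + ?x mod int m = ?x" by (rule mult_div_mod_eq)
      moreover have "0 \<le> ?x mod int m" using m by simp
      ultimately show ?thesis by linarith
    qed
    have lt: "- (int i * indexed_val p s ?h) < int m * ?N s"
      using neg_mult_div_of_cong[OF dvd i(2)] i by simp
    have "0 = (int i * l) * (\<Sum>k=0..r. place_exp r p lam k * int (place_deg p k))"
      by (simp add: place_exp_sum)
    also have "\<dots> = (\<Sum>k=0..r. - (int i * indexed_val p k ?h) * int (place_deg p k))"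
      unfolding sum_distrib_left by (intro sum.cong refl) (simp add: val_h_k mult_ac)
    also have "\<dots> < (\<Sum>k=0..r. int m * ?N k * int (place_deg p k))"
    proof (rule sum_strict_mono_ex1)
      show "\<forall>k\<in>{0..r}. - (int i * indexed_val p k ?h) * int (place_deg p k) \<le> int m * ?N k * int (place_deg p k)"
        using le by (intro ballI mult_right_mono) auto
      show "\<exists>k\<in>{0..r}. - (int i * indexed_val p k ?h) * int (place_deg p k) < int m * ?N k * int (place_deg p k)"
        using lt assms(2,3) by (intro bexI[of _ s]) auto
    qed simp
    also have "\<dots> = int m * ceiling_sum m r p lam l i"
      unfolding c_eq sum_distrib_left by (simp add: mult_ac)
    finally show ?thesis using m by (simp add: zero_less_mult_iff)
  qed
  have mem: "n \<in> weierstrass_semigroup (constants emb) Q\<^sub>s \<longleftrightarrow>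
      ceiling_sum m r p lam l (n mod m) \<le> int (n div m) + (if n mod m = 0 then 0 else 1)" if "n > 0" for n
    unfolding c_eq
  proof (rule F.weierstrass_semigroup_ceilings[OF p_distinct p_monic_irreducibles assms(2,3) refl _ dvd that])
    show "v ?h = 0" if "v \<in> base_vals" "v \<notin> indexed_val p ` {0..r}" for v
      using val_h[OF that(1)] other_val_radicand[OF that] by simp
  qed
  have c0: "ceiling_sum m r p lam l 0 = 0" by (simp add: ceiling_sum_def)
  show ?thesis
    unfolding assms(8) assms(7)
    using multiplicity_and_frobenius(1)[OF m_ge_2 F.zero_in_weierstrass_semigroup mem c0 c1]
      multiplicity_and_frobenius(2)[OF m_ge_2 F.zero_in_weierstrass_semigroup mem c0 c1 assms(9,10)]
    by simp
qed

end
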